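(* $\mathcal U=W_1\cup W_2\cup W_3$.
   Context: Fix real numbers $a<b$. $\boldsymbol{B_1}$ is the algebra of smooth functions $P:[a,b]\to\mathbb C$, and $\boldsymbol{B}_1^{+}=\{P\in\boldsymbol{B_1}: P(x)\ne0 \text{ for all } x\in[a,b]\}$. $\Delta=\{(x,y): a\le y\le x\le b\}$, and $\boldsymbol{B_2}$ is the algebra of smooth functions $f:\Delta\to\mathbb C$ (all partial derivatives of all orders exist and are continuous on $\Delta$). $M[a,b]$ is the space of all smooth $\phi:[a,b]\to\mathbb C$ all of whose derivatives (including order $0$) vanish at $a$. $\widehat I_M$ is the subalgebra of $\mathrm{End}_{\mathbb C}(M[a,b])$ generated by the operators $\phi\mapsto P\phi$ ($P\in\boldsymbol{B_1}$), $\partial_x:\phi\mapsto\phi'$, and $f(x,y)\theta(x-y):\phi\mapsto\int_a^xf(x,z)\phi(z)\,dz$ ($f\in\boldsymbol{B_2}$). Every element of $\widehat I_M$ is uniquely a sum $\big(\sum_{i=1}^nP_i\partial_x^i+P_0\big)+f(x,y)\theta(x-y)$. $\mathbb I^{*}$ is an isomorphic copy of $\widehat I_M$, in which this element is written $\big(\sum_{i=1}^nP_i\partial_x^i+P_0\big)\widehat\beta+f(x,y)\widehat\theta$ and the product (corresponding to composition) is denoted $\bullet$, with identity $\widehat\beta$. For $\Psi=\big(\sum_{i=1}^nP_i\partial_x^i+P_0\big)\widehat\beta+g(x,y)\widehat\theta\in\mathbb I^*$, $\deg_{\widehat\beta}[\Psi]$ is the largest $i\ge1$ such that $P_i$ is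 not identically zero, and is $0$ if $P_i\equiv0$ for all $i\ge1$; $\mathrm{Coef}[\Psi]=P_d$ where $d=\deg_{\widehat\beta}[\Psi]$. The following elements are invertible in $\mathbb I^*$: (type 1) $P_0\widehat\beta$ with $P_0\in\boldsymbol{B}_1^+$; (type 2) $P_0\widehat\beta+f\widehat\theta$ with $P_0\in\boldsymbol{B}_1^+$, $f\in\boldsymbol{B_2}$, $f\widehat\theta\neq0$; (type 3) $\big(\sum_{i=1}^nP_i\partial_x^i+P_0\big)\widehat\beta+f\widehat\theta$ with $n\ge1$, $P_i\in\boldsymbol{B_1}$, $P_n\in\boldsymbol{B}_1^+$, $f\in\boldsymbol{B_2}$. $\mathcal U$ is the subgroup of the group of units of $\mathbb I^*$ generated by all elements of types 1, 2 and 3. Define $W_1=\{\Psi\in\mathbb I^*:\deg_{\widehat\beta}[\Psi]=0,\ \mathrm{Coef}[\Psi]\in\boldsymbol{B}_1^+\}$, $W_2=\{\Psi\in\mathbb I^*:\deg_{\widehat\beta}[\Psi]\ge1,\ \mathrm{Coef}[\Psi]\in\boldsymbol{B}_1^+\}$, $W_3=\{\Psi\in\mathbb I^*:\Psi\text{ is invertible},\ \deg_{\widehat\beta}[\Psi^{-1}]\ge1,\ \mathrm{Coef}[\Psi^{-1}]\in\boldsymbol{B}_1^+\}$. *)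

theory Defs
  imports "HOL-Analysis.Analysis" "HOL-Algebra.QuotRing" "HOL-Algebra.Generated_Groups"
begin

text \<open>A function on a subset \<open>S\<close> of a type is represented by an element of
  \<open>extensional S\<close>, so that equality of functions on \<open>S\<close> is equality in HOL. The same convention
  is used for operators on the function space \<open>M a b\<close>.\<close>

definition deriv_on :: "real \<Rightarrow> real \<Rightarrow> (real \<Rightarrow> complex) \<Rightarrow> real \<Rightarrow> complex" where
  "deriv_on a b \<phi> = (\<lambda>x\<in>{a..b}. vector_derivative \<phi> (at x within {a..b}))"

definition B1 :: "real \<Rightarrow> real \<Rightarrow> (real \<Rightarrow> complex) set" where
  "B1 a b = {P \<in> extensional {a..b}. \<forall>k. (deriv_on a b ^^ k) P differentiable_on {a..b}}"

definition B1_plus :: "real \<Rightarrow> real \<Rightarrow> (real \<Rightarrow> complex) set" where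
  "B1_plus a b = {P \<in> B1 a b. \<forall>x\<in>{a..b}. P x \<noteq> 0}"

definition triangle :: "real \<Rightarrow> real \<Rightarrow> (real \<times> real) set" where
  "triangle a b = {(x, y). a \<le> y \<and> y \<le> x \<and> x \<le> b}"

text \<open>In the next definition \<open>D i j\<close> is the partial derivative of order \<open>i\<close> in \<open>x\<close> and \<open>j\<close> in \<open>y\<close>.
  Partial derivatives are taken along the slices of the closed triangle (one-sided at its
  boundary). At the corner \<open>(a, a)\<close> the slice in direction \<open>y\<close> is a single point, as is the slice
  in direction \<open>x\<close> at \<open>(b, b)\<close>; there the derivative condition is void, and the value of the
  partial derivative is determined by continuity.\<close>

definition B2 :: "real \<Rightarrow> real \<Rightarrow> (real \<times> real \<Rightarrow> complex) set" where
  "B2 a b = {f \<in> extensional (triangle a b).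
     \<exists>D :: nat \<Rightarrow> nat \<Rightarrow> real \<times> real \<Rightarrow> complex. D 0 0 = f \<and>
       (\<forall>i j. continuous_on (triangle a b) (D i j) \<and>
          (\<forall>x y. (x, y) \<in> triangle a b \<longrightarrow>
             ((\<lambda>t. D i j (t, y)) has_vector_derivative D (Suc i) j (x, y)) (at x within {y..b}) \<and>
             ((\<lambda>t. D i j (x, t)) has_vector_derivative D i (Suc j) (x, y)) (at y within {a..x})))}"

definition M :: "real \<Rightarrow> real \<Rightarrow> (real \<Rightarrow> complex) set" where
  "M a b = {\<phi> \<in> B1 a b. \<forall>k. (deriv_on a b ^^ k) \<phi> a = 0}"

type_synonym operator = "(real \<Rightarrow> complex) \<Rightarrow> real \<Rightarrow> complex"

definition add_op :: "real \<Rightarrow> real \<Rightarrow> operator \<Rightarrow> operator \<Rightarrow> operator" where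
  "add_op a b S T = (\<lambda>\<phi>\<in>M a b. \<lambda>x\<in>{a..b}. S \<phi> x + T \<phi> x)"

definition scale_op :: "real \<Rightarrow> real \<Rightarrow> complex \<Rightarrow> operator \<Rightarrow> operator" where
  "scale_op a b c T = (\<lambda>\<phi>\<in>M a b. \<lambda>x\<in>{a..b}. c * T \<phi> x)"

definition End_M :: "real \<Rightarrow> real \<Rightarrow> operator ring" where
  "End_M a b =
    \<lparr>carrier = {T \<in> M a b \<rightarrow>\<^sub>E M a b.
       (\<forall>\<phi>\<in>M a b. \<forall>\<psi>\<in>M a b.
          T (\<lambda>x\<in>{a..b}. \<phi> x + \<psi> x) = (\<lambda>x\<in>{a..b}. T \<phi> x + T \<psi> x)) \<and>
       (\<forall>c. \<forall>\<phi>\<in>M a b. T (\<lambda>x\<in>{a..b}. c * \<phi> x) = (\<lambda>x\<in>{a..b}. c * T \<phi> x))},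
     mult = compose (M a b),
     one = (\<lambda>\<phi>\<in>M a b. \<phi>),
     zero = (\<lambda>\<phi>\<in>M a b. \<lambda>x\<in>{a..b}. 0),
     add = add_op a b\<rparr>"

definition mult_op :: "real \<Rightarrow> real \<Rightarrow> (real \<Rightarrow> complex) \<Rightarrow> operator" where
  "mult_op a b P = (\<lambda>\<phi>\<in>M a b. \<lambda>x\<in>{a..b}. P x * \<phi> x)"

definition diff_op :: "real \<Rightarrow> real \<Rightarrow> operator" where
  "diff_op a b = (\<lambda>\<phi>\<in>M a b. deriv_on a b \<phi>)"

definition int_op :: "real \<Rightarrow> real \<Rightarrow> (real \<times> real \<Rightarrow> complex) \<Rightarrow> operator" where
  "int_op a b f = (\<lambda>\<phi>\<in>M a b. \<lambda>x\<in>{a..b}. integral {a..x} (\<lambda>z. f (x, z) * \<phi> z))"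

inductive_set I_M_carrier :: "real \<Rightarrow> real \<Rightarrow> operator set" for a b :: real where
  mult_op: "P \<in> B1 a b \<Longrightarrow> mult_op a b P \<in> I_M_carrier a b"
| diff_op: "diff_op a b \<in> I_M_carrier a b"
| int_op: "f \<in> B2 a b \<Longrightarrow> int_op a b f \<in> I_M_carrier a b"
| add: "S \<in> I_M_carrier a b \<Longrightarrow> T \<in> I_M_carrier a b \<Longrightarrow> add_op a b S T \<in> I_M_carrier a b"
| scale: "T \<in> I_M_carrier a b \<Longrightarrow> scale_op a b c T \<in> I_M_carrier a b"
| comp: "S \<in> I_M_carrier a b \<Longrightarrow> T \<in> I_M_carrier a b \<Longrightarrow> compose (M a b) S T \<in> I_M_carrier a b"

definition I_M :: "real \<Rightarrow> real \<Rightarrow> operator ring" where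
  "I_M a b = (End_M a b)\<lparr>carrier := I_M_carrier a b\<rparr>"

definition normal_op ::
  "real \<Rightarrow> real \<Rightarrow> nat \<Rightarrow> (nat \<Rightarrow> real \<Rightarrow> complex) \<Rightarrow> (real \<times> real \<Rightarrow> complex) \<Rightarrow> operator" where
  "normal_op a b n P f = (\<lambda>\<phi>\<in>M a b. \<lambda>x\<in>{a..b}.
     (\<Sum>i=1..n. P i x * (diff_op a b ^^ i) \<phi> x) + mult_op a b (P 0) \<phi> x + int_op a b f \<phi> x)"

definition zero1 :: "real \<Rightarrow> real \<Rightarrow> real \<Rightarrow> complex" where
  "zero1 a b = (\<lambda>x\<in>{a..b}. 0)"

definition zero2 :: "real \<Rightarrow> real \<Rightarrow> real \<times> real \<Rightarrow> complex" where
  "zero2 a b = (\<lambda>p\<in>triangle a b. 0)"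

text \<open>From here on, \<open>I\<close> is an isomorphic copy of \<open>I_M a b\<close> and \<open>j\<close> is the isomorphism from
  \<open>I_M a b\<close> to \<open>I\<close>. The element
  \<open>(P\<^sub>n \<partial>\<^sub>x\<^sup>n + \<dots> + P\<^sub>1 \<partial>\<^sub>x + P\<^sub>0) \<beta> + f \<theta>\<close> of \<open>I\<close> is \<open>elt a b j n P f\<close>.\<close>

definition elt :: "real \<Rightarrow> real \<Rightarrow> (operator \<Rightarrow> 'i) \<Rightarrow> nat \<Rightarrow> (nat \<Rightarrow> real \<Rightarrow> complex) \<Rightarrow>
    (real \<times> real \<Rightarrow> complex) \<Rightarrow> 'i" where
  "elt a b j n P f = j (normal_op a b n P f)"

text \<open>The coefficient sequence of an element, padded by zeros beyond its order; it is unique since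
  the representation of an element as a sum is.\<close>

definition coeffs :: "real \<Rightarrow> real \<Rightarrow> (operator \<Rightarrow> 'i) \<Rightarrow> 'i \<Rightarrow> nat \<Rightarrow> real \<Rightarrow> complex" where
  "coeffs a b j \<Psi> = (THE P. \<exists>n. \<exists>f\<in>B2 a b.
     (\<forall>i. P i \<in> B1 a b) \<and> (\<forall>i>n. P i = zero1 a b) \<and> \<Psi> = elt a b j n P f)"

definition deg :: "real \<Rightarrow> real \<Rightarrow> (operator \<Rightarrow> 'i) \<Rightarrow> 'i \<Rightarrow> nat" where
  "deg a b j \<Psi> =
    (if \<forall>i\<ge>1. coeffs a b j \<Psi> i = zero1 a b then 0
     else GREATEST i. 1 \<le> i \<and> coeffs a b j \<Psi> i \<noteq> zero1 a b)"

definition Coef :: "real \<Rightarrow> real \<Rightarrow> (operator \<Rightarrow> 'i) \<Rightarrow> 'i \<Rightarrow> real \<Rightarrow> complex" where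
  "Coef a b j \<Psi> = coeffs a b j \<Psi> (deg a b j \<Psi>)"

definition type1 :: "real \<Rightarrow> real \<Rightarrow> (operator \<Rightarrow> 'i) \<Rightarrow> 'i set" where
  "type1 a b j = {elt a b j 0 (\<lambda>_. P) (zero2 a b) | P. P \<in> B1_plus a b}"

definition type2 :: "real \<Rightarrow> real \<Rightarrow> ('i, 'm) ring_scheme \<Rightarrow> (operator \<Rightarrow> 'i) \<Rightarrow> 'i set" where
  "type2 a b I j = {elt a b j 0 (\<lambda>_. P) f | P f.
     P \<in> B1_plus a b \<and> f \<in> B2 a b \<and> elt a b j 0 (\<lambda>_. zero1 a b) f \<noteq> \<zero>\<^bsub>I\<^esub>}"

definition type3 :: "real \<Rightarrow> real \<Rightarrow> (operator \<Rightarrow> 'i) \<Rightarrow> 'i set" where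
  "type3 a b j = {elt a b j n P f | n P f.
     1 \<le> n \<and> (\<forall>i\<le>n. P i \<in> B1 a b) \<and> P n \<in> B1_plus a b \<and> f \<in> B2 a b}"

definition U :: "real \<Rightarrow> real \<Rightarrow> ('i, 'm) ring_scheme \<Rightarrow> (operator \<Rightarrow> 'i) \<Rightarrow> 'i set" where
  "U a b I j = generate (units_of I) (type1 a b j \<union> type2 a b I j \<union> type3 a b j)"

definition W1 :: "real \<Rightarrow> real \<Rightarrow> ('i, 'm) ring_scheme \<Rightarrow> (operator \<Rightarrow> 'i) \<Rightarrow> 'i set" where
  "W1 a b I j = {\<Psi> \<in> carrier I. deg a b j \<Psi> = 0 \<and> Coef a b j \<Psi> \<in> B1_plus a b}"

definition W2 :: "real \<Rightarrow> real \<Rightarrow> ('i, 'm) ring_scheme \<Rightarrow> (operator \<Rightarrow> 'i) \<Rightarrow> 'i set" where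
  "W2 a b I j = {\<Psi> \<in> carrier I. 1 \<le> deg a b j \<Psi> \<and> Coef a b j \<Psi> \<in> B1_plus a b}"

definition W3 :: "real \<Rightarrow> real \<Rightarrow> ('i, 'm) ring_scheme \<Rightarrow> (operator \<Rightarrow> 'i) \<Rightarrow> 'i set" where
  "W3 a b I j = {\<Psi> \<in> Units I.
     1 \<le> deg a b j (inv\<^bsub>I\<^esub> \<Psi>) \<and> Coef a b j (inv\<^bsub>I\<^esub> \<Psi>) \<in> B1_plus a b}"

end

theory Submission
  imports Defs
begin

text \<open>
Because every derivative of a function in \<open>M a b\<close> vanishes at \<open>a\<close>, differentiation is bijective on
\<open>M a b\<close>: its inverse \<open>\<tau>\<close> is integration from \<open>a\<close>. An operator of order \<open>n\<close> with leading coefficient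
\<open>P\<close> is therefore a product \<open>(P + f \<theta>) \<partial>\<^sup>n\<close>, since a lower term \<open>P\<^sub>i \<partial>\<^sup>i\<close> equals
\<open>P\<^sub>i \<tau>\<^bsup>n-i\<^esup> \<partial>\<^sup>n\<close> and \<open>P\<^sub>i \<tau>\<^bsup>n-i\<^esup>\<close> is an integral operator with smooth kernel
(\<open>elt_eq_leading_form\<close>, with converse \<open>leading_form_eq_elt\<close>).

Let \<open>Order0\<close> be the set of the operators \<open>P + f \<theta>\<close> with nowhere vanishing \<open>P\<close>. It is a group: inverting
\<open>1 + f \<theta>\<close> means solving a Volterra equation of the second kind, whose Neumann series converges and
whose resolvent kernel is again smooth (\<open>smooth_quasi_inverse\<close>). Leibniz' rule and integration by
parts give \<open>\<partial> (P + f \<theta>) = P \<partial> + (P' + f(x,x)) + f\<^sub>x \<theta>\<close> and \<open>(f \<theta>) \<partial> = f(x,x) - f\<^sub>y \<theta>\<close>, and they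
show that \<open>\<partial>\<close> normalizes \<open>Order0\<close> (\<open>\<delta>_vol_commute_left\<close>, \<open>\<delta>_vol_commute_right\<close>).

The three types of generators together are exactly the elements \<open>e \<partial>\<^sup>n\<close> with \<open>e\<close> in \<open>Order0\<close> and
\<open>n \<ge> 0\<close>, so the group that they generate is the union of the cosets \<open>Order0 \<partial>\<^sup>m\<close> over all integers \<open>m\<close>
(\<open>generate_by_powers_of_normalizing_element\<close>). The coset with \<open>m = 0\<close> is \<open>W1\<close>, those with \<open>m > 0\<close> make
up \<open>W2\<close>, and those with \<open>m < 0\<close> consist of the inverses of elements of \<open>W2\<close> and make up \<open>W3\<close>.

To read degree and leading coefficient off the factorization, the coefficients of an operator have to
be unique. By cancelling powers of \<open>\<partial>\<close> this reduces to order zero: \<open>P + f \<theta> = Q + g \<theta>\<close> implies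
\<open>P = Q\<close>. Applying both sides to flat functions that concentrate near the right end of \<open>[a, y]\<close>
recovers the value at \<open>y\<close> of the multiplication part (\<open>vop_eq_imp_multiplier_eq\<close>).
\<close>

section \<open>Integrals with a variable endpoint\<close>

text \<open>The substitution \<open>z = y + (x - y) s\<close> moves the endpoints into the integrand, so that dependence on
them is governed by theorems about parameters over a fixed interval.\<close>

lemma integral_as_unit_integral:
  fixes h :: "real \<Rightarrow> complex"
  assumes "y \<le> x" and "continuous_on {y..x} h"
  shows "integral {y..x} h = of_real (x - y) * integral {0..1} (\<lambda>s. h (y + (x - y) * s))"
proof (cases "y = x")
  case True
  then show ?thesis by simp
next
  case False
  with assms have pos: "x - y > 0" by simp
  have "(h has_integral integral {y..x} h) (cbox y x)"
    using assms by (simp add: integrable_continuous_real integrable_integral)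
  from has_integral_affinity'[OF this pos, of y]
  have "((\<lambda>s. h (y + (x - y) * s)) has_integral (integral {y..x} h /\<^sub>R (x - y))) {0..1}"
    using pos by (simp add: add.commute)
  then have "integral {0..1} (\<lambda>s. h (y + (x - y) * s)) = integral {y..x} h /\<^sub>R (x - y)"
    by (rule integral_unique)
  then show ?thesis using pos by (simp add: scaleR_conv_of_real field_simps)
qed

lemma affine_combination_bounds:
  fixes x y s l r :: real
  assumes "l \<le> y" "y \<le> x" "x \<le> r" "0 \<le> s" "s \<le> 1"
  shows "l \<le> y + (x - y) * s" "y + (x - y) * s \<le> r"
proof -
  have "0 \<le> (x - y) * s" using assms by simp
  then show "l \<le> y + (x - y) * s" using assms(1) by linarith
  have "(x - y) * s \<le> x - y" using mult_left_mono[of s 1 "x - y"] assms by simp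
  then show "y + (x - y) * s \<le> r" using assms(3) by linarith
qed

lemma continuous_on_variable_integral:
  fixes K :: "'p::topological_space \<Rightarrow> real \<Rightarrow> complex" and l u :: "'p \<Rightarrow> real"
  assumes le: "\<And>p. p \<in> S \<Longrightarrow> l p \<le> u p"
    and l: "continuous_on S l" and u: "continuous_on S u"
    and K: "continuous_on {(p, z). p \<in> S \<and> l p \<le> z \<and> z \<le> u p} (\<lambda>(p, z). K p z)"
  shows "continuous_on S (\<lambda>p. integral {l p..u p} (K p))"
proof -
  have sl: "continuous_on {l p..u p} (K p)" if "p \<in> S" for p
    using that by (intro continuous_on_compose2[OF K, where f="\<lambda>z. (p, z)", simplified])
      (auto intro!: continuous_intros)
  have "continuous_on (S \<times> {0..1}) (\<lambda>(p, s). K p (l p + (u p - l p) * s))"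
    unfolding split_def
    by (rule continuous_on_compose2[OF K, where f="\<lambda>q. (fst q, l (fst q) + (u (fst q) - l (fst q)) * snd q)", simplified split_def fst_conv snd_conv])
      (auto intro!: continuous_intros continuous_on_compose2[OF l] continuous_on_compose2[OF u]
        affine_combination_bounds mult_nonneg_nonneg simp: le)
  then have "continuous_on S (\<lambda>p. integral (cbox 0 1) (\<lambda>s. K p (l p + (u p - l p) * s)))"
    by (intro integral_continuous_on_param) simp
  then have "continuous_on S (\<lambda>p. of_real (u p - l p) * integral {0..1} (\<lambda>s. K p (l p + (u p - l p) * s)))"
    using l u by (auto intro!: continuous_intros)
  then show ?thesis
    by (rule continuous_on_eq) (simp add: integral_as_unit_integral[OF le sl])
qed

lemma mem_triangle [simp]: "(x, y) \<in> triangle a b \<longleftrightarrow> a \<le> y \<and> y \<le> x \<and> x \<le> b"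
  by (simp add: triangle_def)

lemma continuous_on_triangle_compose:
  assumes "continuous_on (triangle a b) h" "continuous_on S f" "continuous_on S g"
    and "\<And>p. p \<in> S \<Longrightarrow> a \<le> g p \<and> g p \<le> f p \<and> f p \<le> b"
  shows "continuous_on S (\<lambda>p. h (f p, g p))"
  by (rule continuous_on_compose2[OF assms(1)]) (use assms in \<open>auto intro!: continuous_on_Pair\<close>)

lemma compact_triangle: "compact (triangle a b)"
proof -
  have "triangle a b = ({a..b} \<times> {a..b}) \<inter> {p. snd p \<le> fst p}" by (auto simp: triangle_def)
  moreover have "closed {p::real\<times>real. snd p \<le> fst p}"
    by (intro closed_Collect_le continuous_intros)
  ultimately show ?thesis by (simp add: compact_Times compact_Int_closed)
qed

text \<open>If the difference quotient of \<open>G\<close> extends continuously to the diagonal, its diagonal value is the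
derivative. This form needs the quotient only for \<open>y \<le> x\<close>, which is all that a function on the
triangle provides.\<close>

lemma hadamard_quotient:
  fixes G :: "real \<Rightarrow> complex"
  assumes H: "continuous_on (triangle c d) H"
    and G: "\<And>x y. (x, y) \<in> triangle c d \<Longrightarrow> G x - G y = of_real (x - y) * H (x, y)"
    and x: "x \<in> {c..d}"
  shows "(G has_vector_derivative H (x, x)) (at x within {c..d})"
proof -
  \<comment> \<open>The two orders of the points \<open>t\<close> and \<open>x\<close> are covered by one continuous function.\<close>
  let ?q = "\<lambda>t. H (max t x, min t x)"
  have "continuous_on {c..d} ?q"
    using x by (intro continuous_on_triangle_compose[OF H] continuous_intros) auto
  then have "(?q \<longlongrightarrow> ?q x) (at x within {c..d})"
    using x by (simp only: continuous_on_def)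
  then have "(?q \<longlongrightarrow> H (x, x)) (at x within {c..d})" by simp
  moreover have "?q t = (G t - G x) /\<^sub>R (t - x)" if "t \<in> {c..d}" "t \<noteq> x" for t
  proof (cases "x < t")
    case True
    then show ?thesis using G[of t x] that x by (simp add: max_def min_def scaleR_conv_of_real field_simps)
  next
    case False
    then have "G x - G t = of_real (x - t) * H (x, t)" "max t x = x" "min t x = t"
      using G[of x t] that x by auto
    moreover have "of_real (x - t) \<noteq> (0::complex)" using that by simp
    ultimately show ?thesis by (simp add: scaleR_conv_of_real field_simps)
  qed
  ultimately have "((\<lambda>t. (G t - G x) /\<^sub>R (t - x)) \<longlongrightarrow> H (x, x)) (at x within {c..d})"
    by (subst (asm) Lim_cong_within[OF refl refl refl]) auto
  then have "((\<lambda>t. norm ((G t - G x) /\<^sub>R (t - x) - H (x, x))) \<longlongrightarrow> 0) (at x within {c..d})"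
    by (simp add: LIM_zero tendsto_norm_zero)
  moreover have "norm ((G t - G x) /\<^sub>R (t - x) - H (x, x)) =
      norm ((1 / norm (t - x)) *\<^sub>R (G t - (G x + (t - x) *\<^sub>R H (x, x))))" if "t \<noteq> x" for t
  proof -
    have "G t - (G x + (t - x) *\<^sub>R H (x, x)) = (t - x) *\<^sub>R ((G t - G x) /\<^sub>R (t - x) - H (x, x))"
      using that by (simp add: scaleR_right_diff_distrib)
    then show ?thesis using that by simp
  qed
  ultimately have "((\<lambda>t. norm ((1 / norm (t - x)) *\<^sub>R (G t - (G x + (t - x) *\<^sub>R H (x, x))))) \<longlongrightarrow> 0)
      (at x within {c..d})"
    by (subst (asm) Lim_cong_within[OF refl refl refl]) auto
  then show ?thesis
    unfolding has_vector_derivative_def has_derivative_within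
    by (blast intro: tendsto_norm_zero_cancel bounded_linear_scaleR_left)
qed

text \<open>Partial derivatives along the slices of the closed triangle, in the sense used to define \<open>B2\<close>.\<close>

definition has_dx :: "real \<Rightarrow> real \<Rightarrow> (real \<times> real \<Rightarrow> complex) \<Rightarrow> (real \<times> real \<Rightarrow> complex) \<Rightarrow> bool" where
  "has_dx a b u v \<longleftrightarrow> (\<forall>x y. (x, y) \<in> triangle a b \<longrightarrow>
     ((\<lambda>t. u (t, y)) has_vector_derivative v (x, y)) (at x within {y..b}))"

definition has_dy :: "real \<Rightarrow> real \<Rightarrow> (real \<times> real \<Rightarrow> complex) \<Rightarrow> (real \<times> real \<Rightarrow> complex) \<Rightarrow> bool" where
  "has_dy a b u w \<longleftrightarrow> (\<forall>x y. (x, y) \<in> triangle a b \<longrightarrow>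
     ((\<lambda>t. u (x, t)) has_vector_derivative w (x, y)) (at y within {a..x}))"

lemma has_dxD:
  assumes "has_dx a b u v" "a \<le> y" "y \<le> x" "x \<le> b"
  shows "((\<lambda>t. u (t, y)) has_vector_derivative v (x, y)) (at x within {y..b})"
  using assms by (auto simp: has_dx_def)

lemma has_dyD:
  assumes "has_dy a b u w" "a \<le> y" "y \<le> x" "x \<le> b"
  shows "((\<lambda>t. u (x, t)) has_vector_derivative w (x, y)) (at y within {a..x})"
  using assms by (auto simp: has_dy_def)

lemma integral_dx:
  assumes "has_dx a b u v" "a \<le> y" "y \<le> s" "s \<le> t" "t \<le> b"
  shows "integral {s..t} (\<lambda>x. v (x, y)) = u (t, y) - u (s, y)"
  using assms by (intro integral_unique fundamental_theorem_of_calculus)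
    (auto intro: has_vector_derivative_within_subset[OF has_dxD[OF assms(1)]])

lemma integral_dy:
  assumes "has_dy a b u w" "a \<le> s" "s \<le> t" "t \<le> x" "x \<le> b"
  shows "integral {s..t} (\<lambda>y. w (x, y)) = u (x, t) - u (x, s)"
  using assms by (intro integral_unique fundamental_theorem_of_calculus)
    (auto intro: has_vector_derivative_within_subset[OF has_dyD[OF assms(1)]])

lemma continuous_slices:
  assumes "continuous_on (triangle a b) u"
  shows "a \<le> y \<Longrightarrow> y \<le> s \<Longrightarrow> t \<le> b \<Longrightarrow> continuous_on {s..t} (\<lambda>x. u (x, y))"
    and "a \<le> s \<Longrightarrow> t \<le> x \<Longrightarrow> x \<le> b \<Longrightarrow> continuous_on {s..t} (\<lambda>y. u (x, y))"
  by (auto intro!: continuous_intros continuous_on_triangle_compose[OF assms])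

lemma triangle_subset: "a \<le> c \<Longrightarrow> d \<le> b \<Longrightarrow> triangle c d \<subseteq> triangle a b"
  by (auto simp: triangle_def)

lemma has_dx_subset: "has_dx a b u v \<Longrightarrow> a \<le> c \<Longrightarrow> d \<le> b \<Longrightarrow> has_dx c d u v"
  unfolding has_dx_def
  by (auto intro!: has_vector_derivative_within_subset[where S = "{_..b}" and T = "{_..d}"])

lemma has_dy_subset: "has_dy a b u v \<Longrightarrow> a \<le> c \<Longrightarrow> d \<le> b \<Longrightarrow> has_dy c d u v"
  unfolding has_dy_def
  by (auto intro!: has_vector_derivative_within_subset[where S = "{a.._}" and T = "{c.._}"])

lemma telescoped_difference:
  fixes p q r u v :: complex
  assumes "p - q = u" "q - r = v"
  shows "p - r = v + u"
  unfolding assms[symmetric] by simp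

text \<open>Leibniz' rule for an integrand that is defined only below the diagonal, where differentiation under
the integral sign over a fixed interval is not available. The difference quotient is the mean of
\<open>h\<close> over the new piece of the range plus the integral of the mean of \<open>k\<close> between the two parameters;
both are continuous up to the diagonal.\<close>

lemma deriv_integral_upper:
  assumes h: "continuous_on (triangle c d) h" and k: "continuous_on (triangle c d) k"
    and dx: "has_dx c d h k" and x: "x \<in> {c..d}"
  shows "((\<lambda>t. integral {c..t} (\<lambda>z. h (t, z))) has_vector_derivative
     h (x, x) + integral {c..x} (\<lambda>z. k (x, z))) (at x within {c..d})"
proof -
  let ?G = "\<lambda>t. integral {c..t} (\<lambda>z. h (t, z))"
  let ?A = "\<lambda>p. integral {0..1} (\<lambda>s. h (fst p, snd p + (fst p - snd p) * s))"
  let ?J = "\<lambda>p z. integral {0..1} (\<lambda>s. k (snd p + (fst p - snd p) * s, z))"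
  let ?B = "\<lambda>p. integral {c..snd p} (?J p)"
  have A: "continuous_on (triangle c d) ?A"
    by (intro continuous_on_variable_integral)
      (auto simp: split_def triangle_def intro!: continuous_intros continuous_on_triangle_compose[OF h] affine_combination_bounds)
  have J: "continuous_on {(p, z). p \<in> triangle c d \<and> c \<le> z \<and> z \<le> snd p} (\<lambda>(p, z). ?J p z)"
    unfolding split_def
    by (intro continuous_on_variable_integral)
      (auto simp: split_def triangle_def intro!: continuous_intros continuous_on_triangle_compose[OF k] affine_combination_bounds)
  have B: "continuous_on (triangle c d) ?B"
    by (intro continuous_on_variable_integral J) (auto intro!: continuous_intros)
  have quot: "?G s - ?G t = of_real (s - t) * (?A (s, t) + ?B (s, t))" if st: "(s, t) \<in> triangle c d" for s t
  proof -
    have i1: "(\<lambda>z. h (s, z)) integrable_on {c..s}" "(\<lambda>z. h (s, z)) integrable_on {c..t}" "(\<lambda>z. h (t, z)) integrable_on {c..t}"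
      using st by (auto intro!: integrable_continuous_real continuous_slices[OF h])
    have "integral {t..s} (\<lambda>z. h (s, z)) = of_real (s - t) * ?A (s, t)"
      using st by (subst integral_as_unit_integral) (auto intro!: continuous_slices[OF h])
    moreover have "integral {c..t} (\<lambda>z. h (s, z)) + integral {t..s} (\<lambda>z. h (s, z)) = ?G s"
      using st i1 by (intro Henstock_Kurzweil_Integration.integral_combine) auto
    ultimately have "?G s - integral {c..t} (\<lambda>z. h (s, z)) = of_real (s - t) * ?A (s, t)"
      by (metis add_diff_cancel_left')
    moreover have "integral {c..t} (\<lambda>z. h (s, z)) - ?G t = of_real (s - t) * ?B (s, t)"
    proof -
      have "integral {c..t} (\<lambda>z. h (s, z)) - ?G t = integral {c..t} (\<lambda>z. h (s, z) - h (t, z))"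
        using i1 by (simp add: Henstock_Kurzweil_Integration.integral_diff)
      also have "\<dots> = integral {c..t} (\<lambda>z. of_real (s - t) * ?J (s, t) z)"
      proof (rule integral_cong)
        fix z assume z: "z \<in> {c..t}"
        have "h (s, z) - h (t, z) = integral {t..s} (\<lambda>r. k (r, z))"
          using integral_dx[OF dx, of z t s] z st by simp
        also have "\<dots> = of_real (s - t) * ?J (s, t) z"
          using st z by (subst integral_as_unit_integral) (auto intro!: continuous_slices[OF k])
        finally show "h (s, z) - h (t, z) = of_real (s - t) * ?J (s, t) z" .
      qed
      finally show ?thesis by simp
    qed
    ultimately show ?thesis
      unfolding distrib_left by (subst add.commute) (rule telescoped_difference)
  qed
  have "(?G has_vector_derivative ?A (x, x) + ?B (x, x)) (at x within {c..d})"
    by (rule hadamard_quotient[where H = "\<lambda>p. ?A p + ?B p"])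
      (use A B quot x in \<open>auto intro: continuous_on_add\<close>)
  then show ?thesis by simp
qed

text \<open>The reflection \<open>(x, y) \<mapsto> (- y, - x)\<close> preserves triangles and exchanges the two partial derivatives.\<close>

lemma deriv_integral_lower:
  assumes h: "continuous_on (triangle c d) h" and k: "continuous_on (triangle c d) k"
    and dy: "has_dy c d h k" and y: "y \<in> {c..d}"
  shows "((\<lambda>t. integral {t..d} (\<lambda>z. h (z, t))) has_vector_derivative
     - h (y, y) + integral {y..d} (\<lambda>z. k (z, y))) (at y within {c..d})"
proof -
  let ?h = "\<lambda>p. h (- snd p, - fst p)" and ?k = "\<lambda>p. - k (- snd p, - fst p)"
  have deriv_uminus: "(uminus has_vector_derivative - 1) (at r within R)" for r :: real and R
    by (simp add: has_vector_derivative_def has_derivative_minus)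
  have "has_dx (- d) (- c) ?h ?k"
    unfolding has_dx_def
  proof (intro allI impI)
    fix s w assume "(s, w) \<in> triangle (- d) (- c)"
    then have sw: "c \<le> - s" "- s \<le> - w" "- w \<le> d" by auto
    have "((\<lambda>t. h (- w, t)) \<circ> uminus has_vector_derivative (- 1) *\<^sub>R k (- w, - s)) (at s within {w..- c})"
      by (rule vector_diff_chain_within[OF deriv_uminus]) (use has_dyD[OF dy sw] in simp)
    then show "((\<lambda>t. ?h (t, w)) has_vector_derivative ?k (s, w)) (at s within {w..- c})"
      by (simp add: o_def)
  qed
  then have "((\<lambda>t. integral {- d..t} (\<lambda>z. ?h (t, z))) has_vector_derivative
     ?h (- y, - y) + integral {- d..- y} (\<lambda>z. ?k (- y, z))) (at (- y) within {- d..- c})"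
    using y by (intro deriv_integral_upper)
      (auto simp: triangle_def intro!: continuous_intros continuous_on_triangle_compose[OF h] continuous_on_triangle_compose[OF k])
  then have "((\<lambda>t. integral {- d..t} (\<lambda>z. ?h (t, z))) \<circ> uminus has_vector_derivative
     (- 1) *\<^sub>R (?h (- y, - y) + integral {- d..- y} (\<lambda>z. ?k (- y, z)))) (at y within {c..d})"
    by (intro vector_diff_chain_within[OF deriv_uminus]) simp
  moreover have "integral {- d..- t} (\<lambda>z. h (- z, t)) = integral {t..d} (\<lambda>z. h (z, t))"
    "integral {- d..- t} (\<lambda>z. k (- z, t)) = integral {t..d} (\<lambda>z. k (z, t))" for t
    using Henstock_Kurzweil_Integration.integral_reflect_real[of d t "\<lambda>z. h (z, t)"]
      Henstock_Kurzweil_Integration.integral_reflect_real[of d t "\<lambda>z. k (z, t)"]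
    by simp_all
  ultimately show ?thesis by (simp add: o_def)
qed

section \<open>Composition of kernels\<close>

text \<open>The kernel of the composition of the integral operators with kernels \<open>f\<close> and \<open>g\<close>.\<close>

definition star :: "(real \<times> real \<Rightarrow> complex) \<Rightarrow> (real \<times> real \<Rightarrow> complex) \<Rightarrow> real \<times> real \<Rightarrow> complex" where
  "star f g p = integral {snd p..fst p} (\<lambda>z. f (fst p, z) * g (z, snd p))"

lemma star_integrand_continuous:
  fixes f g :: "real \<times> real \<Rightarrow> complex"
  assumes "continuous_on (triangle a b) f" "continuous_on (triangle a b) g" "(x, y) \<in> triangle a b"
  shows "continuous_on {y..x} (\<lambda>z. f (x, z) * g (z, y))"
  using assms(3) by (intro continuous_on_mult continuous_slices[OF assms(1)] continuous_slices[OF assms(2)]) auto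

lemma star_integrable:
  fixes f g :: "real \<times> real \<Rightarrow> complex"
  assumes "continuous_on (triangle a b) f" "continuous_on (triangle a b) g" "(x, y) \<in> triangle a b"
  shows "(\<lambda>z. f (x, z) * g (z, y)) integrable_on {y..x}"
  by (rule integrable_continuous_real[OF star_integrand_continuous[OF assms]])

lemma continuous_on_star:
  assumes f: "continuous_on (triangle a b) f" and g: "continuous_on (triangle a b) g"
  shows "continuous_on (triangle a b) (star f g)"
  unfolding star_def
  by (rule continuous_on_variable_integral)
    (auto simp: split_def triangle_def intro!: continuous_intros continuous_on_triangle_compose[OF f]
      continuous_on_triangle_compose[OF g])

lemma star_cong:
  assumes "\<And>p. p \<in> triangle a b \<Longrightarrow> f p = f' p" "\<And>p. p \<in> triangle a b \<Longrightarrow> g p = g' p" "p \<in> triangle a b"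
  shows "star f g p = star f' g' p"
  unfolding star_def using assms by (intro Henstock_Kurzweil_Integration.integral_cong) (auto simp: triangle_def)

lemma star_add_left:
  assumes "continuous_on (triangle a b) f" "continuous_on (triangle a b) f'" "continuous_on (triangle a b) g" "p \<in> triangle a b"
  shows "star (\<lambda>p. f p + f' p) g p = star f g p + star f' g p"
  using star_integrable[of a b f g "fst p" "snd p"] star_integrable[of a b f' g "fst p" "snd p"] assms
  by (simp add: star_def distrib_right Henstock_Kurzweil_Integration.integral_add)

lemma star_add_right:
  assumes "continuous_on (triangle a b) f" "continuous_on (triangle a b) g'" "continuous_on (triangle a b) g" "p \<in> triangle a b"
  shows "star f (\<lambda>p. g p + g' p) p = star f g p + star f g' p"
  using star_integrable[of a b f g "fst p" "snd p"] star_integrable[of a b f g' "fst p" "snd p"] assms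
  by (simp add: star_def distrib_left Henstock_Kurzweil_Integration.integral_add)

lemma star_zero [simp]: "star (\<lambda>_. 0) g p = 0" "star f (\<lambda>_. 0) p = 0"
  by (simp_all add: star_def)

lemma has_vector_derivative_times_const:
  fixes f :: "real \<Rightarrow> complex"
  assumes "(f has_vector_derivative D) F"
  shows "((\<lambda>t. f t * c) has_vector_derivative D * c) F" "((\<lambda>t. c * f t) has_vector_derivative c * D) F"
  using assms by (auto intro: bounded_linear.has_vector_derivative[OF bounded_linear_mult_left]
    bounded_linear.has_vector_derivative[OF bounded_linear_mult_right])

lemma has_dx_star:
  assumes f: "continuous_on (triangle a b) f" and f': "continuous_on (triangle a b) f'"
    and g: "continuous_on (triangle a b) g" and dx: "has_dx a b f f'"
  shows "has_dx a b (star f g) (\<lambda>p. f (fst p, fst p) * g p + star f' g p)"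
  unfolding has_dx_def
proof (intro allI impI)
  fix x y assume xy: "(x, y) \<in> triangle a b"
  have sub: "continuous_on (triangle y b) (\<lambda>q. u q * g (snd q, y))" if "continuous_on (triangle a b) u" for u
    using xy by (intro continuous_on_mult continuous_on_subset[OF that triangle_subset]
        continuous_on_triangle_compose[OF g] continuous_intros) (auto simp: triangle_def)
  have "has_dx y b (\<lambda>q. f q * g (snd q, y)) (\<lambda>q. f' q * g (snd q, y))"
    using has_dx_subset[OF dx, of y b] xy
    by (auto simp: has_dx_def intro!: has_vector_derivative_times_const)
  from deriv_integral_upper[OF sub[OF f] sub[OF f'] this, of x]
  show "((\<lambda>t. star f g (t, y)) has_vector_derivative
      f (fst (x, y), fst (x, y)) * g (x, y) + star f' g (x, y)) (at x within {y..b})"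
    using xy by (simp add: star_def)
qed

lemma has_dy_star:
  assumes f: "continuous_on (triangle a b) f" and g': "continuous_on (triangle a b) g'"
    and g: "continuous_on (triangle a b) g" and dy: "has_dy a b g g'"
  shows "has_dy a b (star f g) (\<lambda>p. - (f p * g (snd p, snd p)) + star f g' p)"
  unfolding has_dy_def
proof (intro allI impI)
  fix x y assume xy: "(x, y) \<in> triangle a b"
  have sub: "continuous_on (triangle a x) (\<lambda>q. f (x, fst q) * u q)" if "continuous_on (triangle a b) u" for u
    using xy by (intro continuous_on_mult continuous_on_subset[OF that triangle_subset]
        continuous_on_triangle_compose[OF f] continuous_intros) (auto simp: triangle_def)
  have "has_dy a x (\<lambda>q. f (x, fst q) * g q) (\<lambda>q. f (x, fst q) * g' q)"
    using has_dy_subset[OF dy, of a x] xy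
    by (auto simp: has_dy_def intro!: has_vector_derivative_times_const)
  from deriv_integral_lower[OF sub[OF g] sub[OF g'] this, of y]
  show "((\<lambda>t. star f g (x, t)) has_vector_derivative
      - (f (x, y) * g (snd (x, y), snd (x, y))) + star f g' (x, y)) (at y within {a..x})"
    using xy by (simp add: star_def)
qed

text \<open>A form of Fubini's theorem on a triangle, proved by differentiation: with the first argument of \<open>f\<close>
frozen at \<open>x\<close>, both sides as functions of the upper limit \<open>t\<close> have the derivative
\<open>f (x, t) * star g h (t, y)\<close> and vanish at \<open>t = y\<close>.\<close>

lemma star_assoc:
  assumes f: "continuous_on (triangle a b) f" and g: "continuous_on (triangle a b) g"
    and h: "continuous_on (triangle a b) h" and p: "p \<in> triangle a b"
  shows "star f (star g h) p = star (star f g) h p"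
proof -
  obtain x y where xy: "p = (x, y)" "a \<le> y" "y \<le> x" "x \<le> b" using p by (cases p) auto
  have sub: "triangle y x \<subseteq> triangle a b" using xy by (intro triangle_subset)
  let ?F = "\<lambda>q::real \<times> real. f (x, snd q)"
  have F: "continuous_on (triangle y x) ?F" and H: "continuous_on (triangle y x) (\<lambda>q. h (snd q, y))"
    using xy by (auto simp: triangle_def intro!: continuous_intros continuous_on_triangle_compose[OF f] continuous_on_triangle_compose[OF h])
  have F': "continuous_on (triangle y x) (\<lambda>q. f (x, fst q))"
    using xy by (auto simp: triangle_def intro!: continuous_intros continuous_on_triangle_compose[OF f])
  note g' = continuous_on_subset[OF g sub]
  let ?h = "\<lambda>q. star ?F g q * h (snd q, y)"
  let ?k = "\<lambda>q. f (x, fst q) * g q * h (snd q, y)"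
  let ?R = "\<lambda>t. integral {y..t} (\<lambda>w. ?h (t, w))"
  have "has_dx y x (star ?F g) (\<lambda>q. ?F (fst q, fst q) * g q + star (\<lambda>_. 0) g q)"
    by (rule has_dx_star[OF F _ g']) (auto simp: has_dx_def)
  then have dx: "has_dx y x ?h ?k"
    by (auto simp: has_dx_def intro!: has_vector_derivative_times_const)
  have "((\<lambda>t. f (x, t) * star g h (t, y)) has_integral ?R x - ?R y) {y..x}"
  proof (rule fundamental_theorem_of_calculus[OF xy(3)])
    fix t assume t: "t \<in> {y..x}"
    have "(?R has_vector_derivative ?h (t, t) + integral {y..t} (\<lambda>w. ?k (t, w))) (at t within {y..x})"
      by (rule deriv_integral_upper[OF _ _ dx t])
        (intro continuous_on_mult continuous_on_star F F' g' H)+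
    moreover have "?h (t, t) + integral {y..t} (\<lambda>w. ?k (t, w)) = f (x, t) * star g h (t, y)"
      by (simp add: star_def mult.assoc)
    ultimately show "(?R has_vector_derivative f (x, t) * star g h (t, y)) (at t within {y..x})"
      by simp
  qed
  then have "star f (star g h) p = ?R x"
    by (simp add: star_def xy integral_unique)
  also have "\<dots> = star (star f g) h p"
    by (simp add: star_def xy)
  finally show ?thesis .
qed

text \<open>The chain rule along the diagonal, which lies in the boundary of the triangle. From \<open>(t, t)\<close> to
\<open>(s, s)\<close> one passes through \<open>(s, t)\<close>, and the two legs stay in the triangle when \<open>t \<le> s\<close>.\<close>

lemma deriv_diagonal:
  assumes v: "continuous_on (triangle a b) v" and w: "continuous_on (triangle a b) w"
    and dx: "has_dx a b u v" and dy: "has_dy a b u w" and x: "x \<in> {a..b}"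
  shows "((\<lambda>t. u (t, t)) has_vector_derivative v (x, x) + w (x, x)) (at x within {a..b})"
proof -
  let ?V = "\<lambda>p. integral {0..1} (\<lambda>s. v (snd p + (fst p - snd p) * s, snd p))"
  let ?W = "\<lambda>p. integral {0..1} (\<lambda>s. w (fst p, snd p + (fst p - snd p) * s))"
  have V: "continuous_on (triangle a b) ?V"
    by (intro continuous_on_variable_integral)
      (auto simp: split_def triangle_def intro!: continuous_intros continuous_on_triangle_compose[OF v] affine_combination_bounds)
  have W: "continuous_on (triangle a b) ?W"
    by (intro continuous_on_variable_integral)
      (auto simp: split_def triangle_def intro!: continuous_intros continuous_on_triangle_compose[OF w] affine_combination_bounds)
  have "u (s, s) - u (t, t) = of_real (s - t) * (?V (s, t) + ?W (s, t))" if st: "(s, t) \<in> triangle a b" for s t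
  proof -
    have "u (s, s) - u (s, t) = of_real (s - t) * ?W (s, t)"
      using st integral_dy[OF dy, of t s s] integral_as_unit_integral[of t s "\<lambda>y. w (s, y)"] continuous_slices(2)[OF w]
      by simp
    moreover have "u (s, t) - u (t, t) = of_real (s - t) * ?V (s, t)"
      using st integral_dx[OF dx, of t t s] integral_as_unit_integral[of t s "\<lambda>x. v (x, t)"] continuous_slices(1)[OF v]
      by simp
    ultimately show ?thesis
      unfolding distrib_left by (rule telescoped_difference)
  qed
  then have "((\<lambda>t. u (t, t)) has_vector_derivative ?V (x, x) + ?W (x, x)) (at x within {a..b})"
    using x by (intro hadamard_quotient[where H = "\<lambda>p. ?V p + ?W p"] continuous_on_add V W) auto
  then show ?thesis by simp
qed

section \<open>Finite orders of smoothness\<close>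

text \<open>Smoothness of order \<open>k\<close> is what closure properties can be proved for by induction. The derivatives \<open>v\<close>
and \<open>w\<close> are not linked to each other here; that mixed derivatives agree is recovered later from
\<open>mixed_derivatives_commute\<close>.\<close>

primrec Ck_triangle :: "real \<Rightarrow> real \<Rightarrow> nat \<Rightarrow> (real \<times> real \<Rightarrow> complex) \<Rightarrow> bool" where
  "Ck_triangle a b 0 u \<longleftrightarrow> continuous_on (triangle a b) u"
| "Ck_triangle a b (Suc k) u \<longleftrightarrow> continuous_on (triangle a b) u \<and>
     (\<exists>v w. has_dx a b u v \<and> has_dy a b u w \<and> Ck_triangle a b k v \<and> Ck_triangle a b k w)"

lemma Ck_triangle_continuous: "Ck_triangle a b k u \<Longrightarrow> continuous_on (triangle a b) u"
  by (cases k) auto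

lemma Ck_triangle_SucI:
  "continuous_on (triangle a b) u \<Longrightarrow> has_dx a b u v \<Longrightarrow> has_dy a b u w \<Longrightarrow> Ck_triangle a b k v \<Longrightarrow>
   Ck_triangle a b k w \<Longrightarrow> Ck_triangle a b (Suc k) u"
  by auto

lemma Ck_triangle_Suc_D: "Ck_triangle a b (Suc k) u \<Longrightarrow> Ck_triangle a b k u"
proof (induction k arbitrary: u)
  case (Suc k)
  then show ?case by (metis Ck_triangle.simps(2))
qed simp

lemma has_dx_transfer:
  assumes "has_dx a b u v" "\<And>p. p \<in> triangle a b \<Longrightarrow> u' p = u p" "\<And>p. p \<in> triangle a b \<Longrightarrow> v' p = v p"
  shows "has_dx a b u' v'"
  unfolding has_dx_def
proof (intro allI impI)
  fix x y assume xy: "(x, y) \<in> triangle a b"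
  have "((\<lambda>t. u' (t, y)) has_vector_derivative v (x, y)) (at x within {y..b})"
    by (rule has_vector_derivative_transform[OF _ _ has_dxD[OF assms(1)]]) (use assms(2) xy in auto)
  then show "((\<lambda>t. u' (t, y)) has_vector_derivative v' (x, y)) (at x within {y..b})"
    using assms(3)[OF xy] by simp
qed

lemma has_dy_transfer:
  assumes "has_dy a b u v" "\<And>p. p \<in> triangle a b \<Longrightarrow> u' p = u p" "\<And>p. p \<in> triangle a b \<Longrightarrow> v' p = v p"
  shows "has_dy a b u' v'"
  unfolding has_dy_def
proof (intro allI impI)
  fix x y assume xy: "(x, y) \<in> triangle a b"
  have "((\<lambda>t. u' (x, t)) has_vector_derivative v (x, y)) (at y within {a..x})"
    by (rule has_vector_derivative_transform[OF _ _ has_dyD[OF assms(1)]]) (use assms(2) xy in auto)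
  then show "((\<lambda>t. u' (x, t)) has_vector_derivative v' (x, y)) (at y within {a..x})"
    using assms(3)[OF xy] by simp
qed

lemma Ck_triangle_transfer:
  assumes "Ck_triangle a b k u" "\<And>p. p \<in> triangle a b \<Longrightarrow> u' p = u p"
  shows "Ck_triangle a b k u'"
proof -
  have c: "continuous_on (triangle a b) u'"
    by (rule continuous_on_eq[OF Ck_triangle_continuous[OF assms(1)] assms(2)[symmetric]])
  show ?thesis
  proof (cases k)
    case (Suc n)
    with assms(1) obtain v w where
      vw: "has_dx a b u v" "has_dy a b u w" "Ck_triangle a b n v" "Ck_triangle a b n w" by auto
    show ?thesis unfolding Suc
      by (rule Ck_triangle_SucI[OF c has_dx_transfer[OF vw(1) assms(2)] has_dy_transfer[OF vw(2) assms(2)] vw(3,4)]) simp_all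
  qed (simp add: c)
qed

lemma has_dx_add: "has_dx a b u v \<Longrightarrow> has_dx a b u' v' \<Longrightarrow> has_dx a b (\<lambda>p. u p + u' p) (\<lambda>p. v p + v' p)"
  by (auto simp: has_dx_def intro!: has_vector_derivative_add)

lemma has_dy_add: "has_dy a b u v \<Longrightarrow> has_dy a b u' v' \<Longrightarrow> has_dy a b (\<lambda>p. u p + u' p) (\<lambda>p. v p + v' p)"
  by (auto simp: has_dy_def intro!: has_vector_derivative_add)

lemma has_dx_uminus: "has_dx a b u v \<Longrightarrow> has_dx a b (\<lambda>p. - u p) (\<lambda>p. - v p)"
  by (auto simp: has_dx_def intro!: has_vector_derivative_minus)

lemma has_dy_uminus: "has_dy a b u v \<Longrightarrow> has_dy a b (\<lambda>p. - u p) (\<lambda>p. - v p)"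
  by (auto simp: has_dy_def intro!: has_vector_derivative_minus)

lemma has_dx_mult: "has_dx a b u v \<Longrightarrow> has_dx a b u' v' \<Longrightarrow> has_dx a b (\<lambda>p. u p * u' p) (\<lambda>p. u p * v' p + v p * u' p)"
  by (auto simp: has_dx_def intro!: has_vector_derivative_mult)

lemma has_dy_mult: "has_dy a b u v \<Longrightarrow> has_dy a b u' v' \<Longrightarrow> has_dy a b (\<lambda>p. u p * u' p) (\<lambda>p. u p * v' p + v p * u' p)"
  by (auto simp: has_dy_def intro!: has_vector_derivative_mult)

lemma Ck_triangle_const: "Ck_triangle a b k (\<lambda>_. c)"
proof (induction k arbitrary: c)
  case (Suc k)
  show ?case by (rule Ck_triangle_SucI[OF _ _ _ Suc[of 0] Suc[of 0]]) (auto simp: has_dx_def has_dy_def)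
qed simp

lemma Ck_triangle_add: "Ck_triangle a b k u \<Longrightarrow> Ck_triangle a b k u' \<Longrightarrow> Ck_triangle a b k (\<lambda>p. u p + u' p)"
proof (induction k arbitrary: u u')
  case (Suc k)
  from Suc.prems obtain v w v' w' where
    "has_dx a b u v" "has_dy a b u w" "Ck_triangle a b k v" "Ck_triangle a b k w"
    "has_dx a b u' v'" "has_dy a b u' w'" "Ck_triangle a b k v'" "Ck_triangle a b k w'" by auto
  then show ?case
    by (intro Ck_triangle_SucI[OF _ has_dx_add[of a b u v u' v'] has_dy_add[of a b u w u' w']] Suc.IH)
      (use Suc.prems in \<open>auto intro: continuous_on_add\<close>)
qed (auto intro: continuous_on_add)

lemma Ck_triangle_mult: "Ck_triangle a b k u \<Longrightarrow> Ck_triangle a b k u' \<Longrightarrow> Ck_triangle a b k (\<lambda>p. u p * u' p)"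
proof (induction k arbitrary: u u')
  case (Suc k)
  from Suc.prems obtain v w v' w' where
    "has_dx a b u v" "has_dy a b u w" "Ck_triangle a b k v" "Ck_triangle a b k w"
    "has_dx a b u' v'" "has_dy a b u' w'" "Ck_triangle a b k v'" "Ck_triangle a b k w'" by auto
  then show ?case
    by (intro Ck_triangle_SucI[OF _ has_dx_mult[of a b u v u' v'] has_dy_mult[of a b u w u' w']] Ck_triangle_add Suc.IH)
      (use Suc.prems in \<open>auto intro: continuous_on_mult Ck_triangle_Suc_D simp del: Ck_triangle.simps(2) dest: Ck_triangle_continuous\<close>)
qed (auto intro: continuous_on_mult)

lemma Ck_triangle_uminus: "Ck_triangle a b k u \<Longrightarrow> Ck_triangle a b k (\<lambda>p. - u p)"
  using Ck_triangle_mult[OF Ck_triangle_const[of a b k "- 1"], of u] by simp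

text \<open>The flag \<open>z\<close> demands that the function and its derivatives up to order \<open>k\<close> vanish at \<open>a\<close>. In this way
the coefficient functions (\<open>z\<close> false) and the functions in \<open>M a b\<close> (\<open>z\<close> true) share their calculus.\<close>

primrec Ck_interval :: "bool \<Rightarrow> real \<Rightarrow> real \<Rightarrow> nat \<Rightarrow> (real \<Rightarrow> complex) \<Rightarrow> bool" where
  "Ck_interval z a b 0 P \<longleftrightarrow> continuous_on {a..b} P \<and> (z \<longrightarrow> P a = 0)"
| "Ck_interval z a b (Suc k) P \<longleftrightarrow> (z \<longrightarrow> P a = 0) \<and>
     (\<exists>Q. (\<forall>x\<in>{a..b}. (P has_vector_derivative Q x) (at x within {a..b})) \<and> Ck_interval z a b k Q)"

lemma continuous_on_if_vector_derivative:
  assumes "\<forall>x\<in>S. (P has_vector_derivative Q x) (at x within S)"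
  shows "continuous_on S P"
  using assms has_vector_derivative_continuous continuous_on_eq_continuous_within by blast

lemma Ck_interval_continuous: "Ck_interval z a b k P \<Longrightarrow> continuous_on {a..b} P"
  by (cases k) (auto intro: continuous_on_if_vector_derivative)

lemma Ck_interval_zero_at: "Ck_interval True a b k P \<Longrightarrow> P a = 0"
  by (cases k) auto

lemma Ck_interval_SucI:
  "(z \<Longrightarrow> P a = 0) \<Longrightarrow> (\<And>x. x \<in> {a..b} \<Longrightarrow> (P has_vector_derivative Q x) (at x within {a..b})) \<Longrightarrow>
   Ck_interval z a b k Q \<Longrightarrow> Ck_interval z a b (Suc k) P"
  by (auto intro!: exI[of _ Q])

lemma Ck_interval_Suc_D: "Ck_interval z a b (Suc k) P \<Longrightarrow> Ck_interval z a b k P"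
proof (induction k arbitrary: P)
  case 0
  then show ?case by (auto intro: continuous_on_if_vector_derivative)
next
  case (Suc k)
  then show ?case by (metis Ck_interval.simps(2))
qed

lemma Ck_interval_cong:
  assumes "a \<le> b" "\<And>x. x \<in> {a..b} \<Longrightarrow> P x = P' x"
  shows "Ck_interval z a b k P \<longleftrightarrow> Ck_interval z a b k P'"
proof -
  have "(P has_vector_derivative D) (at x within {a..b}) \<longleftrightarrow> (P' has_vector_derivative D) (at x within {a..b})"
    if "x \<in> {a..b}" for x D
    using assms that by (intro has_vector_derivative_cong_ev) (auto simp: eventually_at_filter)
  moreover have "P a = P' a" using assms by auto
  moreover have "continuous_on {a..b} P \<longleftrightarrow> continuous_on {a..b} P'"
    by (rule continuous_on_cong[OF refl assms(2)])
  ultimately show ?thesis by (cases k) auto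
qed

lemma Ck_interval_const: "Ck_interval False a b k (\<lambda>_. c)"
proof (induction k arbitrary: c)
  case (Suc k)
  show ?case by (rule Ck_interval_SucI[OF _ _ Suc[of 0]]) auto
qed simp

lemma Ck_interval_add: "Ck_interval z a b k P \<Longrightarrow> Ck_interval z a b k P' \<Longrightarrow> Ck_interval z a b k (\<lambda>x. P x + P' x)"
proof (induction k arbitrary: P P')
  case (Suc k)
  from Suc.prems obtain Q Q' where
    "\<forall>x\<in>{a..b}. (P has_vector_derivative Q x) (at x within {a..b})" "Ck_interval z a b k Q"
    "\<forall>x\<in>{a..b}. (P' has_vector_derivative Q' x) (at x within {a..b})" "Ck_interval z a b k Q'" by auto
  then show ?case
    by (intro Ck_interval_SucI[where Q = "\<lambda>x. Q x + Q' x"] Suc.IH)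
      (use Suc.prems in \<open>auto intro: has_vector_derivative_add\<close>)
qed (auto intro: continuous_on_add)

lemma Ck_interval_mult: "Ck_interval False a b k P \<Longrightarrow> Ck_interval z a b k P' \<Longrightarrow> Ck_interval z a b k (\<lambda>x. P x * P' x)"
proof (induction k arbitrary: P P')
  case (Suc k)
  from Suc.prems obtain Q Q' where
    "\<forall>x\<in>{a..b}. (P has_vector_derivative Q x) (at x within {a..b})" "Ck_interval False a b k Q"
    "\<forall>x\<in>{a..b}. (P' has_vector_derivative Q' x) (at x within {a..b})" "Ck_interval z a b k Q'" by auto
  then show ?case
    by (intro Ck_interval_SucI[where Q = "\<lambda>x. P x * Q' x + Q x * P' x"] Ck_interval_add Suc.IH has_vector_derivative_mult)
      (use Suc.prems in \<open>auto intro: Ck_interval_Suc_D simp del: Ck_interval.simps(2) dest: Ck_interval_zero_at\<close>)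
qed (auto intro: continuous_on_mult)

lemma Ck_interval_inverse:
  assumes "\<And>x. x \<in> {a..b} \<Longrightarrow> P x \<noteq> 0" "Ck_interval False a b k P"
  shows "Ck_interval False a b k (\<lambda>x. inverse (P x))"
  using assms(2)
proof (induction k)
  case 0
  then show ?case using assms(1) by (auto intro!: continuous_on_inverse)
next
  case (Suc k)
  from Suc.prems obtain Q where
    Q: "\<forall>x\<in>{a..b}. (P has_vector_derivative Q x) (at x within {a..b})" "Ck_interval False a b k Q" by auto
  note inv = Suc.IH[OF Ck_interval_Suc_D[OF Suc.prems]]
  show ?case
  proof (rule Ck_interval_SucI)
    show "Ck_interval False a b k (\<lambda>x. - 1 * (Q x * (inverse (P x) * inverse (P x))))"
      by (intro Ck_interval_mult inv Q Ck_interval_const)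
    fix x assume x: "x \<in> {a..b}"
    have "((\<lambda>x. inverse (P x)) has_derivative (\<lambda>h. - (inverse (P x) * (h *\<^sub>R Q x) * inverse (P x)))) (at x within {a..b})"
      by (rule Deriv.has_derivative_inverse[where f = P and f' = "\<lambda>h. h *\<^sub>R Q x"])
        (use Q x assms(1) in \<open>auto simp: has_vector_derivative_def\<close>)
    then show "((\<lambda>x. inverse (P x)) has_vector_derivative - 1 * (Q x * (inverse (P x) * inverse (P x)))) (at x within {a..b})"
      by (simp add: has_vector_derivative_def algebra_simps)
  qed simp
qed

lemma continuous_on_triangle_coordinate:
  fixes P :: "real \<Rightarrow> complex"
  assumes "continuous_on {a..b} P"
  shows "continuous_on (triangle a b) (\<lambda>p. P (fst p))" "continuous_on (triangle a b) (\<lambda>p. P (snd p))"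
  by (auto simp: triangle_def intro!: continuous_on_compose2[OF assms] continuous_on_fst continuous_on_snd continuous_on_id)

lemma Ck_triangle_fst: "Ck_interval False a b k P \<Longrightarrow> Ck_triangle a b k (\<lambda>p. P (fst p))"
proof (induction k arbitrary: P)
  case 0
  then show ?case by (simp add: continuous_on_triangle_coordinate)
next
  case (Suc k)
  note cont = Ck_interval_continuous[OF Suc.prems]
  from Suc.prems obtain Q where
    Q: "\<forall>x\<in>{a..b}. (P has_vector_derivative Q x) (at x within {a..b})" "Ck_interval False a b k Q" by auto
  show ?case
  proof (rule Ck_triangle_SucI[OF _ _ _ Suc.IH[OF Q(2)] Ck_triangle_const[of a b k 0]])
    show "has_dx a b (\<lambda>p. P (fst p)) (\<lambda>p. Q (fst p))"
      using Q(1) by (auto simp: has_dx_def intro!: has_vector_derivative_within_subset[OF bspec[OF Q(1)]])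
  qed (simp_all add: has_dy_def continuous_on_triangle_coordinate cont)
qed

lemma Ck_triangle_snd: "Ck_interval False a b k P \<Longrightarrow> Ck_triangle a b k (\<lambda>p. P (snd p))"
proof (induction k arbitrary: P)
  case 0
  then show ?case by (simp add: continuous_on_triangle_coordinate)
next
  case (Suc k)
  note cont = Ck_interval_continuous[OF Suc.prems]
  from Suc.prems obtain Q where
    Q: "\<forall>x\<in>{a..b}. (P has_vector_derivative Q x) (at x within {a..b})" "Ck_interval False a b k Q" by auto
  show ?case
  proof (rule Ck_triangle_SucI[OF _ _ _ Ck_triangle_const[of a b k 0] Suc.IH[OF Q(2)]])
    show "has_dy a b (\<lambda>p. P (snd p)) (\<lambda>p. Q (snd p))"
      using Q(1) by (auto simp: has_dy_def intro!: has_vector_derivative_within_subset[OF bspec[OF Q(1)]])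
  qed (simp_all add: has_dx_def continuous_on_triangle_coordinate cont)
qed

lemma Ck_interval_diagonal: "Ck_triangle a b k u \<Longrightarrow> Ck_interval False a b k (\<lambda>x. u (x, x))"
proof (induction k arbitrary: u)
  case 0
  then show ?case by (auto intro!: continuous_on_triangle_compose[of a b u] continuous_intros)
next
  case (Suc k)
  from Suc.prems obtain v w where
    vw: "has_dx a b u v" "has_dy a b u w" "Ck_triangle a b k v" "Ck_triangle a b k w" by auto
  show ?case
    by (rule Ck_interval_SucI[OF _ deriv_diagonal[OF _ _ vw(1,2)] Ck_interval_add[OF Suc.IH[OF vw(3)] Suc.IH[OF vw(4)]]])
      (use vw Ck_triangle_continuous in auto)
qed

text \<open>Each derivative of \<open>star f g\<close> differentiates only one of the two factors, and the boundary term
is the product of one factor with the restriction of the other to the diagonal; so no order of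
smoothness is lost.\<close>

lemma Ck_triangle_star: "Ck_triangle a b k f \<Longrightarrow> Ck_triangle a b k g \<Longrightarrow> Ck_triangle a b k (star f g)"
proof (induction k arbitrary: f g)
  case 0
  then show ?case by (simp add: continuous_on_star)
next
  case (Suc k)
  from Suc.prems obtain f' g' where
    fg: "has_dx a b f f'" "has_dy a b g g'" "Ck_triangle a b k f'" "Ck_triangle a b k g'" by auto
  note k = Ck_triangle_Suc_D[OF Suc.prems(1)] Ck_triangle_Suc_D[OF Suc.prems(2)]
  note c = k[THEN Ck_triangle_continuous] fg(3,4)[THEN Ck_triangle_continuous]
  show ?case
    by (rule Ck_triangle_SucI[OF continuous_on_star[OF c(1,2)] has_dx_star[OF c(1,3,2) fg(1)] has_dy_star[OF c(1,4,2) fg(2)]])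
      (intro Ck_triangle_add Ck_triangle_uminus Ck_triangle_mult Suc.IH k fg
        Ck_triangle_fst[OF Ck_interval_diagonal] Ck_triangle_snd[OF Ck_interval_diagonal])+
qed

section \<open>Smooth functions\<close>

text \<open>The points strictly below the diagonal are dense. This matters at the corners \<open>(a, a)\<close> and \<open>(b, b)\<close>,
where one of the slices is a single point and does not determine the partial derivative.\<close>

lemma eq_on_triangle_if_eq_below_diagonal:
  fixes u u' :: "real \<times> real \<Rightarrow> complex"
  assumes ab: "a < b" and c: "continuous_on (triangle a b) u" "continuous_on (triangle a b) u'"
    and eq: "\<And>x y. a \<le> y \<Longrightarrow> y < x \<Longrightarrow> x \<le> b \<Longrightarrow> u (x, y) = u' (x, y)"
    and p: "p \<in> triangle a b"
  shows "u p = u' p"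
proof (cases "snd p < fst p")
  case True
  then show ?thesis using eq[of "snd p" "fst p"] p by (auto simp: triangle_def split: prod.splits)
next
  case False
  then obtain x where x: "p = (x, x)" "a \<le> x" "x \<le> b" using p by (auto simp: triangle_def)
  let ?e = "\<lambda>n. inverse (real (Suc n))"
  \<comment> \<open>A sequence from below the diagonal that stays in the triangle also when \<open>x\<close> is \<open>a\<close> or \<open>b\<close>.\<close>
  let ?q = "\<lambda>n. (x + (b - x) * ?e n, x - (x - a) * ?e n)"
  have lim: "?q \<longlonglongrightarrow> (x + (b - x) * 0, x - (x - a) * 0)"
    by (intro tendsto_intros LIMSEQ_inverse_real_of_nat)
  have e: "0 < ?e n" "?e n \<le> 1" for n by (auto simp: field_simps)
  have le: "(b - x) * ?e n \<le> b - x" "(x - a) * ?e n \<le> x - a" for n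
    using mult_left_mono[OF e(2), of "b - x" n] mult_left_mono[OF e(2), of "x - a" n] x by auto
  have nn: "(b - x) * ?e n \<ge> 0" "(x - a) * ?e n \<ge> 0" for n using x e(1)[of n] by (simp_all del: of_nat_Suc)
  have "(b - x) * ?e n + (x - a) * ?e n = (b - a) * ?e n" for n by (simp add: algebra_simps)
  then have pos: "(b - x) * ?e n + (x - a) * ?e n > 0" for n using ab e(1)[of n] by (simp del: of_nat_Suc)
  have mem: "?q n \<in> triangle a b" for n using le[of n] nn[of n] by (simp del: of_nat_Suc)
  have same: "u (?q n) = u' (?q n)" for n
    using eq[of "x - (x - a) * ?e n" "x + (b - x) * ?e n"] le[of n] nn[of n] pos[of n] by linarith
  have "(\<lambda>n. v (?q n)) \<longlonglongrightarrow> v p" if "continuous_on (triangle a b) v" for v :: "real \<times> real \<Rightarrow> complex"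
    by (rule continuous_on_tendsto_compose[OF that, of ?q]) (use lim mem x in auto)
  from this[OF c(1)] this[OF c(2)] have "(\<lambda>n. u (?q n)) \<longlonglongrightarrow> u p" "(\<lambda>n. u (?q n)) \<longlonglongrightarrow> u' p"
    using same by simp_all
  then show ?thesis by (rule LIMSEQ_unique)
qed

lemma vector_derivative_unique_on_interval:
  fixes f :: "real \<Rightarrow> 'a::real_normed_vector"
  assumes "(f has_vector_derivative D) (at x within {a..b})" "(f has_vector_derivative D') (at x within {a..b})"
    and "a < b" "x \<in> {a..b}"
  shows "D = D'"
  using vector_derivative_unique_within_closed_interval[of a b x f D D'] assms by simp

lemma has_dx_unique:
  assumes "a < b" "has_dx a b u v" "has_dx a b u v'" "continuous_on (triangle a b) v" "continuous_on (triangle a b) v'"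
    and "p \<in> triangle a b"
  shows "v p = v' p"
  by (rule eq_on_triangle_if_eq_below_diagonal[OF assms(1,4,5) _ assms(6)])
    (rule vector_derivative_unique_on_interval[OF has_dxD[OF assms(2)] has_dxD[OF assms(3)]], auto)

lemma has_dy_unique:
  assumes "a < b" "has_dy a b u v" "has_dy a b u v'" "continuous_on (triangle a b) v" "continuous_on (triangle a b) v'"
    and "p \<in> triangle a b"
  shows "v p = v' p"
  by (rule eq_on_triangle_if_eq_below_diagonal[OF assms(1,4,5) _ assms(6)])
    (rule vector_derivative_unique_on_interval[OF has_dyD[OF assms(2)] has_dyD[OF assms(3)]], auto)

text \<open>Below the diagonal a point lies in a rectangle contained in the triangle. There
\<open>u (x, y) - u (m, y)\<close> is the integral of \<open>v\<close> over \<open>[m, x]\<close>; differentiating in \<open>y\<close> under the integral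
sign and then in \<open>x\<close> identifies the two mixed derivatives.\<close>

lemma mixed_derivatives_commute:
  assumes ab: "a < b" and dx: "has_dx a b u v" and dy: "has_dy a b u w"
    and vp: "has_dy a b v p" and wq: "has_dx a b w q"
    and c: "continuous_on (triangle a b) v" "continuous_on (triangle a b) w"
      "continuous_on (triangle a b) p" "continuous_on (triangle a b) q"
    and r: "r \<in> triangle a b"
  shows "p r = q r"
proof (rule eq_on_triangle_if_eq_below_diagonal[OF ab c(3,4) _ r])
  fix x0 y0 assume xy: "a \<le> y0" "y0 < x0" "x0 \<le> b"
  obtain m where m: "y0 < m" "m < x0" using dense[OF xy(2)] by auto
  have eq: "integral {m..x} (\<lambda>s. p (s, y0)) = integral {m..x} (\<lambda>s. q (s, y0))" if x: "x \<in> {m..b}" for x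
  proof -
    have "((\<lambda>y. integral (cbox m x) (\<lambda>s. v (s, y))) has_vector_derivative integral (cbox m x) (\<lambda>s. p (s, y0)))
        (at y0 within {a..m})"
    proof (rule leibniz_rule_vector_derivative)
      fix y s assume "y \<in> {a..m}" "s \<in> cbox m x"
      then show "((\<lambda>y. v (s, y)) has_vector_derivative p (s, y)) (at y within {a..m})"
        using x by (intro has_vector_derivative_within_subset[OF has_dyD[OF vp]]) auto
    next
      fix y assume "y \<in> {a..m}"
      then show "(\<lambda>s. v (s, y)) integrable_on cbox m x"
        using x by (auto intro!: integrable_continuous_real continuous_slices[OF c(1)])
    next
      show "continuous_on ({a..m} \<times> cbox m x) (\<lambda>(y, s). p (s, y))"
        using x unfolding split_def by (intro continuous_on_triangle_compose[OF c(3)] continuous_intros) auto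
    qed (use xy m in auto)
    moreover have "u (x, y) - u (m, y) = integral (cbox m x) (\<lambda>s. v (s, y))" if "y \<in> {a..m}" for y
      using integral_dx[OF dx, of y m x] that xy m x by simp
    moreover have "y0 \<in> {a..m}" using xy m by simp
    ultimately have "((\<lambda>y. u (x, y) - u (m, y)) has_vector_derivative integral {m..x} (\<lambda>s. p (s, y0))) (at y0 within {a..m})"
      using has_vector_derivative_transform[of y0 "{a..m}" "\<lambda>y. u (x, y) - u (m, y)" "\<lambda>y. integral (cbox m x) (\<lambda>s. v (s, y))"]
      by simp
    moreover have "((\<lambda>y. u (x, y) - u (m, y)) has_vector_derivative w (x, y0) - w (m, y0)) (at y0 within {a..m})"
      using xy m x by (intro has_vector_derivative_diff has_vector_derivative_within_subset[OF has_dyD[OF dy]]) auto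
    moreover have "integral {m..x} (\<lambda>s. q (s, y0)) = w (x, y0) - w (m, y0)"
      using integral_dx[OF wq, of y0 m x] xy m x by simp
    ultimately show ?thesis
      using vector_derivative_unique_on_interval[of "\<lambda>y. u (x, y) - u (m, y)" _ y0 a m] xy m by simp
  qed
  have "((\<lambda>x. integral {m..x} (\<lambda>s. q (s, y0))) has_vector_derivative p (x0, y0)) (at x0 within {m..b})"
  proof (rule has_vector_derivative_transform)
    show "((\<lambda>x. integral {m..x} (\<lambda>s. p (s, y0))) has_vector_derivative p (x0, y0)) (at x0 within {m..b})"
      using xy m by (intro integral_has_vector_derivative) (auto intro!: continuous_slices[OF c(3)])
  qed (use xy m eq in auto)
  moreover have "((\<lambda>x. integral {m..x} (\<lambda>s. q (s, y0))) has_vector_derivative q (x0, y0)) (at x0 within {m..b})"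
    using xy m by (intro integral_has_vector_derivative) (auto intro!: continuous_slices[OF c(4)])
  ultimately show "p (x0, y0) = q (x0, y0)"
    using xy m by (intro vector_derivative_unique_on_interval[of _ _ x0 m b]) auto
qed

abbreviation smooth_triangle :: "real \<Rightarrow> real \<Rightarrow> (real \<times> real \<Rightarrow> complex) \<Rightarrow> bool" where
  "smooth_triangle a b u \<equiv> \<forall>k. Ck_triangle a b k u"

abbreviation smooth_interval :: "bool \<Rightarrow> real \<Rightarrow> real \<Rightarrow> (real \<Rightarrow> complex) \<Rightarrow> bool" where
  "smooth_interval z a b P \<equiv> \<forall>k. Ck_interval z a b k P"

text \<open>The derivatives witnessing different orders of smoothness coincide by uniqueness, so a single one is
smooth of every order.\<close>

lemma smooth_triangle_has_dx:
  assumes "a < b" "smooth_triangle a b u"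
  obtains v where "has_dx a b u v" "smooth_triangle a b v" "v \<in> extensional (triangle a b)"
proof -
  have "Ck_triangle a b (Suc 0) u" using assms(2) by blast
  then obtain v where v: "has_dx a b u v" "continuous_on (triangle a b) v" by auto
  have "Ck_triangle a b k v" for k
  proof -
    have "Ck_triangle a b (Suc k) u" using assms(2) by blast
    then obtain v' where v': "has_dx a b u v'" "Ck_triangle a b k v'" by auto
    show ?thesis
      using has_dx_unique[OF assms(1) v(1) v'(1) v(2) Ck_triangle_continuous[OF v'(2)]]
      by (intro Ck_triangle_transfer[OF v'(2)])
  qed
  then show ?thesis
    using v(1) by (intro that[of "restrict v (triangle a b)"])
      (auto intro: has_dx_transfer Ck_triangle_transfer[where u = v])
qed

lemma smooth_triangle_has_dy:
  assumes "a < b" "smooth_triangle a b u"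
  obtains v where "has_dy a b u v" "smooth_triangle a b v" "v \<in> extensional (triangle a b)"
proof -
  have "Ck_triangle a b (Suc 0) u" using assms(2) by blast
  then obtain v where v: "has_dy a b u v" "continuous_on (triangle a b) v" by auto
  have "Ck_triangle a b k v" for k
  proof -
    have "Ck_triangle a b (Suc k) u" using assms(2) by blast
    then obtain v' where v': "has_dy a b u v'" "Ck_triangle a b k v'" by auto
    show ?thesis
      using has_dy_unique[OF assms(1) v(1) v'(1) v(2) Ck_triangle_continuous[OF v'(2)]]
      by (intro Ck_triangle_transfer[OF v'(2)])
  qed
  then show ?thesis
    using v(1) by (intro that[of "restrict v (triangle a b)"])
      (auto intro: has_dy_transfer Ck_triangle_transfer[where u = v])
qed

text \<open>The doubly indexed family in the definition of \<open>B2\<close> is obtained by iterating a choice of the two partial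
derivatives. Extensionality turns agreement of mixed derivatives on the triangle into an equation
between functions, which makes the iteration independent of the order.\<close>

lemma B2_iff_smooth:
  assumes ab: "a < b"
  shows "f \<in> B2 a b \<longleftrightarrow> f \<in> extensional (triangle a b) \<and> smooth_triangle a b f"
proof (intro iffI conjI allI)
  fix k assume "f \<in> B2 a b"
  then obtain D where D: "D 0 0 = f" "\<And>i j. continuous_on (triangle a b) (D i j)"
    "\<And>i j. has_dx a b (D i j) (D (Suc i) j)" "\<And>i j. has_dy a b (D i j) (D i (Suc j))"
    unfolding B2_def has_dx_def has_dy_def by blast
  have "Ck_triangle a b k (D i j)" for i j
    by (induction k arbitrary: i j) (use D(2-4) in \<open>auto intro!: Ck_triangle_SucI simp del: Ck_triangle.simps(2)\<close>)
  with D(1) show "Ck_triangle a b k f" by metis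
next
  assume "f \<in> extensional (triangle a b) \<and> smooth_triangle a b f"
  define S where "S = {u \<in> extensional (triangle a b). smooth_triangle a b u}"
  have f: "f \<in> S" using \<open>_ \<and> _\<close> by (simp add: S_def)
  have "\<forall>u\<in>S. \<exists>v\<in>S. has_dx a b u v" "\<forall>u\<in>S. \<exists>v\<in>S. has_dy a b u v"
    unfolding S_def by (auto elim: smooth_triangle_has_dx[OF ab] smooth_triangle_has_dy[OF ab])
  then obtain X Y where X: "\<And>u. u \<in> S \<Longrightarrow> X u \<in> S \<and> has_dx a b u (X u)" and Y: "\<And>u. u \<in> S \<Longrightarrow> Y u \<in> S \<and> has_dy a b u (Y u)"
    by metis
  have cont: "continuous_on (triangle a b) u" if "u \<in> S" for u
    using that Ck_triangle_continuous by (auto simp: S_def)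
  have comm: "Y (X u) = X (Y u)" if u: "u \<in> S" for u
  proof (rule extensionalityI)
    show "Y (X u) \<in> extensional (triangle a b)" "X (Y u) \<in> extensional (triangle a b)"
      using X Y u by (auto simp: S_def)
    show "Y (X u) r = X (Y u) r" if "r \<in> triangle a b" for r
      using that X Y u by (intro mixed_derivatives_commute[OF ab, of u "X u" "Y u"] cont) auto
  qed
  define D where "D i j = (X ^^ i) ((Y ^^ j) f)" for i j :: nat
  have Yj: "(Y ^^ j) f \<in> S" for j by (induction j) (use f Y in auto)
  have D: "D i j \<in> S" for i j by (induction i) (use Yj X in \<open>auto simp: D_def\<close>)
  have dy: "Y (D i j) = D i (Suc j)" for i j
    by (induction i) (use D comm in \<open>auto simp: D_def\<close>)
  have "D 0 0 = f \<and> (\<forall>i j. continuous_on (triangle a b) (D i j) \<and> has_dx a b (D i j) (D (Suc i) j) \<and>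
      has_dy a b (D i j) (D i (Suc j)))"
    using cont[OF D] X[OF D] Y[OF D] dy by (auto simp: D_def)
  then show "f \<in> B2 a b"
    using f unfolding B2_def S_def has_dx_def has_dy_def by blast
qed (simp_all add: B2_def)

lemma deriv_on_eq:
  assumes "a < b" "x \<in> {a..b}" "(P has_vector_derivative D) (at x within {a..b})"
  shows "deriv_on a b P x = D"
  using assms vector_derivative_within_cbox[of a b x P D] by (simp add: deriv_on_def)

lemma Ck_interval_deriv_on:
  assumes "a < b" "Ck_interval z a b (Suc k) P"
  shows "Ck_interval z a b k (deriv_on a b P)"
    and "x \<in> {a..b} \<Longrightarrow> (P has_vector_derivative deriv_on a b P x) (at x within {a..b})"
proof -
  obtain Q where "\<forall>x\<in>{a..b}. (P has_vector_derivative Q x) (at x within {a..b})"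
    and Q2: "Ck_interval z a b k Q"
    using assms(2) by auto
  then have Q: "\<And>x. x \<in> {a..b} \<Longrightarrow> (P has_vector_derivative Q x) (at x within {a..b})" by blast
  have eq: "deriv_on a b P x = Q x" if "x \<in> {a..b}" for x
    using deriv_on_eq[OF assms(1) that Q[OF that]] .
  show "Ck_interval z a b k (deriv_on a b P)"
    using Q2 Ck_interval_cong[of a b "deriv_on a b P" Q z k] eq assms(1) by simp
  show "x \<in> {a..b} \<Longrightarrow> (P has_vector_derivative deriv_on a b P x) (at x within {a..b})"
    using Q eq by simp
qed

lemma smooth_interval_iff:
  assumes ab: "a < b"
  shows "smooth_interval z a b P \<longleftrightarrow>
    (\<forall>k. (deriv_on a b ^^ k) P differentiable_on {a..b} \<and> (z \<longrightarrow> (deriv_on a b ^^ k) P a = 0))"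
    (is "_ \<longleftrightarrow> ?R P")
proof
  assume s: "smooth_interval z a b P"
  have "smooth_interval z a b ((deriv_on a b ^^ n) P)" for n
    by (induction n) (use s in \<open>auto intro!: Ck_interval_deriv_on[OF ab] simp del: Ck_interval.simps(2)\<close>)
  then have n: "Ck_interval z a b (Suc 0) ((deriv_on a b ^^ n) P)" for n by blast
  show "?R P"
  proof (intro allI conjI)
    fix k
    show "(deriv_on a b ^^ k) P differentiable_on {a..b}"
      unfolding differentiable_on_def
      using differentiableI_vector[OF Ck_interval_deriv_on(2)[OF ab n[of k]]] by blast
    show "z \<longrightarrow> (deriv_on a b ^^ k) P a = 0" using n[of k] by simp
  qed
next
  assume "?R P"
  then show "smooth_interval z a b P"
  proof (intro allI)
    fix k assume "?R P"
    then show "Ck_interval z a b k P"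
    proof (induction k arbitrary: P)
      case 0
      then show ?case using spec[OF 0, of 0] by (auto intro: differentiable_imp_continuous_on)
    next
      case (Suc k)
      have "?R (deriv_on a b P)"
      proof
        fix n
        show "(deriv_on a b ^^ n) (deriv_on a b P) differentiable_on {a..b} \<and> (z \<longrightarrow> (deriv_on a b ^^ n) (deriv_on a b P) a = 0)"
          using spec[OF Suc.prems, of "Suc n"] unfolding funpow_Suc_right o_apply .
      qed
      then have "Ck_interval z a b k (deriv_on a b P)" by (rule Suc.IH)
      moreover have "P differentiable_on {a..b}" "z \<longrightarrow> P a = 0" using spec[OF Suc.prems, of 0] by simp_all
      ultimately show ?case
        by (intro Ck_interval_SucI[where Q = "deriv_on a b P"])
          (auto simp: deriv_on_def differentiable_on_def vector_derivative_works[symmetric])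
    qed
  qed
qed

lemma B1_iff_smooth: "a < b \<Longrightarrow> P \<in> B1 a b \<longleftrightarrow> P \<in> extensional {a..b} \<and> smooth_interval False a b P"
  by (simp add: B1_def smooth_interval_iff)

lemma M_iff_smooth: "a < b \<Longrightarrow> \<phi> \<in> M a b \<longleftrightarrow> \<phi> \<in> extensional {a..b} \<and> smooth_interval True a b \<phi>"
  by (auto simp: M_def B1_def smooth_interval_iff)

section \<open>The Volterra resolvent\<close>

text \<open>In the norm with weight \<open>exp (2 C (x - y))\<close>, composition with a kernel bounded by \<open>C\<close> is a
contraction with factor one half; the weight absorbs the length of the interval.\<close>

lemma star_exp_bound:
  assumes f: "continuous_on (triangle a b) f" and u: "continuous_on (triangle a b) u" and C: "C > 0"
    and fC: "\<And>p. p \<in> triangle a b \<Longrightarrow> norm (f p) \<le> C"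
    and uK: "\<And>p. p \<in> triangle a b \<Longrightarrow> norm (u p) \<le> K * exp (2 * C * (fst p - snd p))"
    and p: "p \<in> triangle a b"
  shows "norm (star f u p) \<le> K / 2 * exp (2 * C * (fst p - snd p))"
proof -
  obtain x y where xy: "p = (x, y)" "a \<le> y" "y \<le> x" "x \<le> b" using p by (cases p) auto
  have "norm (u p) \<ge> 0" by simp
  then have K: "K \<ge> 0" using uK[OF p] by (meson dual_order.trans exp_gt_zero zero_le_mult_iff not_le)
  have int: "((\<lambda>z. C * (K * exp (2 * C * (z - y)))) has_integral
      K / 2 * exp (2 * C * (x - y)) - K / 2 * exp (2 * C * (y - y))) {y..x}"
    by (rule fundamental_theorem_of_calculus[OF xy(3)])
      (auto intro!: derivative_eq_intros simp flip: has_real_derivative_iff_has_vector_derivative)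
  have "norm (star f u p) \<le> integral {y..x} (\<lambda>z. C * (K * exp (2 * C * (z - y))))"
    unfolding star_def xy fst_conv snd_conv
  proof (rule integral_norm_bound_integral)
    show "(\<lambda>z. f (x, z) * u (z, y)) integrable_on {y..x}"
      using xy by (intro star_integrable[OF f u]) auto
    show "(\<lambda>z. C * (K * exp (2 * C * (z - y)))) integrable_on {y..x}" using int by blast
    show "norm (f (x, z) * u (z, y)) \<le> C * (K * exp (2 * C * (z - y)))" if "z \<in> {y..x}" for z
      using that xy fC[of "(x, z)"] uK[of "(z, y)"] C unfolding norm_mult by (intro mult_mono) auto
  qed
  also have "\<dots> \<le> K / 2 * exp (2 * C * (x - y))"
    using K unfolding integral_unique[OF int] by simp
  finally show ?thesis by (simp add: xy)
qed

primrec neumann :: "(real \<times> real \<Rightarrow> complex) \<Rightarrow> nat \<Rightarrow> real \<times> real \<Rightarrow> complex" where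
  "neumann f 0 = (\<lambda>p. - f p)"
| "neumann f (Suc n) = (\<lambda>p. - star f (neumann f n) p)"

lemma continuous_neumann:
  "continuous_on (triangle a b) f \<Longrightarrow> continuous_on (triangle a b) (neumann f n)"
  by (induction n) (auto intro: continuous_on_minus continuous_on_star)

lemma neumann_bound:
  assumes f: "continuous_on (triangle a b) f" and C: "C > 0"
    and fC: "\<And>p. p \<in> triangle a b \<Longrightarrow> norm (f p) \<le> C" and p: "p \<in> triangle a b"
  shows "norm (neumann f n p) \<le> C * (1 / 2) ^ n * exp (2 * C * (fst p - snd p))"
  using p
proof (induction n arbitrary: p)
  case 0
  have "snd p \<le> fst p" using 0 by (auto simp: triangle_def)
  then have "C * 1 \<le> C * exp (2 * C * (fst p - snd p))"
    using C by (intro mult_left_mono) auto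
  then show ?case using fC[OF 0] by simp
next
  case (Suc n)
  show ?case
    using star_exp_bound[OF f continuous_neumann[OF f] C fC Suc.IH Suc.prems] by simp
qed

text \<open>The equation \<open>f + g + star f g = 0\<close> says that \<open>1 + g \<theta>\<close> is a right inverse of \<open>1 + f \<theta>\<close>. It is solved by
the Neumann series.\<close>

lemma right_quasi_inverse:
  assumes f: "continuous_on (triangle a b) f"
  obtains g where "continuous_on (triangle a b) g" "\<And>p. p \<in> triangle a b \<Longrightarrow> f p + g p + star f g p = 0"
proof -
  have "bounded (f ` triangle a b)"
    by (intro compact_imp_bounded compact_continuous_image f compact_triangle)
  then obtain C where C: "C > 0" "\<And>p. p \<in> triangle a b \<Longrightarrow> norm (f p) \<le> C"
    unfolding bounded_pos by blast
  define g where "g = (\<lambda>p. \<Sum>n. neumann f n p)"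
  define S where "S n p = (\<Sum>i<n. neumann f i p)" for n p
  have "uniform_limit (triangle a b) (\<lambda>n p. \<Sum>i<n. neumann f i p) (\<lambda>p. \<Sum>n. neumann f n p) sequentially"
  proof (rule Weierstrass_m_test)
    fix n p assume p: "p \<in> triangle a b"
    have "exp (2 * C * (fst p - snd p)) \<le> exp (2 * C * (b - a))"
      using p C by (auto simp: triangle_def)
    then have "C * (1 / 2) ^ n * exp (2 * C * (fst p - snd p)) \<le> C * (1 / 2) ^ n * exp (2 * C * (b - a))"
      using C by (intro mult_left_mono) auto
    then show "norm (neumann f n p) \<le> C * (1 / 2) ^ n * exp (2 * C * (b - a))"
      using neumann_bound[OF f C p, of n] by simp
  next
    show "summable (\<lambda>n. C * (1 / 2) ^ n * exp (2 * C * (b - a)))"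
      by (intro summable_mult summable_mult2 summable_geometric) simp
  qed
  then have lim: "uniform_limit (triangle a b) S g sequentially"
    by (simp add: S_def[abs_def] g_def)
  have S: "continuous_on (triangle a b) (S n)" for n
    unfolding S_def by (intro continuous_on_sum continuous_neumann f)
  have g: "continuous_on (triangle a b) g"
    by (rule uniform_limit_theorem[OF _ lim]) (simp_all add: S)
  \<comment> \<open>The partial sums are the iterates of \<open>g \<mapsto> - f - star f g\<close>; the equation is their limit.\<close>
  have rec: "S (Suc n) p = - f p - star f (S n) p" if p: "p \<in> triangle a b" for n p
  proof (induction n)
    case 0
    have "S 0 = (\<lambda>_. 0)" by (rule ext) (simp add: S_def)
    then show ?case by (simp add: S_def)
  next
    case (Suc n)
    have "star f (S (Suc n)) p = star f (\<lambda>p. S n p + neumann f n p) p"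
      unfolding S_def[abs_def] by simp
    also have "\<dots> = star f (S n) p + star f (neumann f n) p"
      by (rule star_add_right[OF f continuous_neumann[OF f] S p])
    finally have "star f (S (Suc n)) p = star f (S n) p + star f (neumann f n) p" .
    moreover have "S (Suc (Suc n)) p = S (Suc n) p - star f (neumann f n) p" by (simp add: S_def)
    ultimately show ?case using Suc.IH by simp
  qed
  have "f p + g p + star f g p = 0" if p: "p \<in> triangle a b" for p
  proof -
    obtain x y where xy: "p = (x, y)" "a \<le> y" "y \<le> x" "x \<le> b" using p by (cases p) auto
    have fx: "continuous_on {y..x} (\<lambda>z. f (x, z))" and gy: "continuous_on {y..x} (\<lambda>z. g (z, y))"
      using xy by (auto intro: continuous_slices[OF f] continuous_slices[OF g])
    have lim_y: "uniform_limit {y..x} (\<lambda>n z. S n (z, y)) (\<lambda>z. g (z, y)) sequentially"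
      by (rule uniform_limit_compose'[OF lim]) (use xy in auto)
    have "uniform_limit {y..x} (\<lambda>n z. f (x, z) * S n (z, y)) (\<lambda>z. f (x, z) * g (z, y)) sequentially"
      by (intro uniform_lim_mult uniform_limit_const lim_y compact_imp_bounded compact_continuous_image fx gy) simp_all
    moreover have "continuous_on {y..x} (\<lambda>z. f (x, z) * S n (z, y))" for n
      using xy by (intro star_integrand_continuous[OF f S]) simp
    ultimately obtain I J where I: "\<And>n. ((\<lambda>z. f (x, z) * S n (z, y)) has_integral I n) {y..x}"
      and J: "((\<lambda>z. f (x, z) * g (z, y)) has_integral J) {y..x}" and IJ: "I \<longlonglongrightarrow> J"
      by (rule uniform_limit_integral) (simp, blast)
    have "I n = star f (S n) p" "J = star f g p" for n
      using integral_unique[OF I[of n]] integral_unique[OF J] by (simp_all add: star_def xy)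
    then have "(\<lambda>n. star f (S n) p) \<longlonglongrightarrow> star f g p"
      using IJ by (metis (no_types, lifting) ext)
    then have "(\<lambda>n. - f p - star f (S n) p) \<longlonglongrightarrow> - f p - star f g p"
      by (intro tendsto_intros)
    moreover have "(\<lambda>n. S (Suc n) p) \<longlonglongrightarrow> g p"
      using tendsto_uniform_limitI[OF lim p] by (rule LIMSEQ_Suc)
    ultimately have "g p = - f p - star f g p"
      using rec[OF p] LIMSEQ_unique by simp
    then show ?thesis by simp
  qed
  then show ?thesis using that g by blast
qed

text \<open>A right inverse that itself has a right inverse is two-sided: with \<open>h\<close> the right quasi-inverse of \<open>g\<close>,
associativity forces \<open>h = f\<close>.\<close>

lemma quasi_inverse:
  assumes f: "continuous_on (triangle a b) f"
  obtains g where "continuous_on (triangle a b) g"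
    "\<And>p. p \<in> triangle a b \<Longrightarrow> f p + g p + star f g p = 0"
    "\<And>p. p \<in> triangle a b \<Longrightarrow> f p + g p + star g f p = 0"
proof -
  obtain g where g: "continuous_on (triangle a b) g" and fg: "\<And>p. p \<in> triangle a b \<Longrightarrow> f p + g p + star f g p = 0"
    using right_quasi_inverse[OF f] by blast
  obtain h where h: "continuous_on (triangle a b) h" and gh: "\<And>p. p \<in> triangle a b \<Longrightarrow> g p + h p + star g h p = 0"
    using right_quasi_inverse[OF g] by blast
  note cs = continuous_on_add continuous_on_star f g h
  have "f p = h p" if p: "p \<in> triangle a b" for p
  proof -
    have "star (\<lambda>p. f p + g p + star f g p) h p = star (\<lambda>_. 0) h p"
      by (rule star_cong[OF fg refl p])
    moreover have "star (\<lambda>p. f p + g p + star f g p) h p = star f h p + star g h p + star (star f g) h p"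
      using p by (simp add: star_add_left[where a = a and b = b] cs)
    moreover have "star f (\<lambda>p. g p + h p + star g h p) p = star f (\<lambda>_. 0) p"
      by (rule star_cong[OF refl gh p])
    moreover have "star f (\<lambda>p. g p + h p + star g h p) p = star f g p + star f h p + star f (star g h) p"
      using p by (simp add: star_add_right[where a = a and b = b] cs)
    ultimately have "star f h p + star g h p + star (star f g) h p = star f g p + star f h p + star (star f g) h p"
      using star_assoc[OF f g h p] by simp
    then have "star g h p = star f g p" by simp
    then have "h p + g p + star f g p = 0" using gh[OF p] by (simp only: ac_simps)
    with fg[OF p] have "f p + g p + star f g p = h p + g p + star f g p" by (rule trans[OF _ sym])
    then show ?thesis by simp
  qed
  then have "f p + g p + star g f p = 0" if "p \<in> triangle a b" for p
    using gh[OF that] star_cong[of a b g g f h p] that by (simp add: add.commute)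
  then show ?thesis using that g fg by blast
qed

text \<open>Bootstrapping: the equation with \<open>star f g\<close> expresses the \<open>x\<close>-derivative of \<open>g\<close> through \<open>g\<close>
and derivatives of \<open>f\<close>, the one with \<open>star g f\<close> does so for the \<open>y\<close>-derivative. Both equations are
needed because the \<open>y\<close>-derivative of \<open>star f g\<close> would involve that of \<open>g\<close>.\<close>

lemma Ck_quasi_inverse:
  assumes g: "continuous_on (triangle a b) g"
    and fg: "\<And>p. p \<in> triangle a b \<Longrightarrow> f p + g p + star f g p = 0"
    and gf: "\<And>p. p \<in> triangle a b \<Longrightarrow> f p + g p + star g f p = 0"
  shows "Ck_triangle a b k f \<Longrightarrow> Ck_triangle a b k g"
proof (induction k)
  case 0
  then show ?case using g by simp
next
  case (Suc k)
  note f_k = Ck_triangle_Suc_D[OF Suc.prems]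
  note g_k = Suc.IH[OF f_k]
  from Suc.prems obtain v w where
    vw: "has_dx a b f v" "has_dy a b f w" "Ck_triangle a b k v" "Ck_triangle a b k w" by auto
  note c = f_k[THEN Ck_triangle_continuous] vw(3,4)[THEN Ck_triangle_continuous]
  have g_eq: "g p = - (f p + star f g p)" "g p = - (f p + star g f p)" if "p \<in> triangle a b" for p
    using fg[OF that] gf[OF that] by (simp_all only: eq_neg_iff_add_eq_0 ac_simps)
  have dx: "has_dx a b g (\<lambda>p. - (v p + (f (fst p, fst p) * g p + star v g p)))"
    using has_dx_uminus[OF has_dx_add[OF vw(1) has_dx_star[OF c(1,2) g vw(1)]]]
    by (rule has_dx_transfer) (rule g_eq(1), assumption, rule refl)
  have dy: "has_dy a b g (\<lambda>p. - (w p + (- (g p * f (snd p, snd p)) + star g w p)))"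
    using has_dy_uminus[OF has_dy_add[OF vw(2) has_dy_star[OF g c(3,1) vw(2)]]]
    by (rule has_dy_transfer) (rule g_eq(2), assumption, rule refl)
  show ?case
    by (rule Ck_triangle_SucI[OF g dx dy])
      (intro Ck_triangle_uminus Ck_triangle_add Ck_triangle_mult Ck_triangle_star f_k g_k vw
        Ck_triangle_fst[OF Ck_interval_diagonal] Ck_triangle_snd[OF Ck_interval_diagonal])+
qed

lemma smooth_quasi_inverse:
  assumes "smooth_triangle a b f"
  obtains g where "smooth_triangle a b g"
    "\<And>p. p \<in> triangle a b \<Longrightarrow> f p + g p + star f g p = 0"
    "\<And>p. p \<in> triangle a b \<Longrightarrow> f p + g p + star g f p = 0"
  by (rule quasi_inverse[of a b f])
    (use assms Ck_triangle_continuous Ck_quasi_inverse in \<open>blast+\<close>)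

section \<open>Functions flat at the left endpoint\<close>

lemma power_over_fact_le_exp:
  fixes s :: real
  assumes "s \<ge> 0"
  shows "s ^ n / fact n \<le> exp s"
proof -
  have "(\<Sum>i\<in>{n}. s ^ i /\<^sub>R fact i) \<le> (\<Sum>i. s ^ i /\<^sub>R fact i)"
    by (rule sum_le_suminf) (use assms summable_exp_generic[of s] in auto)
  then show ?thesis by (simp add: exp_def divide_inverse_commute)
qed

text \<open>The family \<open>t\<^bsup>-m\<^esup> exp (- 1 / t)\<close> is closed under differentiation up to linear combinations, which gives
derivatives of all orders by a single induction.\<close>

definition flat_bump :: "nat \<Rightarrow> real \<Rightarrow> real" where
  "flat_bump m t = (if t \<le> 0 then 0 else inverse t ^ m * exp (- inverse t))"

text \<open>The quadratic bound makes the derivative at \<open>0\<close> vanish; it follows from \<open>s\<^bsup>m+2\<^esup> \<le> (m+2)! exp s\<close> for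
\<open>s = 1 / t\<close>.\<close>

lemma flat_bump_bounds:
  assumes "t \<ge> 0"
  shows "0 \<le> flat_bump m t" "flat_bump m t \<le> fact (m + 2) * t ^ 2"
proof -
  show "0 \<le> flat_bump m t" by (simp add: flat_bump_def)
  show "flat_bump m t \<le> fact (m + 2) * t ^ 2"
  proof (cases "t = 0")
    case False
    with assms have t: "t > 0" by simp
    define s where "s = inverse t"
    have s: "s > 0" "t = inverse s" using t by (simp_all add: s_def)
    have "s ^ (m + 2) \<le> fact (m + 2) * exp s"
      using power_over_fact_le_exp[OF less_imp_le[OF s(1)], of "m + 2"]
      by (simp only: pos_divide_le_eq[OF fact_gt_zero] mult.commute)
    then have "s ^ m * s ^ 2 * exp (- s) \<le> fact (m + 2) * exp s * exp (- s)"
      by (intro mult_right_mono[OF _ exp_ge_zero]) (simp only: power_add)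
    then have "s ^ m * exp (- s) * s ^ 2 \<le> fact (m + 2) * (exp s * exp (- s))"
      by (simp only: mult_ac)
    then have "s ^ m * exp (- s) * s ^ 2 \<le> fact (m + 2)"
      by (simp only: exp_minus_inverse mult_1_right)
    then have "s ^ m * exp (- s) \<le> fact (m + 2) / s ^ 2"
      using s by (simp add: pos_le_divide_eq)
    moreover have "flat_bump m t = s ^ m * exp (- s)" using t by (simp add: flat_bump_def s_def)
    moreover have "fact (m + 2) / s ^ 2 = fact (m + 2) * t ^ 2"
      unfolding s(2) by (simp only: power_inverse divide_inverse)
    ultimately show ?thesis by simp
  qed (simp add: flat_bump_def)
qed

lemma flat_bump_derivative:
  assumes "t \<ge> 0"
  shows "(flat_bump m has_real_derivative (flat_bump (m + 2) t - real m * flat_bump (m + 1) t)) (at t within {0..})"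
proof (cases "t = 0")
  case True
  have "((\<lambda>r. flat_bump m r / r) \<longlongrightarrow> 0) (at 0 within {0..})"
  proof (rule Lim_null_comparison)
    show "\<forall>\<^sub>F r in at 0 within {0..}. norm (flat_bump m r / r) \<le> fact (m + 2) * r"
      unfolding eventually_at_filter
      using flat_bump_bounds[of _ m] by (auto simp: field_simps power2_eq_square intro!: always_eventually)
    show "((\<lambda>r::real. fact (m + 2) * r) \<longlongrightarrow> 0) (at 0 within {0..})"
      by (rule tendsto_eq_rhs[OF tendsto_mult[OF tendsto_const tendsto_ident_at]]) simp
  qed
  then show ?thesis
    using True by (simp add: has_field_derivative_iff flat_bump_def)
next
  case False
  with assms have t: "t > 0" by simp
  have inv: "(inverse has_real_derivative - (inverse t ^ 2)) (at t)"
    using DERIV_inverse[of t] t by (simp add: numeral_2_eq_2)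
  have "((\<lambda>t. inverse t ^ m * exp (- inverse t)) has_real_derivative
      real m * (- (inverse t ^ 2) * inverse t ^ (m - Suc 0)) * exp (- inverse t) +
      exp (- inverse t) * - (- (inverse t ^ 2)) * inverse t ^ m) (at t)"
    by (intro DERIV_mult DERIV_power inv DERIV_fun_exp DERIV_minus)
  also have "real m * (- (inverse t ^ 2) * inverse t ^ (m - Suc 0)) * exp (- inverse t) +
      exp (- inverse t) * - (- (inverse t ^ 2)) * inverse t ^ m =
      inverse t ^ (m + 2) * exp (- inverse t) - real m * (inverse t ^ (m + 1) * exp (- inverse t))"
    by (cases m) (simp_all add: power2_eq_square algebra_simps)
  finally have "((\<lambda>t. inverse t ^ m * exp (- inverse t)) has_real_derivative
      (inverse t ^ (m + 2) * exp (- inverse t) - real m * (inverse t ^ (m + 1) * exp (- inverse t)))) (at t)" .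
  then have d: "(flat_bump m has_real_derivative
      (inverse t ^ (m + 2) * exp (- inverse t) - real m * (inverse t ^ (m + 1) * exp (- inverse t)))) (at t)"
    by (rule has_field_derivative_transform_within_open[where S = "{0<..}"]) (use t in \<open>simp_all add: flat_bump_def\<close>)
  show ?thesis
  proof (rule has_field_derivative_at_within)
    have "flat_bump k t = inverse t ^ k * exp (- inverse t)" for k
      using t by (simp add: flat_bump_def)
    with d show "(flat_bump m has_real_derivative flat_bump (m + 2) t - real m * flat_bump (m + 1) t) (at t)"
      by (simp only:)
  qed
qed

lemma Ck_interval_flat_bump: "Ck_interval True a b k (\<lambda>x. of_real (flat_bump m (x - a)))"
proof (induction k arbitrary: m)
  case 0
  have "continuous_on {0..} (flat_bump m)"
    by (rule DERIV_continuous_on, rule flat_bump_derivative) simp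
  then have "continuous_on {a..b} (\<lambda>x. flat_bump m (x - a))"
    by (rule continuous_on_compose2) (auto intro!: continuous_intros)
  then show ?case by (auto simp: flat_bump_def[of _ 0] intro!: continuous_intros)
next
  case (Suc k)
  show ?case
  proof (rule Ck_interval_SucI)
    show "Ck_interval True a b k (\<lambda>x. of_real (flat_bump (m + 2) (x - a)) + - of_nat m * of_real (flat_bump (m + 1) (x - a)))"
      by (intro Ck_interval_add Ck_interval_mult Ck_interval_const Suc.IH)
    fix x assume x: "x \<in> {a..b}"
    let ?D = "flat_bump (m + 2) (x - a) - real m * flat_bump (m + 1) (x - a)"
    have "((\<lambda>x. x - a) has_real_derivative 1) (at x within {a..b})"
      by (auto intro!: derivative_eq_intros)
    with DERIV_subset[OF flat_bump_derivative] have "(flat_bump m \<circ> (\<lambda>x. x - a) has_real_derivative ?D * 1) (at x within {a..b})"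
      by (rule DERIV_image_chain) (use x in auto)
    then have "((\<lambda>x. flat_bump m (x - a)) has_real_derivative ?D * 1) (at x within {a..b})"
      by (simp add: o_def)
    then have "((\<lambda>x. complex_of_real (flat_bump m (x - a))) has_vector_derivative of_real ?D) (at x within {a..b})"
      by (intro has_vector_derivative_of_real) (simp add: has_real_derivative_iff_has_vector_derivative)
    then show "((\<lambda>x. complex_of_real (flat_bump m (x - a))) has_vector_derivative
        of_real (flat_bump (m + 2) (x - a)) + - of_nat m * of_real (flat_bump (m + 1) (x - a))) (at x within {a..b})"
      by simp
  qed (simp add: flat_bump_def)
qed

lemma Ck_interval_monomial: "Ck_interval False a b k (\<lambda>x. of_real (x - a) ^ N)"
proof (induction N)
  case 0
  then show ?case using Ck_interval_const[of a b k 1] by simp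
next
  case (Suc N)
  have "Ck_interval False a b k (\<lambda>x. of_real (x - a))"
  proof (cases k)
    case 0
    then show ?thesis by (auto intro!: continuous_intros)
  next
    case (Suc n)
    have "((\<lambda>x. complex_of_real (x - a)) has_vector_derivative 1) (at x within {a..b})" for x
      by (auto intro!: derivative_eq_intros)
    then show ?thesis
      unfolding Suc by (intro Ck_interval_SucI[where Q = "\<lambda>_. 1"] Ck_interval_const) auto
  qed
  from Ck_interval_mult[OF this Suc] show ?case by simp
qed

section \<open>Volterra operators\<close>

definition volterra :: "real \<Rightarrow> (real \<times> real \<Rightarrow> complex) \<Rightarrow> (real \<Rightarrow> complex) \<Rightarrow> real \<Rightarrow> complex" where
  "volterra a f \<phi> x = integral {a..x} (\<lambda>z. f (x, z) * \<phi> z)"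

text \<open>A function of one variable is a kernel that ignores its second argument; integrals against it are the
slice \<open>y = a\<close> of a composition of kernels, so facts about kernels apply.\<close>

lemma volterra_eq_star: "volterra a f \<phi> x = star f (\<lambda>p. \<phi> (fst p)) (x, a)"
  by (simp add: volterra_def star_def)

lemma volterra_derivative:
  assumes "continuous_on (triangle a b) f" "continuous_on (triangle a b) f'" "continuous_on {a..b} \<phi>"
    and "has_dx a b f f'" "x \<in> {a..b}"
  shows "(volterra a f \<phi> has_vector_derivative f (x, x) * \<phi> x + volterra a f' \<phi> x) (at x within {a..b})"
  using has_dxD[OF has_dx_star[OF assms(1,2) continuous_on_triangle_coordinate(1)[OF assms(3)] assms(4)], of a x] assms(5)
  unfolding volterra_eq_star[abs_def] by simp

lemma Ck_interval_volterra:
  "Ck_triangle a b k f \<Longrightarrow> Ck_interval z a b k \<phi> \<Longrightarrow> Ck_interval z a b k (volterra a f \<phi>)"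
proof (induction k arbitrary: f)
  case 0
  then show ?case
    using continuous_slices(1)[OF continuous_on_star[OF _ continuous_on_triangle_coordinate(1)], of a b f \<phi> a a b]
    by (cases "a \<le> b") (simp_all add: volterra_eq_star[abs_def], simp_all add: star_def)
next
  case (Suc k)
  from Suc.prems obtain f' where f': "has_dx a b f f'" "Ck_triangle a b k f'" by auto
  note f_k = Ck_triangle_Suc_D[OF Suc.prems(1)] and p_k = Ck_interval_Suc_D[OF Suc.prems(2)]
  show ?case
  proof (rule Ck_interval_SucI)
    show "Ck_interval z a b k (\<lambda>x. f (x, x) * \<phi> x + volterra a f' \<phi> x)"
      by (intro Ck_interval_add Ck_interval_mult Ck_interval_diagonal Suc.IH f_k f' p_k)
    show "(volterra a f \<phi> has_vector_derivative f (x, x) * \<phi> x + volterra a f' \<phi> x) (at x within {a..b})"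
      if "x \<in> {a..b}" for x
      using that by (intro volterra_derivative f' f_k[THEN Ck_triangle_continuous] f'(2)[THEN Ck_triangle_continuous]
        p_k[THEN Ck_interval_continuous])
  qed (simp add: volterra_def)
qed

lemma volterra_by_parts:
  assumes f: "continuous_on (triangle a b) f" and fy: "continuous_on (triangle a b) fy" and dy: "has_dy a b f fy"
    and d: "\<And>z. z \<in> {a..b} \<Longrightarrow> (\<phi> has_vector_derivative \<phi>' z) (at z within {a..b})"
    and c: "continuous_on {a..b} \<phi>'" and z: "\<phi> a = 0" and x: "x \<in> {a..b}"
  shows "volterra a f \<phi>' x = f (x, x) * \<phi> x - volterra a fy \<phi> x"
proof -
  have cp: "continuous_on {a..b} \<phi>"
    using d by (intro continuous_on_if_vector_derivative[of _ _ \<phi>']) blast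
  have "((\<lambda>z. f (x, z) * \<phi>' z + fy (x, z) * \<phi> z) has_integral f (x, x) * \<phi> x - f (x, a) * \<phi> a) {a..x}"
  proof (rule fundamental_theorem_of_calculus)
    fix z assume z: "z \<in> {a..x}"
    show "((\<lambda>z. f (x, z) * \<phi> z) has_vector_derivative f (x, z) * \<phi>' z + fy (x, z) * \<phi> z) (at z within {a..x})"
      using x z by (intro has_vector_derivative_mult has_dyD[OF dy]
        has_vector_derivative_within_subset[OF d]) auto
  qed (use x in auto)
  then have "integral {a..x} (\<lambda>z. f (x, z) * \<phi>' z + fy (x, z) * \<phi> z) = f (x, x) * \<phi> x"
    using z by (simp add: integral_unique)
  moreover have "integral {a..x} (\<lambda>z. f (x, z) * \<phi>' z + fy (x, z) * \<phi> z) = volterra a f \<phi>' x + volterra a fy \<phi> x"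
    unfolding volterra_def using x
    by (intro Henstock_Kurzweil_Integration.integral_add integrable_continuous_real continuous_on_mult
      continuous_slices[OF f] continuous_slices[OF fy] continuous_on_subset[OF c] continuous_on_subset[OF cp]) auto
  ultimately show ?thesis by (simp add: eq_diff_eq)
qed

text \<open>The operator \<open>P + f \<theta>\<close>, for coefficients that need not be extensional; only their restrictions to the
interval and to the triangle matter.\<close>

definition vop :: "real \<Rightarrow> real \<Rightarrow> (real \<Rightarrow> complex) \<Rightarrow> (real \<times> real \<Rightarrow> complex) \<Rightarrow> operator" where
  "vop a b P f = (\<lambda>\<phi>\<in>M a b. \<lambda>x\<in>{a..b}. P x * \<phi> x + volterra a f \<phi> x)"

locale nondegenerate_interval =
  fixes a b :: real
  assumes less: "a < b"
begin

lemma M_D: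
  assumes "\<phi> \<in> M a b"
  shows "\<phi> \<in> extensional {a..b}" "Ck_interval True a b k \<phi>" "continuous_on {a..b} \<phi>" "\<phi> a = 0"
    "deriv_on a b \<phi> \<in> M a b"
    "x \<in> {a..b} \<Longrightarrow> (\<phi> has_vector_derivative deriv_on a b \<phi> x) (at x within {a..b})"
proof -
  show 1: "\<phi> \<in> extensional {a..b}" and 2: "Ck_interval True a b k \<phi>" for k using assms M_iff_smooth[OF less] by auto
  show "continuous_on {a..b} \<phi>" "\<phi> a = 0"
    using 2[of 0] by (auto dest: Ck_interval_continuous Ck_interval_zero_at)
  show "deriv_on a b \<phi> \<in> M a b"
    unfolding M_iff_smooth[OF less] using Ck_interval_deriv_on(1)[OF less 2] by (auto simp: deriv_on_def)
  show "x \<in> {a..b} \<Longrightarrow> (\<phi> has_vector_derivative deriv_on a b \<phi> x) (at x within {a..b})"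
    by (rule Ck_interval_deriv_on(2)[OF less 2[of "Suc 0"]])
qed

lemma restrict_in_M:
  assumes "\<And>k. Ck_interval True a b k \<phi>"
  shows "restrict \<phi> {a..b} \<in> M a b"
  unfolding M_iff_smooth[OF less]
  using assms Ck_interval_cong[of a b "restrict \<phi> {a..b}" \<phi> True] less by auto

lemma vop_in_M:
  assumes "smooth_interval False a b P" "smooth_triangle a b f" "\<phi> \<in> M a b"
  shows "vop a b P f \<phi> \<in> M a b"
  unfolding vop_def restrict_apply'[OF assms(3)]
  using assms M_D(2)[OF assms(3)]
  by (intro restrict_in_M Ck_interval_add Ck_interval_mult Ck_interval_volterra) auto

lemma vop_apply: "\<phi> \<in> M a b \<Longrightarrow> x \<in> {a..b} \<Longrightarrow> vop a b P f \<phi> x = P x * \<phi> x + volterra a f \<phi> x"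
  by (simp add: vop_def)

lemma operator_eqI:
  assumes "S \<in> extensional (M a b)" "T \<in> extensional (M a b)"
    and "\<And>\<phi>. \<phi> \<in> M a b \<Longrightarrow> S \<phi> \<in> extensional {a..b}" "\<And>\<phi>. \<phi> \<in> M a b \<Longrightarrow> T \<phi> \<in> extensional {a..b}"
    and "\<And>\<phi> x. \<phi> \<in> M a b \<Longrightarrow> x \<in> {a..b} \<Longrightarrow> S \<phi> x = T \<phi> x"
  shows "S = T"
  by (intro extensionalityI[OF assms(1,2)] extensionalityI[OF assms(3,4)] assms(5))

lemma vop_extensional: "vop a b P f \<in> extensional (M a b)" "\<phi> \<in> M a b \<Longrightarrow> vop a b P f \<phi> \<in> extensional {a..b}"
  by (simp_all add: vop_def)

lemma vop_cong:
  assumes "\<And>x. x \<in> {a..b} \<Longrightarrow> P x = Q x" "\<And>p. p \<in> triangle a b \<Longrightarrow> f p = g p"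
  shows "vop a b P f = vop a b Q g"
proof (rule operator_eqI)
  fix \<phi> x assume "\<phi> \<in> M a b" "x \<in> {a..b}"
  then show "vop a b P f \<phi> x = vop a b Q g \<phi> x"
    using assms star_cong[of a b f g "\<lambda>p. \<phi> (fst p)" "\<lambda>p. \<phi> (fst p)" "(x, a)"]
    by (simp add: vop_apply volterra_eq_star)
qed (simp_all add: vop_extensional)

lemma volterra_add:
  assumes "continuous_on (triangle a b) f" "continuous_on (triangle a b) g" "\<phi> \<in> M a b" "x \<in> {a..b}"
  shows "volterra a (\<lambda>p. f p + g p) \<phi> x = volterra a f \<phi> x + volterra a g \<phi> x"
  unfolding volterra_eq_star
  using assms by (intro star_add_left[of a b] continuous_on_triangle_coordinate M_D) auto

lemma vop_add:
  assumes "smooth_triangle a b f" "smooth_triangle a b g"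
  shows "add_op a b (vop a b P f) (vop a b Q g) = vop a b (\<lambda>x. P x + Q x) (\<lambda>p. f p + g p)"
proof (rule operator_eqI)
  fix \<phi> x assume px: "\<phi> \<in> M a b" "x \<in> {a..b}"
  have "continuous_on (triangle a b) f" "continuous_on (triangle a b) g"
    using assms Ck_triangle_continuous by blast+
  then show "add_op a b (vop a b P f) (vop a b Q g) \<phi> x = vop a b (\<lambda>x. P x + Q x) (\<lambda>p. f p + g p) \<phi> x"
    using px by (simp add: add_op_def vop_apply volterra_add distrib_right)
qed (simp_all add: vop_extensional add_op_def)

lemma vop_comp:
  assumes P: "smooth_interval False a b P" and f: "smooth_triangle a b f"
    and Q: "smooth_interval False a b Q" and g: "smooth_triangle a b g"
  shows "compose (M a b) (vop a b P f) (vop a b Q g) =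
    vop a b (\<lambda>x. P x * Q x) (\<lambda>p. P (fst p) * g p + (f p * Q (snd p) + star f g p))"
proof (rule operator_eqI)
  fix \<phi> x assume px: "\<phi> \<in> M a b" "x \<in> {a..b}"
  let ?\<phi> = "\<lambda>p::real \<times> real. \<phi> (fst p)"
  have cont: "continuous_on (triangle a b) f" "continuous_on (triangle a b) g"
      "continuous_on {a..b} P" "continuous_on {a..b} Q" "continuous_on (triangle a b) ?\<phi>"
    using assms Ck_triangle_continuous Ck_interval_continuous M_D(3)[OF px(1)]
    by (blast intro: continuous_on_triangle_coordinate)+
  note cs = cont continuous_on_star continuous_on_triangle_coordinate continuous_on_mult continuous_on_add
  have xa: "(x, a) \<in> triangle a b" using px by simp
  have "volterra a f (vop a b Q g \<phi>) x = star f (\<lambda>p. Q (fst p) * ?\<phi> p + star g ?\<phi> p) (x, a)"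
    unfolding volterra_def star_def[of f] fst_conv snd_conv
    by (intro Henstock_Kurzweil_Integration.integral_cong) (use px in \<open>auto simp: vop_apply volterra_eq_star\<close>)
  also have "\<dots> = star f (\<lambda>p. Q (fst p) * ?\<phi> p) (x, a) + star f (star g ?\<phi>) (x, a)"
    by (rule star_add_right[OF _ _ _ xa]) (intro cs)+
  also have "star f (star g ?\<phi>) (x, a) = star (star f g) ?\<phi> (x, a)"
    by (rule star_assoc[OF cont(1,2,5) xa])
  also have "star f (\<lambda>p. Q (fst p) * ?\<phi> p) (x, a) = star (\<lambda>p. f p * Q (snd p)) ?\<phi> (x, a)"
    by (simp add: star_def mult.assoc)
  finally have 1: "volterra a f (vop a b Q g \<phi>) x =
    star (\<lambda>p. f p * Q (snd p)) ?\<phi> (x, a) + star (star f g) ?\<phi> (x, a)" .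
  have "star (\<lambda>p. P (fst p) * g p + (f p * Q (snd p) + star f g p)) ?\<phi> (x, a) =
    star (\<lambda>p. P (fst p) * g p) ?\<phi> (x, a) + star (\<lambda>p. f p * Q (snd p) + star f g p) ?\<phi> (x, a)"
    by (rule star_add_left[OF _ _ _ xa]) (intro cs)+
  also have "star (\<lambda>p. f p * Q (snd p) + star f g p) ?\<phi> (x, a) =
    star (\<lambda>p. f p * Q (snd p)) ?\<phi> (x, a) + star (star f g) ?\<phi> (x, a)"
    by (rule star_add_left[OF _ _ _ xa]) (intro cs)+
  also have "star (\<lambda>p. P (fst p) * g p) ?\<phi> (x, a) = P x * star g ?\<phi> (x, a)"
    by (simp add: star_def mult.assoc)
  finally show "compose (M a b) (vop a b P f) (vop a b Q g) \<phi> x =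
    vop a b (\<lambda>x. P x * Q x) (\<lambda>p. P (fst p) * g p + (f p * Q (snd p) + star f g p)) \<phi> x"
    using px vop_in_M[OF Q g px(1)] 1
    by (simp add: compose_def vop_apply volterra_eq_star algebra_simps)
qed (simp_all add: vop_extensional compose_def vop_in_M[OF Q g])

lemma mult_op_eq_vop: "mult_op a b P = vop a b P (\<lambda>_. 0)"
  by (rule operator_eqI) (simp_all add: vop_extensional vop_apply mult_op_def volterra_def)

lemma int_op_eq_vop: "int_op a b f = vop a b (\<lambda>_. 0) f"
  by (rule operator_eqI) (simp_all add: vop_extensional vop_apply int_op_def volterra_def)

lemma identity_eq_vop: "(\<lambda>\<phi>\<in>M a b. \<phi>) = vop a b (\<lambda>_. 1) (\<lambda>_. 0)"
  by (rule operator_eqI) (auto simp: vop_extensional vop_apply volterra_def M_D(1))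

lemma diff_op_in_M: "\<phi> \<in> M a b \<Longrightarrow> diff_op a b \<phi> \<in> M a b"
  by (simp add: diff_op_def M_D)

text \<open>The product rule for the multiplication part and Leibniz' rule for the integral part.\<close>

lemma diff_comp_vop:
  assumes P: "smooth_interval False a b P" and f: "smooth_triangle a b f"
    and P': "\<And>x. x \<in> {a..b} \<Longrightarrow> (P has_vector_derivative P' x) (at x within {a..b})"
    and f': "has_dx a b f f'" "smooth_triangle a b f'"
  shows "compose (M a b) (diff_op a b) (vop a b P f) =
    add_op a b (compose (M a b) (vop a b P (\<lambda>_. 0)) (diff_op a b)) (vop a b (\<lambda>x. P' x + f (x, x)) f')"
proof (rule operator_eqI)
  fix \<phi> x assume px: "\<phi> \<in> M a b" "x \<in> {a..b}"
  have cont: "continuous_on (triangle a b) f" "continuous_on (triangle a b) f'"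
    using f f' Ck_triangle_continuous by blast+
  have "((\<lambda>x. P x * \<phi> x + volterra a f \<phi> x) has_vector_derivative
      (P x * deriv_on a b \<phi> x + P' x * \<phi> x) + (f (x, x) * \<phi> x + volterra a f' \<phi> x)) (at x within {a..b})"
    using px by (intro has_vector_derivative_add has_vector_derivative_mult P' volterra_derivative cont f' M_D)
  then have "(vop a b P f \<phi> has_vector_derivative
      (P x * deriv_on a b \<phi> x + P' x * \<phi> x) + (f (x, x) * \<phi> x + volterra a f' \<phi> x)) (at x within {a..b})"
    using px by (intro has_vector_derivative_transform[of x "{a..b}" "vop a b P f \<phi>"]) (auto simp: vop_apply)
  then have "deriv_on a b (vop a b P f \<phi>) x =
      (P x * deriv_on a b \<phi> x + P' x * \<phi> x) + (f (x, x) * \<phi> x + volterra a f' \<phi> x)"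
    by (rule deriv_on_eq[OF less px(2)])
  then show "compose (M a b) (diff_op a b) (vop a b P f) \<phi> x =
    add_op a b (compose (M a b) (vop a b P (\<lambda>_. 0)) (diff_op a b)) (vop a b (\<lambda>x. P' x + f (x, x)) f') \<phi> x"
    using px vop_in_M[OF P f px(1)] M_D(5)[OF px(1)]
    by (simp add: compose_def diff_op_def add_op_def vop_apply algebra_simps) (simp add: volterra_def)
qed (simp_all add: compose_def diff_op_def deriv_on_def add_op_def vop_in_M[OF P f])

text \<open>Integration by parts; the boundary term at \<open>a\<close> vanishes on \<open>M a b\<close>.\<close>

lemma integral_comp_diff:
  assumes f: "smooth_triangle a b f" and f': "has_dy a b f f'" "smooth_triangle a b f'"
  shows "compose (M a b) (vop a b (\<lambda>_. 0) f) (diff_op a b) = vop a b (\<lambda>x. f (x, x)) (\<lambda>p. - f' p)"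
proof (rule operator_eqI)
  fix \<phi> x assume px: "\<phi> \<in> M a b" "x \<in> {a..b}"
  have cont: "continuous_on (triangle a b) f" "continuous_on (triangle a b) f'"
    using f f' Ck_triangle_continuous by blast+
  have "volterra a f (deriv_on a b \<phi>) x = f (x, x) * \<phi> x - volterra a f' \<phi> x"
    using px by (intro volterra_by_parts[OF cont f'(1)] M_D M_D(3)[OF M_D(5)])
  then show "compose (M a b) (vop a b (\<lambda>_. 0) f) (diff_op a b) \<phi> x = vop a b (\<lambda>x. f (x, x)) (\<lambda>p. - f' p) \<phi> x"
    using px M_D(5)[OF px(1)]
    by (simp add: compose_def diff_op_def vop_apply) (simp add: volterra_def)
qed (simp_all add: vop_extensional compose_def diff_op_def vop_apply M_D(5))

lemma diff_comp_antiderivative: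
  "compose (M a b) (diff_op a b) (vop a b (\<lambda>_. 0) (\<lambda>_. 1)) = vop a b (\<lambda>_. 1) (\<lambda>_. 0)"
proof -
  have "compose (M a b) (diff_op a b) (vop a b (\<lambda>_. 0) (\<lambda>_. 1)) =
    add_op a b (compose (M a b) (vop a b (\<lambda>_. 0) (\<lambda>_. 0)) (diff_op a b)) (vop a b (\<lambda>x. 0 + 1) (\<lambda>_. 0))"
    by (rule diff_comp_vop) (auto simp: has_dx_def Ck_interval_const Ck_triangle_const)
  also have "\<dots> = vop a b (\<lambda>_. 1) (\<lambda>_. 0)"
    by (rule operator_eqI)
      (auto simp: add_op_def vop_extensional compose_def diff_op_def vop_apply M_D(5) volterra_def)
  finally show ?thesis .
qed

lemma antiderivative_comp_diff:
  "compose (M a b) (vop a b (\<lambda>_. 0) (\<lambda>_. 1)) (diff_op a b) = vop a b (\<lambda>_. 1) (\<lambda>_. 0)"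
  using integral_comp_diff[of "\<lambda>_. 1" "\<lambda>_. 0"] by (simp add: has_dy_def Ck_triangle_const)

text \<open>Evaluate the equation at \<open>y > a\<close> on \<open>(x - a)\<^sup>N exp (- 1 / (x - a))\<close>. The multiplication part contributes
\<open>(y - a)\<^sup>N\<close> times a constant, while the integral is of size \<open>(y - a)\<^bsup>N+1\<^esup> / (N + 1)\<close>, which is
negligible as \<open>N\<close> grows. The point \<open>a\<close> follows by continuity.\<close>

lemma vop_eq_imp_multiplier_eq:
  assumes P: "continuous_on {a..b} P" and Q: "continuous_on {a..b} Q"
    and f: "continuous_on (triangle a b) f" and g: "continuous_on (triangle a b) g"
    and eq: "vop a b P f = vop a b Q g" and x: "x \<in> {a..b}"
  shows "P x = Q x"
proof -
  have right: "P y - Q y = 0" if y: "y \<in> {a<..b}" for y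
  proof (rule ccontr)
    assume ne: "P y - Q y \<noteq> 0"
    let ?h = "\<lambda>p. g p + - f p"
    have h: "continuous_on (triangle a b) ?h" by (intro continuous_on_add continuous_on_minus f g)
    have "bounded (?h ` triangle a b)"
      by (intro compact_imp_bounded compact_continuous_image h compact_triangle)
    then obtain C where C: "C > 0" "\<And>p. p \<in> triangle a b \<Longrightarrow> norm (?h p) \<le> C"
      unfolding bounded_pos by blast
    define G where "G = flat_bump 0 (y - a)"
    have G: "G > 0" using y by (simp add: G_def flat_bump_def)
    have bound: "norm (P y - Q y) * G * real (Suc N) \<le> C * (y - a)" for N
    proof -
      let ?\<phi> = "\<lambda>x. complex_of_real (x - a) ^ N * of_real (flat_bump 0 (x - a))"
      let ?\<psi> = "restrict ?\<phi> {a..b}"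
      have M: "?\<psi> \<in> M a b"
        by (intro restrict_in_M Ck_interval_mult Ck_interval_monomial Ck_interval_flat_bump)
      have y': "y \<in> {a..b}" using y by simp
      have "vop a b P f ?\<psi> y = vop a b Q g ?\<psi> y" using eq by simp
      then have "P y * ?\<phi> y + volterra a f ?\<psi> y = Q y * ?\<phi> y + volterra a g ?\<psi> y"
        unfolding vop_apply[OF M y'] restrict_apply'[OF y'] .
      then have "(P y - Q y) * ?\<phi> y = volterra a g ?\<psi> y - volterra a f ?\<psi> y"
        by (simp add: algebra_simps)
      also have "\<dots> = volterra a ?h ?\<psi> y"
        using volterra_add[OF g continuous_on_minus[OF f] M y'] by (simp add: volterra_def)
      finally have "norm ((P y - Q y) * ?\<phi> y) = norm (volterra a ?h ?\<psi> y)" by (rule arg_cong)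
      moreover have "norm ((P y - Q y) * ?\<phi> y) = norm (P y - Q y) * ((y - a) ^ N * G)"
        using y G unfolding norm_mult norm_power norm_of_real G_def by simp
      ultimately have "norm (P y - Q y) * ((y - a) ^ N * G) = norm (volterra a ?h ?\<psi> y)" by simp
      also have "\<dots> \<le> integral {a..y} (\<lambda>z. C * (z - a) ^ N)"
        unfolding volterra_def
      proof (rule integral_norm_bound_integral)
        show "(\<lambda>z. ?h (y, z) * ?\<psi> z) integrable_on {a..y}"
          using y by (intro integrable_continuous_real continuous_on_mult continuous_slices(2)[OF h]
            continuous_on_subset[OF M_D(3)[OF M]]) auto
        show "(\<lambda>z. C * (z - a) ^ N) integrable_on {a..y}"
          by (intro integrable_continuous_real continuous_intros)
        fix z assume z: "z \<in> {a..y}"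
        have "0 \<le> flat_bump 0 (z - a)" "flat_bump 0 (z - a) \<le> 1" by (simp_all add: flat_bump_def)
        then have "norm (?\<psi> z) \<le> (z - a) ^ N * 1"
          using z y unfolding norm_mult norm_power by (simp add: norm_mult norm_power mult_left_le flip: of_real_diff)
        then show "norm (?h (y, z) * ?\<psi> z) \<le> C * (z - a) ^ N"
          unfolding norm_mult using z y C by (intro mult_mono) auto
      qed
      also have "\<dots> = C * (y - a) ^ Suc N / real (Suc N)"
      proof -
        have power: "(z - a) ^ N + real N * (z - a) ^ (N - Suc 0) * (z - a) = real (Suc N) * (z - a) ^ N" for z
          by (cases N) (simp_all add: algebra_simps)
        have "((\<lambda>z. C * (z - a) ^ N) has_integral C * (y - a) ^ Suc N / real (Suc N) - C * (a - a) ^ Suc N / real (Suc N)) {a..y}"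
          using y by (intro fundamental_theorem_of_calculus)
            (auto intro!: derivative_eq_intros simp: power simp del: of_nat_Suc simp flip: has_real_derivative_iff_has_vector_derivative)
        from integral_unique[OF this] show ?thesis by simp
      qed
      finally have "(y - a) ^ N * (norm (P y - Q y) * G * real (Suc N)) \<le> (y - a) ^ N * (C * (y - a))"
        by (simp add: field_simps del: of_nat_Suc)
      then show ?thesis using y by (simp del: of_nat_Suc)
    qed
    have "norm (P y - Q y) * G > 0" using ne G by simp
    then obtain N where "C * (y - a) < real N * (norm (P y - Q y) * G)"
      using reals_Archimedean3 by blast
    also have "\<dots> \<le> real (Suc N) * (norm (P y - Q y) * G)"
      using G by (intro mult_right_mono) auto
    finally show False using bound[of N] by (simp add: mult.commute)
  qed
  have "P x - Q x = 0"
    by (rule continuous_constant_on_closure[of "{a<..b}"])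
      (use right x less in \<open>auto intro!: continuous_on_diff P Q\<close>)
  then show ?thesis by simp
qed

end

section \<open>Generation by powers of a normalizing element\<close>

text \<open>If \<open>d\<close> normalizes the subgroup \<open>E\<close>, the cosets \<open>E d\<^sup>m\<close> with integer \<open>m\<close> form a subgroup. Elements with
\<open>m \<ge> 0\<close> lie in \<open>H\<close>, and the inverse of an element with \<open>m < 0\<close> does.\<close>

lemma (in group) generate_by_powers_of_normalizing_element:
  assumes E: "subgroup E G" and d: "d \<in> carrier G"
    and left: "\<And>e. e \<in> E \<Longrightarrow> \<exists>e'\<in>E. d \<otimes> e = e' \<otimes> d"
    and right: "\<And>e. e \<in> E \<Longrightarrow> \<exists>e'\<in>E. e \<otimes> d = d \<otimes> e'"
  defines "H \<equiv> {e \<otimes> d [^] n | e n. e \<in> E \<and> n \<in> (UNIV :: nat set)}"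
  shows "generate G H = H \<union> {u \<in> carrier G. inv u \<in> H}"
proof -
  interpret E: subgroup E G by (rule E)
  define K where "K = {e \<otimes> d [^] m | e m. e \<in> E \<and> m \<in> (UNIV :: int set)}"
  have left_nat: "\<exists>e'\<in>E. d [^] n \<otimes> e = e' \<otimes> d [^] n" if "e \<in> E" for e and n :: nat
    using that
  proof (induction n arbitrary: e)
    case (Suc n)
    obtain e1 where e1: "e1 \<in> E" "d \<otimes> e = e1 \<otimes> d" using left[OF Suc.prems] by blast
    obtain e2 where e2: "e2 \<in> E" "d [^] n \<otimes> e1 = e2 \<otimes> d [^] n" using Suc.IH[OF e1(1)] by blast
    have "d [^] Suc n \<otimes> e = d [^] n \<otimes> (d \<otimes> e)" using Suc.prems d by (simp add: m_assoc)
    also have "\<dots> = d [^] n \<otimes> e1 \<otimes> d" using e1 d by (simp add: m_assoc)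
    also have "\<dots> = e2 \<otimes> d [^] Suc n" using e2 d by (simp add: m_assoc)
    finally show ?case using e2(1) by blast
  qed (use d in auto)
  have right_nat: "\<exists>e'\<in>E. e \<otimes> d [^] n = d [^] n \<otimes> e'" if "e \<in> E" for e and n :: nat
    using that
  proof (induction n arbitrary: e)
    case (Suc n)
    obtain e1 where e1: "e1 \<in> E" "e \<otimes> d [^] n = d [^] n \<otimes> e1" using Suc.IH[OF Suc.prems] by blast
    obtain e2 where e2: "e2 \<in> E" "e1 \<otimes> d = d \<otimes> e2" using right[OF e1(1)] by blast
    have "e \<otimes> d [^] Suc n = e \<otimes> d [^] n \<otimes> d" using Suc.prems d by (simp add: m_assoc)
    also have "\<dots> = d [^] n \<otimes> (e1 \<otimes> d)" using e1 d by (simp add: m_assoc)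
    also have "\<dots> = d [^] Suc n \<otimes> e2" using e2 d by (simp add: m_assoc)
    finally show ?case using e2(1) by blast
  qed (use d in auto)
  have left_int: "\<exists>e'\<in>E. d [^] m \<otimes> e = e' \<otimes> d [^] m" if e: "e \<in> E" for e and m :: int
  proof (cases "m \<ge> 0")
    case True
    then have "d [^] m = d [^] nat m" by (metis int_pow_int nat_0_le)
    then show ?thesis using left_nat[OF e] by (simp only:)
  next
    case False
    \<comment> \<open>Moving \<open>e\<close> across a negative power amounts to moving it across \<open>d\<^sup>n\<close> in the other direction.\<close>
    define n where "n = nat (- m)"
    have "m = - int n" using False by (simp add: n_def)
    then have m: "d [^] m = inv (d [^] n)" by (simp only: int_pow_neg_int[OF d])
    obtain e' where e': "e' \<in> E" "e \<otimes> d [^] n = d [^] n \<otimes> e'" using right_nat[OF e] by blast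
    have "inv (d [^] n) \<otimes> e = inv (d [^] n) \<otimes> (e \<otimes> d [^] n) \<otimes> inv (d [^] n)"
      using e d by (simp add: m_assoc)
    also have "\<dots> = e' \<otimes> inv (d [^] n)"
      unfolding e'(2) using e' d by (simp add: m_assoc[symmetric])
    finally show ?thesis using e'(1) m by auto
  qed
  have K_carrier: "K \<subseteq> carrier G" using d by (auto simp: K_def)
  have inv_form: "\<exists>e'\<in>E. inv (e \<otimes> d [^] m) = e' \<otimes> d [^] (- m)" if e: "e \<in> E" for e and m :: int
  proof -
    have "inv (e \<otimes> d [^] m) = d [^] (- m) \<otimes> inv e"
      using e d by (simp add: inv_mult_group int_pow_neg)
    then show ?thesis using left_int[OF E.m_inv_closed[OF e], of "- m"] by simp
  qed
  have K: "subgroup K G"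
  proof (rule subgroupI)
    show "K \<noteq> {}" using E.one_closed unfolding K_def by blast
    fix x assume "x \<in> K"
    then obtain e m where e: "e \<in> E" "x = e \<otimes> d [^] (m :: int)" by (auto simp: K_def)
    show "inv x \<in> K" using inv_form[OF e(1), of m] unfolding e(2) K_def by blast
    fix y assume "y \<in> K"
    then obtain e' m' where e': "e' \<in> E" "y = e' \<otimes> d [^] (m' :: int)" by (auto simp: K_def)
    obtain e2 where e2: "e2 \<in> E" "d [^] m \<otimes> e' = e2 \<otimes> d [^] m" using left_int[OF e'(1)] by blast
    have "x \<otimes> y = e \<otimes> (d [^] m \<otimes> e') \<otimes> d [^] m'"
      using e e' d by (simp add: m_assoc)
    also have "\<dots> = e \<otimes> e2 \<otimes> d [^] (m + m')"
      unfolding e2(2) using e e2 d by (simp add: m_assoc int_pow_mult)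
    finally show "x \<otimes> y \<in> K" using e e2 unfolding K_def by blast
  qed (rule K_carrier)
  have HK: "H \<subseteq> K"
  proof
    fix x assume "x \<in> H"
    then obtain e n where "e \<in> E" "x = e \<otimes> d [^] (n :: nat)" by (auto simp: H_def)
    then have "x = e \<otimes> d [^] int n" by (simp add: int_pow_int)
    then show "x \<in> K" using \<open>e \<in> E\<close> unfolding K_def by blast
  qed
  show ?thesis
  proof
    show "generate G H \<subseteq> H \<union> {u \<in> carrier G. inv u \<in> H}"
    proof
      fix u assume "u \<in> generate G H"
      then have "u \<in> K" using generate_subgroup_incl[OF HK K] by blast
      then obtain e m where e: "e \<in> E" "u = e \<otimes> d [^] (m :: int)" by (auto simp: K_def)
      show "u \<in> H \<union> {u \<in> carrier G. inv u \<in> H}"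
      proof (cases "m \<ge> 0")
        case True
        then have "d [^] m = d [^] nat m" by (metis int_pow_int nat_0_le)
        then have "u = e \<otimes> d [^] nat m" using e(2) by (simp only:)
        then show ?thesis using e(1) unfolding H_def by blast
      next
        case False
        obtain e' where e': "e' \<in> E" "inv u = e' \<otimes> d [^] (- m)" using inv_form[OF e(1), of m] e(2) by blast
        have "d [^] (- m) = d [^] nat (- m)" using False by (metis int_pow_int nat_0_le neg_0_le_iff_le linear)
        then have "inv u = e' \<otimes> d [^] nat (- m)" using e'(2) by (simp only:)
        then have "inv u \<in> H" using e'(1) unfolding H_def by blast
        then show ?thesis using e d by auto
      qed
    qed
  next
    show "H \<union> {u \<in> carrier G. inv u \<in> H} \<subseteq> generate G H"
    proof
      fix u assume "u \<in> H \<union> {u \<in> carrier G. inv u \<in> H}"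
      then show "u \<in> generate G H"
        by (metis (no_types, lifting) Un_iff generate.incl generate.inv inv_inv mem_Collect_eq)
    qed
  qed
qed

section \<open>The algebra generated by the operators\<close>

context nondegenerate_interval
begin

abbreviation smooth1 :: "(real \<Rightarrow> complex) \<Rightarrow> bool" where
  "smooth1 P \<equiv> smooth_interval False a b P"

abbreviation smooth2 :: "(real \<times> real \<Rightarrow> complex) \<Rightarrow> bool" where
  "smooth2 f \<equiv> smooth_triangle a b f"

lemma smooth_intros:
  "smooth1 (\<lambda>_. c)"
  "smooth1 P \<Longrightarrow> smooth1 Q \<Longrightarrow> smooth1 (\<lambda>x. P x + Q x)"
  "smooth1 P \<Longrightarrow> smooth1 Q \<Longrightarrow> smooth1 (\<lambda>x. P x * Q x)"
  "smooth2 (\<lambda>_. c)"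
  "smooth2 f \<Longrightarrow> smooth2 (\<lambda>p. - f p)"
  "smooth2 f \<Longrightarrow> smooth2 g \<Longrightarrow> smooth2 (\<lambda>p. f p + g p)"
  "smooth2 f \<Longrightarrow> smooth2 g \<Longrightarrow> smooth2 (\<lambda>p. f p * g p)"
  "smooth2 f \<Longrightarrow> smooth2 g \<Longrightarrow> smooth2 (star f g)"
  "smooth1 P \<Longrightarrow> smooth2 (\<lambda>p. P (fst p))"
  "smooth1 P \<Longrightarrow> smooth2 (\<lambda>p. P (snd p))"
  "smooth2 f \<Longrightarrow> smooth1 (\<lambda>x. f (x, x))"
  by (simp add: Ck_interval_const, simp add: Ck_interval_add, simp add: Ck_interval_mult,
    simp add: Ck_triangle_const, simp add: Ck_triangle_uminus, simp add: Ck_triangle_add,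
    simp add: Ck_triangle_mult, simp add: Ck_triangle_star, simp add: Ck_triangle_fst,
    simp add: Ck_triangle_snd, simp add: Ck_interval_diagonal)

lemma smooth_restrict:
  "smooth1 P \<Longrightarrow> restrict P {a..b} \<in> B1 a b"
  "smooth2 f \<Longrightarrow> restrict f (triangle a b) \<in> B2 a b"
proof -
  have "Ck_interval False a b k (restrict P {a..b}) \<longleftrightarrow> Ck_interval False a b k P" for k
    by (rule Ck_interval_cong) (use less in auto)
  then show "smooth1 P \<Longrightarrow> restrict P {a..b} \<in> B1 a b"
    by (simp add: B1_iff_smooth[OF less])
  have "Ck_triangle a b k f \<Longrightarrow> Ck_triangle a b k (restrict f (triangle a b))" for k
    by (rule Ck_triangle_transfer) simp_all
  then show "smooth2 f \<Longrightarrow> restrict f (triangle a b) \<in> B2 a b"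
    by (simp add: B2_iff_smooth[OF less])
qed

lemma B_smooth: "P \<in> B1 a b \<Longrightarrow> smooth1 P" "f \<in> B2 a b \<Longrightarrow> smooth2 f"
  by (simp_all add: B1_iff_smooth[OF less] B2_iff_smooth[OF less])

lemma zero_in_B: "zero1 a b \<in> B1 a b" "zero2 a b \<in> B2 a b"
  using smooth_restrict(1)[OF smooth_intros(1)[of 0]] smooth_restrict(2)[OF smooth_intros(4)[of 0]]
  by (simp_all add: zero1_def zero2_def)

text \<open>Restricting the coefficients to the interval and to the triangle makes them members of \<open>B1\<close> and \<open>B2\<close>.\<close>

lemma vop_in_I_M:
  assumes "smooth1 P" "smooth2 f"
  shows "vop a b P f \<in> I_M_carrier a b"
proof -
  let ?P = "restrict P {a..b}" and ?f = "restrict f (triangle a b)"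
  have "add_op a b (mult_op a b ?P) (int_op a b ?f) = vop a b (\<lambda>x. ?P x + 0) (\<lambda>p. 0 + ?f p)"
    unfolding mult_op_eq_vop int_op_eq_vop
    by (rule vop_add[OF smooth_intros(4) B_smooth(2)[OF smooth_restrict(2)[OF assms(2)]]])
  also have "\<dots> = vop a b P f" by (rule vop_cong) simp_all
  finally show ?thesis
    using smooth_restrict(1)[OF assms(1)] smooth_restrict(2)[OF assms(2)]
      I_M_carrier.add I_M_carrier.mult_op I_M_carrier.int_op by metis
qed

text \<open>The closure rules of the algebra say nothing about values; that these stay in \<open>M a b\<close> is what allows
operators to be composed.\<close>

lemma I_M_maps_M: "T \<in> I_M_carrier a b \<Longrightarrow> \<phi> \<in> M a b \<Longrightarrow> T \<phi> \<in> M a b"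
proof (induction arbitrary: \<phi> rule: I_M_carrier.induct)
  case (mult_op P)
  show ?case
    unfolding mult_op_eq_vop by (rule vop_in_M[OF B_smooth(1)[OF mult_op(1)] smooth_intros(4) mult_op(2)])
next
  case (int_op f)
  show ?case
    unfolding int_op_eq_vop by (rule vop_in_M[OF smooth_intros(1) B_smooth(2)[OF int_op(1)] int_op(2)])
next
  case (add S T)
  show ?case
    unfolding add_op_def restrict_apply'[OF add.prems]
    by (intro restrict_in_M Ck_interval_add M_D(2) add)
next
  case (scale T c)
  show ?case
    unfolding scale_op_def restrict_apply'[OF scale.prems]
    by (intro restrict_in_M Ck_interval_mult Ck_interval_const M_D(2) scale)
qed (simp_all add: diff_op_in_M compose_def)

lemma scale_op_eq_compose:
  assumes "T \<in> I_M_carrier a b"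
  shows "scale_op a b c T = compose (M a b) (vop a b (\<lambda>_. c) (\<lambda>_. 0)) T"
  by (rule operator_eqI)
    (use I_M_maps_M[OF assms] in \<open>auto simp: scale_op_def compose_def vop_apply volterra_def vop_extensional\<close>)

definition derivative_power :: "nat \<Rightarrow> operator" where
  "derivative_power n = (\<lambda>\<phi>\<in>M a b. (diff_op a b ^^ n) \<phi>)"

lemma derivative_power_in_M: "\<phi> \<in> M a b \<Longrightarrow> (diff_op a b ^^ n) \<phi> \<in> M a b"
  by (induction n) (simp_all add: diff_op_in_M)

lemma derivative_power_Suc:
  "derivative_power (Suc n) = compose (M a b) (diff_op a b) (derivative_power n)"
  by (auto simp: derivative_power_def compose_def)

lemma normal_op_0: "normal_op a b 0 P f = vop a b (P 0) f"
  by (rule operator_eqI)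
    (simp_all add: normal_op_def vop_extensional vop_apply mult_op_def int_op_def volterra_def)

text \<open>Peeling off the top term is the recursion by which the normal form is studied.\<close>

lemma normal_op_Suc:
  "normal_op a b (Suc n) P f =
    add_op a b (normal_op a b n P f) (compose (M a b) (vop a b (P (Suc n)) (\<lambda>_. 0)) (derivative_power (Suc n)))"
  by (rule operator_eqI)
    (simp_all add: normal_op_def add_op_def compose_def derivative_power_def derivative_power_in_M
      diff_op_in_M vop_apply vop_extensional volterra_def del: funpow.simps)

end

section \<open>Relations in the ring\<close>

locale integro_differential_ring = nondegenerate_interval a b + ring I
  for a b and I (structure) +
  fixes j
  assumes iso: "j \<in> ring_iso (I_M a b) I"
begin

text \<open>
The images in \<open>I\<close> of the operators \<open>P + f \<theta>\<close>, of the derivative and of the antiderivative. From here on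
the computations take place in \<open>I\<close>, whose ring laws are available.\<close>

definition vol where "vol P f = j (vop a b P f)"
definition \<delta> where "\<delta> = j (diff_op a b)"
definition \<tau> where "\<tau> = vol (\<lambda>_. 0) (\<lambda>_. 1)"

lemma j_hom:
  "S \<in> I_M_carrier a b \<Longrightarrow> j S \<in> carrier I"
  "S \<in> I_M_carrier a b \<Longrightarrow> T \<in> I_M_carrier a b \<Longrightarrow> j (compose (M a b) S T) = j S \<otimes> j T"
  "S \<in> I_M_carrier a b \<Longrightarrow> T \<in> I_M_carrier a b \<Longrightarrow> j (add_op a b S T) = j S \<oplus> j T"
  "j (\<lambda>\<phi>\<in>M a b. \<phi>) = \<one>"
  using iso by (auto simp: ring_iso_def ring_hom_def I_M_def End_M_def)

lemma j_bij: "bij_betw j (I_M_carrier a b) (carrier I)"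
  using iso by (simp add: ring_iso_def I_M_def)

lemma vol_closed: "smooth1 P \<Longrightarrow> smooth2 f \<Longrightarrow> vol P f \<in> carrier I"
  by (simp add: vol_def j_hom vop_in_I_M)

lemma vol_cong:
  "(\<And>x. x \<in> {a..b} \<Longrightarrow> P x = Q x) \<Longrightarrow> (\<And>p. p \<in> triangle a b \<Longrightarrow> f p = g p) \<Longrightarrow> vol P f = vol Q g"
  unfolding vol_def by (rule arg_cong[OF vop_cong])

lemma vol_add:
  assumes "smooth1 P" "smooth2 f" "smooth1 Q" "smooth2 g"
  shows "vol P f \<oplus> vol Q g = vol (\<lambda>x. P x + Q x) (\<lambda>p. f p + g p)"
  unfolding vol_def using assms by (simp add: vop_in_I_M flip: j_hom(3) vop_add)

lemma vol_mult:
  assumes "smooth1 P" "smooth2 f" "smooth1 Q" "smooth2 g"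
  shows "vol P f \<otimes> vol Q g = vol (\<lambda>x. P x * Q x) (\<lambda>p. P (fst p) * g p + (f p * Q (snd p) + star f g p))"
  unfolding vol_def using assms by (simp add: vop_in_I_M flip: j_hom(2) vop_comp)

lemma vol_one: "vol (\<lambda>_. 1) (\<lambda>_. 0) = \<one>"
  using j_hom(4) by (simp add: vol_def identity_eq_vop)

lemma vol_zero: "vol (\<lambda>_. 0) (\<lambda>_. 0) = \<zero>"
  using vol_add[of "\<lambda>_. 0" "\<lambda>_. 0" "\<lambda>_. 0" "\<lambda>_. 0"] vol_closed[of "\<lambda>_. 0" "\<lambda>_. 0"] smooth_intros(1,4)
  by (simp add: add.l_cancel_one)

lemma vol_eq_imp_multiplier_eq:
  assumes "smooth1 P" "smooth2 f" "smooth1 Q" "smooth2 g" "vol P f = vol Q g" "x \<in> {a..b}"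
  shows "P x = Q x"
proof (rule vop_eq_imp_multiplier_eq)
  show "vop a b P f = vop a b Q g"
    using assms vop_in_I_M j_bij unfolding vol_def bij_betw_def by (meson inj_onD)
qed (use assms Ck_interval_continuous Ck_triangle_continuous in blast)+

lemma diff_op_in_I_M: "diff_op a b \<in> I_M_carrier a b"
  by (rule I_M_carrier.diff_op)

lemma \<delta>_closed: "\<delta> \<in> carrier I" and \<tau>_closed: "\<tau> \<in> carrier I"
  by (auto simp: \<delta>_def \<tau>_def intro!: j_hom(1) diff_op_in_I_M vol_closed smooth_intros)

lemma \<delta>_\<tau>: "\<delta> \<otimes> \<tau> = \<one>" and \<tau>_\<delta>: "\<tau> \<otimes> \<delta> = \<one>"
  using diff_comp_antiderivative antiderivative_comp_diff vol_one
  unfolding \<delta>_def \<tau>_def vol_def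
  by (metis j_hom(2) diff_op_in_I_M vop_in_I_M smooth_intros(1,4))+

lemma \<delta>_unit: "\<delta> \<in> Units I"
  using \<delta>_closed \<tau>_closed \<delta>_\<tau> \<tau>_\<delta> by (auto simp: Units_def)

lemma \<delta>_vol:
  assumes P: "smooth1 P" and f: "smooth2 f" and P': "smooth1 P'"
    "\<And>x. x \<in> {a..b} \<Longrightarrow> (P has_vector_derivative P' x) (at x within {a..b})"
    and f': "has_dx a b f f'" "smooth2 f'"
  shows "\<delta> \<otimes> vol P f = vol P (\<lambda>_. 0) \<otimes> \<delta> \<oplus> vol (\<lambda>x. P' x + f (x, x)) f'"
proof -
  have mem: "vop a b P f \<in> I_M_carrier a b" "vop a b P (\<lambda>_. 0) \<in> I_M_carrier a b"
    "vop a b (\<lambda>x. P' x + f (x, x)) f' \<in> I_M_carrier a b"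
    by (intro vop_in_I_M smooth_intros P f P'(1) f'(2))+
  show ?thesis
    unfolding \<delta>_def vol_def using arg_cong[OF diff_comp_vop[OF P f P'(2) f'], of j]
    by (simp add: j_hom mem diff_op_in_I_M I_M_carrier.comp)
qed

lemma integral_\<delta>:
  assumes f: "smooth2 f" and f': "has_dy a b f f'" "smooth2 f'"
  shows "vol (\<lambda>_. 0) f \<otimes> \<delta> = vol (\<lambda>x. f (x, x)) (\<lambda>p. - f' p)"
  unfolding \<delta>_def vol_def integral_comp_diff[OF assms, symmetric]
  by (intro j_hom(2)[symmetric] vop_in_I_M diff_op_in_I_M smooth_intros f)

lemma vol_split:
  assumes "smooth1 P" "smooth2 f"
  shows "vol P f = vol P (\<lambda>_. 0) \<oplus> vol (\<lambda>_. 0) f"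
  using vol_add[OF assms(1) smooth_intros(4)[of 0] smooth_intros(1)[of 0] assms(2)] by simp

text \<open>Since \<open>P + f \<theta> = (P + f \<theta>) \<tau> \<delta>\<close>, an operator of order zero can be read as one of order one with
vanishing leading coefficient. This is how lower order terms are absorbed.\<close>

lemma vol_eq_integral_\<delta>:
  assumes "smooth1 P" "smooth2 f"
  obtains g where "smooth2 g" "vol P f = vol (\<lambda>_. 0) g \<otimes> \<delta>"
proof -
  let ?g = "\<lambda>p. P (fst p) * 1 + (f p * 0 + star f (\<lambda>_. 1) p)"
  have "vol P f = (vol P f \<otimes> \<tau>) \<otimes> \<delta>"
    using vol_closed[OF assms] by (simp add: m_assoc \<tau>_closed \<delta>_closed \<tau>_\<delta>)
  also have "vol P f \<otimes> \<tau> = vol (\<lambda>_. 0) ?g"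
    unfolding \<tau>_def using vol_mult[OF assms smooth_intros(1)[of 0] smooth_intros(4)[of 1]] by simp
  finally have "vol P f = vol (\<lambda>_. 0) ?g \<otimes> \<delta>" .
  moreover have "smooth2 ?g" by (intro smooth_intros assms)
  ultimately show ?thesis using that by blast
qed

lemma smooth1_derivative:
  assumes "smooth1 P"
  obtains P' where "smooth1 P'" "\<And>x. x \<in> {a..b} \<Longrightarrow> (P has_vector_derivative P' x) (at x within {a..b})"
  using assms Ck_interval_deriv_on[OF less] that[of "deriv_on a b P"] by blast

text \<open>In \<open>\<delta> (P + f \<theta>)\<close> the part of order zero is absorbed into an integral operator followed by \<open>\<delta>\<close>, so the
multiplication part \<open>P\<close> is unchanged.\<close>

lemma \<delta>_vol_commute_left:
  assumes P: "smooth1 P" and f: "smooth2 f"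
  obtains g where "smooth2 g" "\<delta> \<otimes> vol P f = vol P g \<otimes> \<delta>"
proof -
  obtain P' where P': "smooth1 P'" "\<And>x. x \<in> {a..b} \<Longrightarrow> (P has_vector_derivative P' x) (at x within {a..b})"
    using smooth1_derivative[OF P] by blast
  obtain f' where f': "has_dx a b f f'" "smooth2 f'" using smooth_triangle_has_dx[OF less f] by blast
  have s: "smooth1 (\<lambda>x. P' x + f (x, x))" by (intro smooth_intros P' f)
  obtain g where g: "smooth2 g" "vol (\<lambda>x. P' x + f (x, x)) f' = vol (\<lambda>_. 0) g \<otimes> \<delta>"
    by (rule vol_eq_integral_\<delta>[OF s f'(2)])
  have "\<delta> \<otimes> vol P f = vol P (\<lambda>_. 0) \<otimes> \<delta> \<oplus> vol (\<lambda>_. 0) g \<otimes> \<delta>"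
    using \<delta>_vol[OF P f P' f'] g(2) by simp
  also have "\<dots> = vol P g \<otimes> \<delta>"
    unfolding vol_split[OF P g(1)]
    by (intro l_distr[symmetric] vol_closed \<delta>_closed smooth_intros P g(1))
  finally show ?thesis using that g(1) by blast
qed

text \<open>The kernel \<open>g\<close> has to satisfy \<open>g\<^sub>x = - f\<^sub>y\<close> and \<open>P' + g(x,x) = f(x,x)\<close>; integrating the first condition
from the diagonal, with the second as initial value, defines it.\<close>

lemma \<delta>_vol_commute_right:
  assumes P: "smooth1 P" and f: "smooth2 f"
  obtains g where "smooth2 g" "vol P f \<otimes> \<delta> = \<delta> \<otimes> vol P g"
proof -
  obtain P' where P': "smooth1 P'" "\<And>x. x \<in> {a..b} \<Longrightarrow> (P has_vector_derivative P' x) (at x within {a..b})"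
    using smooth1_derivative[OF P] by blast
  obtain f' where f': "has_dy a b f f'" "smooth2 f'" using smooth_triangle_has_dy[OF less f] by blast
  define Q where "Q = (\<lambda>x. f (x, x) + (- 1) * P' x)"
  define g where "g = (\<lambda>p. Q (snd p) + star (\<lambda>_. 1) (\<lambda>p. - f' p) p)"
  have Q: "smooth1 Q" unfolding Q_def by (intro smooth_intros f P')
  have g: "smooth2 g" unfolding g_def by (intro smooth_intros Q f')
  have cont: "continuous_on (triangle a b) (\<lambda>p. - f' p)"
    using smooth_intros(5)[OF f'(2)] Ck_triangle_continuous by blast
  have "has_dx a b (star (\<lambda>_. 1) (\<lambda>p. - f' p)) (\<lambda>p. 1 * - f' p + star (\<lambda>_. 0) (\<lambda>p. - f' p) p)"
    by (rule has_dx_star[where f = "\<lambda>_. 1" and f' = "\<lambda>_. 0"]) (auto simp: has_dx_def cont)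
  then have "has_dx a b g (\<lambda>p. 0 + (1 * - f' p + star (\<lambda>_. 0) (\<lambda>p. - f' p) p))"
    unfolding g_def by (intro has_dx_add) (simp_all add: has_dx_def)
  then have g': "has_dx a b g (\<lambda>p. - f' p)" by simp
  have "g (x, x) = f (x, x) - P' x" for x by (simp add: g_def Q_def star_def)
  then have "\<delta> \<otimes> vol P g = vol P (\<lambda>_. 0) \<otimes> \<delta> \<oplus> vol (\<lambda>x. f (x, x)) (\<lambda>p. - f' p)"
    using \<delta>_vol[OF P g P' g' smooth_intros(5)[OF f'(2)]] by simp
  also have "vol (\<lambda>x. f (x, x)) (\<lambda>p. - f' p) = vol (\<lambda>_. 0) f \<otimes> \<delta>"
    by (rule integral_\<delta>[OF f f', symmetric])
  also have "vol P (\<lambda>_. 0) \<otimes> \<delta> \<oplus> vol (\<lambda>_. 0) f \<otimes> \<delta> = vol P f \<otimes> \<delta>"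
    unfolding vol_split[OF P f]
    by (intro l_distr[symmetric] vol_closed \<delta>_closed smooth_intros P f)
  finally show ?thesis using that g by metis
qed

lemma \<delta>_pow_closed: "\<delta> [^] (n :: nat) \<in> carrier I"
  by (intro nat_pow_closed \<delta>_closed)

lemma \<delta>_pow_vol_commute:
  assumes "smooth1 P" "smooth2 f"
  shows "\<exists>g. smooth2 g \<and> \<delta> [^] (n :: nat) \<otimes> vol P f = vol P g \<otimes> \<delta> [^] n"
  using assms(2)
proof (induction n arbitrary: f)
  case 0
  then show ?case using vol_closed[OF assms(1)] by auto
next
  case (Suc n)
  obtain g where g: "smooth2 g" "\<delta> \<otimes> vol P f = vol P g \<otimes> \<delta>"
    by (rule \<delta>_vol_commute_left[OF assms(1) Suc.prems])
  obtain h where h: "smooth2 h" "\<delta> [^] n \<otimes> vol P g = vol P h \<otimes> \<delta> [^] n"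
    using Suc.IH[OF g(1)] by blast
  note c = vol_closed[OF assms(1) Suc.prems] vol_closed[OF assms(1) g(1)] vol_closed[OF assms(1) h(1)] \<delta>_closed \<delta>_pow_closed
  have "\<delta> [^] Suc n \<otimes> vol P f = \<delta> [^] n \<otimes> (\<delta> \<otimes> vol P f)" using c by (simp add: m_assoc)
  also have "\<dots> = \<delta> [^] n \<otimes> vol P g \<otimes> \<delta>" unfolding g(2) using c by (simp add: m_assoc)
  also have "\<dots> = vol P h \<otimes> \<delta> [^] Suc n" unfolding h(2) using c by (simp add: m_assoc)
  finally show ?case using h(1) by blast
qed

lemma raise_order:
  assumes "smooth1 P" "smooth2 f"
  shows "\<exists>Q g. smooth1 Q \<and> smooth2 g \<and> vol P f \<otimes> \<delta> [^] (n :: nat) = vol Q g \<otimes> \<delta> [^] (n + k)"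
proof (induction k)
  case 0
  then show ?case using assms by auto
next
  case (Suc k)
  then obtain Q g where Q: "smooth1 Q" "smooth2 g" "vol P f \<otimes> \<delta> [^] n = vol Q g \<otimes> \<delta> [^] (n + k)" by blast
  obtain h where h: "smooth2 h" "vol Q g = vol (\<lambda>_. 0) h \<otimes> \<delta>" by (rule vol_eq_integral_\<delta>[OF Q(1,2)])
  have "vol P f \<otimes> \<delta> [^] n = vol (\<lambda>_. 0) h \<otimes> (\<delta> \<otimes> \<delta> [^] (n + k))"
    unfolding Q(3) h(2) by (intro m_assoc vol_closed smooth_intros h \<delta>_closed \<delta>_pow_closed)
  also have "\<delta> \<otimes> \<delta> [^] (n + k) = \<delta> [^] (n + Suc k)"
    by (simp add: nat_pow_Suc2[OF \<delta>_closed, symmetric])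
  finally show ?case using h(1) smooth_intros(1)[of 0] by blast
qed

text \<open>Closure of the set of products \<open>(P + f \<theta>) \<delta>\<^sup>n\<close> under the operations that generate the algebra: sums are
brought to a common power by \<open>raise_order\<close>, and in products powers of \<open>\<delta>\<close> are moved to the right.\<close>

lemma carrier_form:
  assumes "x \<in> carrier I"
  obtains P f and n :: nat where "smooth1 P" "smooth2 f" "x = vol P f \<otimes> \<delta> [^] n"
proof -
  have "\<exists>P f n. smooth1 P \<and> smooth2 f \<and> j T = vol P f \<otimes> \<delta> [^] (n :: nat)" if "T \<in> I_M_carrier a b" for T
    using that
  proof induction
    case (mult_op P)
    then have "j (Defs.mult_op a b P) = vol P (\<lambda>_. 0) \<otimes> \<delta> [^] (0 :: nat)"
      using vol_closed[OF B_smooth(1) smooth_intros(4)[of 0]] by (simp add: mult_op_eq_vop vol_def)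
    then show ?case using B_smooth(1)[OF mult_op] smooth_intros(4)[of 0] by blast
  next
    case diff_op
    have "j (Defs.diff_op a b) = vol (\<lambda>_. 1) (\<lambda>_. 0) \<otimes> \<delta> [^] (1 :: nat)"
      using \<delta>_closed by (simp add: vol_one) (simp add: \<delta>_def)
    then show ?case using smooth_intros(1)[of 1] smooth_intros(4)[of 0] by blast
  next
    case (int_op f)
    then have "j (Defs.int_op a b f) = vol (\<lambda>_. 0) f \<otimes> \<delta> [^] (0 :: nat)"
      using vol_closed[OF smooth_intros(1)[of 0] B_smooth(2)] by (simp add: int_op_eq_vop vol_def)
    then show ?case using B_smooth(2)[OF int_op] smooth_intros(1)[of 0] by blast
  next
    case (add S T)
    then obtain P f m Q g n where *: "smooth1 P" "smooth2 f" "j S = vol P f \<otimes> \<delta> [^] (m :: nat)"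
      "smooth1 Q" "smooth2 g" "j T = vol Q g \<otimes> \<delta> [^] (n :: nat)" by blast
    obtain P1 f1 where 1: "smooth1 P1" "smooth2 f1" "j S = vol P1 f1 \<otimes> \<delta> [^] (m + n)"
      using raise_order[OF *(1,2), of m n] *(3) by metis
    obtain Q1 g1 where 2: "smooth1 Q1" "smooth2 g1" "j T = vol Q1 g1 \<otimes> \<delta> [^] (m + n)"
      using raise_order[OF *(4,5), of n m] *(6) by (metis Groups.add.commute)
    have "j (add_op a b S T) = (vol P1 f1 \<oplus> vol Q1 g1) \<otimes> \<delta> [^] (m + n)"
      using add.hyps 1 2 by (simp add: j_hom(3) l_distr vol_closed \<delta>_pow_closed)
    also have "vol P1 f1 \<oplus> vol Q1 g1 = vol (\<lambda>x. P1 x + Q1 x) (\<lambda>p. f1 p + g1 p)"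
      by (rule vol_add[OF 1(1,2) 2(1,2)])
    finally show ?case using smooth_intros(2)[OF 1(1) 2(1)] smooth_intros(6)[OF 1(2) 2(2)] by blast
  next
    case (scale T c)
    then obtain P f n where *: "smooth1 P" "smooth2 f" "j T = vol P f \<otimes> \<delta> [^] (n :: nat)" by blast
    have s: "smooth1 (\<lambda>_. c)" "smooth2 (\<lambda>_. 0)" by (intro smooth_intros)+
    have "j (scale_op a b c T) = vol (\<lambda>_. c) (\<lambda>_. 0) \<otimes> vol P f \<otimes> \<delta> [^] n"
      using scale.hyps * s
      by (simp add: scale_op_eq_compose j_hom(2) vop_in_I_M m_assoc vol_closed \<delta>_pow_closed flip: vol_def)
    also have "vol (\<lambda>_. c) (\<lambda>_. 0) \<otimes> vol P f = vol (\<lambda>x. c * P x) (\<lambda>p. c * f p + (0 * P (snd p) + star (\<lambda>_. 0) f p))"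
      by (rule vol_mult[OF s *(1,2)])
    finally have "j (scale_op a b c T) = vol (\<lambda>x. c * P x) (\<lambda>p. c * f p + (0 * P (snd p) + star (\<lambda>_. 0) f p)) \<otimes> \<delta> [^] n" .
    moreover have "smooth1 (\<lambda>x. c * P x)" "smooth2 (\<lambda>p. c * f p + (0 * P (snd p) + star (\<lambda>_. 0) f p))"
      by (intro smooth_intros * s)+
    ultimately show ?case
      by (intro exI[of _ "\<lambda>x. c * P x"] exI[of _ n]
        exI[of _ "\<lambda>p. c * f p + (0 * P (snd p) + star (\<lambda>_. 0) f p)"] conjI)
  next
    case (comp S T)
    then obtain P f m Q g n where *: "smooth1 P" "smooth2 f" "j S = vol P f \<otimes> \<delta> [^] (m :: nat)"
      "smooth1 Q" "smooth2 g" "j T = vol Q g \<otimes> \<delta> [^] (n :: nat)" by blast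
    obtain h where h: "smooth2 h" "\<delta> [^] m \<otimes> vol Q g = vol Q h \<otimes> \<delta> [^] m"
      using \<delta>_pow_vol_commute[OF *(4,5)] by blast
    note c = vol_closed[OF *(1,2)] vol_closed[OF *(4,5)] vol_closed[OF *(4) h(1)] \<delta>_pow_closed
    have "j (compose (M a b) S T) = vol P f \<otimes> (\<delta> [^] m \<otimes> vol Q g) \<otimes> \<delta> [^] n"
      using comp.hyps c by (simp add: j_hom(2) * m_assoc)
    also have "\<dots> = vol P f \<otimes> vol Q h \<otimes> \<delta> [^] (m + n)"
      unfolding h(2) using c by (simp add: m_assoc nat_pow_mult[OF \<delta>_closed])
    also have "vol P f \<otimes> vol Q h = vol (\<lambda>x. P x * Q x) (\<lambda>p. P (fst p) * h p + (f p * Q (snd p) + star f h p))"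
      by (rule vol_mult[OF *(1,2,4) h(1)])
    finally have "j (compose (M a b) S T) =
      vol (\<lambda>x. P x * Q x) (\<lambda>p. P (fst p) * h p + (f p * Q (snd p) + star f h p)) \<otimes> \<delta> [^] (m + n)" .
    moreover have "smooth1 (\<lambda>x. P x * Q x)" "smooth2 (\<lambda>p. P (fst p) * h p + (f p * Q (snd p) + star f h p))"
      by (intro smooth_intros * h)+
    ultimately show ?case
      by (intro exI[of _ "\<lambda>x. P x * Q x"] exI[of _ "m + n"]
        exI[of _ "\<lambda>p. P (fst p) * h p + (f p * Q (snd p) + star f h p)"] conjI)
  qed
  moreover obtain T where "T \<in> I_M_carrier a b" "x = j T"
    using assms j_bij by (auto simp: bij_betw_def)
  ultimately obtain P f n where "smooth1 P" "smooth2 f" "x = vol P f \<otimes> \<delta> [^] (n :: nat)" by metis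
  then show ?thesis by (rule that)
qed

definition Order0 where "Order0 = {vol P f | P f. smooth1 P \<and> smooth2 f \<and> (\<forall>x\<in>{a..b}. P x \<noteq> 0)}"

lemma Order0_I: "smooth1 P \<Longrightarrow> smooth2 f \<Longrightarrow> (\<And>x. x \<in> {a..b} \<Longrightarrow> P x \<noteq> 0) \<Longrightarrow> vol P f \<in> Order0"
  unfolding Order0_def by blast

text \<open>\<open>P + f \<theta> = P (1 + (f / P) \<theta>)\<close>, and the second factor is inverted by the quasi-inverse \<open>G\<close> of its kernel.
The inverse is \<open>(1 + G \<theta>) (1 / P)\<close>.\<close>

lemma Order0_inverse:
  assumes "e \<in> Order0"
  obtains e' where "e' \<in> Order0" "e \<otimes> e' = \<one>" "e' \<otimes> e = \<one>"
proof -
  obtain P f where e: "e = vol P f" and P: "smooth1 P" and f: "smooth2 f" and nz: "\<And>x. x \<in> {a..b} \<Longrightarrow> P x \<noteq> 0"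
    using assms by (auto simp: Order0_def)
  define Q where "Q = (\<lambda>x. inverse (P x))"
  have Q: "smooth1 Q" unfolding Q_def using Ck_interval_inverse nz P by blast
  have F: "smooth2 (\<lambda>p. Q (fst p) * f p)" by (intro smooth_intros Q f)
  obtain G where G: "smooth2 G"
    and r: "\<And>p. p \<in> triangle a b \<Longrightarrow> Q (fst p) * f p + G p + star (\<lambda>p. Q (fst p) * f p) G p = 0"
    and l: "\<And>p. p \<in> triangle a b \<Longrightarrow> Q (fst p) * f p + G p + star G (\<lambda>p. Q (fst p) * f p) p = 0"
    using smooth_quasi_inverse[OF F] by blast
  define g where "g = (\<lambda>p. G p * Q (snd p))"
  have g: "smooth2 g" unfolding g_def by (intro smooth_intros G Q)
  have PQ: "P x * Q x = 1" if "x \<in> {a..b}" for x using nz[OF that] by (simp add: Q_def)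
  have "vol P f \<otimes> vol Q g = vol (\<lambda>_. 1) (\<lambda>_. 0)"
    unfolding vol_mult[OF P f Q g]
  proof (rule vol_cong)
    fix p assume p: "p \<in> triangle a b"
    then have x: "fst p \<in> {a..b}" by (auto simp: triangle_def)
    have "star f g p = P (fst p) * Q (snd p) * star (\<lambda>p. Q (fst p) * f p) G p"
      unfolding star_def Henstock_Kurzweil_Integration.integral_mult_right[symmetric]
      using PQ[OF x] by (intro Henstock_Kurzweil_Integration.integral_cong) (simp add: g_def)
    moreover have "P (fst p) * Q (snd p) * (Q (fst p) * f p + G p + star (\<lambda>p. Q (fst p) * f p) G p) =
        P (fst p) * Q (fst p) * (f p * Q (snd p)) + P (fst p) * (G p * Q (snd p)) +
        P (fst p) * Q (snd p) * star (\<lambda>p. Q (fst p) * f p) G p"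
      by (simp add: algebra_simps)
    ultimately have "P (fst p) * g p + (f p * Q (snd p) + star f g p) =
        P (fst p) * Q (snd p) * (Q (fst p) * f p + G p + star (\<lambda>p. Q (fst p) * f p) G p)"
      unfolding PQ[OF x] by (simp add: g_def)
    then show "P (fst p) * g p + (f p * Q (snd p) + star f g p) = 0" using r[OF p] by simp
  qed (rule PQ)
  moreover have "vol Q g \<otimes> vol P f = vol (\<lambda>_. 1) (\<lambda>_. 0)"
    unfolding vol_mult[OF Q g P f]
  proof (rule vol_cong)
    fix p assume p: "p \<in> triangle a b"
    then have y: "snd p \<in> {a..b}" by (auto simp: triangle_def)
    have "star g f p = star G (\<lambda>p. Q (fst p) * f p) p"
      unfolding star_def by (simp add: g_def mult.assoc)
    moreover have "g p * P (snd p) = G p" using PQ[OF y] by (simp add: g_def mult.assoc mult.commute)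
    ultimately show "Q (fst p) * f p + (g p * P (snd p) + star g f p) = 0" using l[OF p] by (simp add: add.assoc)
  qed (use PQ in \<open>simp add: mult.commute\<close>)
  moreover have "vol Q g \<in> Order0" by (rule Order0_I[OF Q g]) (simp add: Q_def nz)
  ultimately show ?thesis using that e vol_one by metis
qed

lemma Order0_closed: "e \<in> Order0 \<Longrightarrow> e \<in> carrier I"
  by (auto simp: Order0_def vol_closed)

lemma Order0_Units: "Order0 \<subseteq> Units I"
proof
  fix e assume e: "e \<in> Order0"
  then obtain e' where "e' \<in> Order0" "e \<otimes> e' = \<one>" "e' \<otimes> e = \<one>" by (rule Order0_inverse)
  then show "e \<in> Units I" using e Order0_closed by (auto simp: Units_def)
qed

lemma Order0_subgroup: "subgroup Order0 (units_of I)"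
proof (rule group.subgroupI[OF units_group])
  show "Order0 \<subseteq> carrier (units_of I)" using Order0_Units by (simp add: units_of_carrier)
  have "vol (\<lambda>_. 1) (\<lambda>_. 0) \<in> Order0"
    by (rule Order0_I[OF smooth_intros(1) smooth_intros(4)]) simp
  then show "Order0 \<noteq> {}" by blast
  fix e assume e: "e \<in> Order0"
  then obtain e' where e': "e' \<in> Order0" "e \<otimes> e' = \<one>" "e' \<otimes> e = \<one>" by (rule Order0_inverse)
  have "inv e = e'"
    by (rule sym, rule inv_unique'[OF Order0_closed[OF e] Order0_closed[OF e'(1)] e'(2,3)])
  then show "inv\<^bsub>units_of I\<^esub> e \<in> Order0"
    unfolding units_of_inv[OF subsetD[OF Order0_Units e]] using e'(1) by simp
  fix e2 assume "e2 \<in> Order0"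
  with e obtain P f Q g where *: "e = vol P f" "smooth1 P" "smooth2 f" "\<forall>x\<in>{a..b}. P x \<noteq> 0"
    "e2 = vol Q g" "smooth1 Q" "smooth2 g" "\<forall>x\<in>{a..b}. Q x \<noteq> 0" by (auto simp: Order0_def)
  have "e \<otimes> e2 = vol (\<lambda>x. P x * Q x) (\<lambda>p. P (fst p) * g p + (f p * Q (snd p) + star f g p))"
    unfolding * by (rule vol_mult) (use * in auto)
  moreover have "vol (\<lambda>x. P x * Q x) (\<lambda>p. P (fst p) * g p + (f p * Q (snd p) + star f g p)) \<in> Order0"
  proof (rule Order0_I)
    show "smooth1 (\<lambda>x. P x * Q x)" "smooth2 (\<lambda>p. P (fst p) * g p + (f p * Q (snd p) + star f g p))"
      by (intro smooth_intros *)+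
  qed (use * in auto)
  ultimately show "e \<otimes>\<^bsub>units_of I\<^esub> e2 \<in> Order0" by (simp only: units_of_mult)
qed

end

section \<open>Degree and leading coefficient\<close>

context integro_differential_ring
begin

lemma j_derivative_power:
  "derivative_power n \<in> I_M_carrier a b \<and> j (derivative_power n) = \<delta> [^] n"
proof (induction n)
  case 0
  have id: "derivative_power 0 = (\<lambda>\<phi>\<in>M a b. \<phi>)" by (simp add: derivative_power_def)
  have "derivative_power 0 \<in> I_M_carrier a b"
    unfolding id identity_eq_vop by (rule vop_in_I_M[OF smooth_intros(1,4)])
  then show ?case unfolding id by (intro conjI, assumption) (simp only: j_hom(4) nat_pow_0)
next
  case (Suc n)
  then show ?case
    unfolding derivative_power_Suc nat_pow_Suc2[OF \<delta>_closed]
    by (simp add: I_M_carrier.comp diff_op_in_I_M j_hom(2) \<delta>_def)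
qed

lemma normal_op_in_I_M:
  assumes "\<And>i. i \<le> n \<Longrightarrow> smooth1 (P i)" "smooth2 f"
  shows "normal_op a b n P f \<in> I_M_carrier a b"
  using assms(1)
proof (induction n)
  case 0
  show ?case unfolding normal_op_0 by (rule vop_in_I_M[OF 0[OF order_refl] assms(2)])
next
  case (Suc n)
  show ?case
    unfolding normal_op_Suc
    by (intro I_M_carrier.add I_M_carrier.comp Suc.IH Suc.prems vop_in_I_M smooth_intros(4)
        j_derivative_power[THEN conjunct1]) simp_all
qed

lemma elt_0: "elt a b j 0 P f = vol (P 0) f"
  by (simp add: elt_def normal_op_0 vol_def)

lemma elt_Suc:
  assumes "\<And>i. i \<le> Suc n \<Longrightarrow> smooth1 (P i)" "smooth2 f"
  shows "elt a b j (Suc n) P f = elt a b j n P f \<oplus> vol (P (Suc n)) (\<lambda>_. 0) \<otimes> \<delta> [^] Suc n"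
proof -
  have "vop a b (P (Suc n)) (\<lambda>_. 0) \<in> I_M_carrier a b"
    by (rule vop_in_I_M[OF assms(1)[OF order_refl] smooth_intros(4)])
  moreover have "normal_op a b n P f \<in> I_M_carrier a b"
    by (rule normal_op_in_I_M) (simp_all add: assms)
  ultimately show ?thesis
    using j_derivative_power[of "Suc n"]
    by (simp add: elt_def normal_op_Suc j_hom(2,3) I_M_carrier.comp vol_def del: nat_pow_Suc)
qed

lemma elt_closed:
  "(\<And>i. i \<le> n \<Longrightarrow> smooth1 (P i)) \<Longrightarrow> smooth2 f \<Longrightarrow> elt a b j n P f \<in> carrier I"
  unfolding elt_def by (intro j_hom(1) normal_op_in_I_M)

lemma elt_cong: "(\<And>i. i \<le> n \<Longrightarrow> P i = Q i) \<Longrightarrow> elt a b j n P f = elt a b j n Q f"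
  by (simp add: elt_def normal_op_def)

text \<open>The terms of order at most \<open>n\<close> are an operator of order zero times \<open>\<delta>\<^sup>n\<close>; rewriting that factor as an
integral operator followed by \<open>\<delta>\<close> lifts them to \<open>\<delta>\<^bsup>n+1\<^esup>\<close> without affecting the leading coefficient.\<close>

lemma elt_eq_leading_form:
  assumes "\<And>i. i \<le> n \<Longrightarrow> smooth1 (P i)" "smooth2 f"
  obtains g where "smooth2 g" "elt a b j n P f = vol (P n) g \<otimes> \<delta> [^] n"
proof -
  have "\<exists>g. smooth2 g \<and> elt a b j n P f = vol (P n) g \<otimes> \<delta> [^] n"
    using assms(1)
  proof (induction n)
    case 0
    then have "elt a b j 0 P f = vol (P 0) f \<otimes> \<delta> [^] (0 :: nat)"
      using vol_closed[OF 0[OF order_refl] assms(2)] by (simp add: elt_0)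
    then show ?case using assms(2) by (intro exI[of _ f] conjI)
  next
    case (Suc n)
    obtain g where g: "smooth2 g" "elt a b j n P f = vol (P n) g \<otimes> \<delta> [^] n"
      using Suc.IH[OF Suc.prems] by (metis le_SucI)
    have Pn: "smooth1 (P n)" "smooth1 (P (Suc n))" by (simp_all add: Suc.prems)
    obtain h where h: "smooth2 h" "vol (P n) g = vol (\<lambda>_. 0) h \<otimes> \<delta>" by (rule vol_eq_integral_\<delta>[OF Pn(1) g(1)])
    have c: "vol (\<lambda>_. 0) h \<in> carrier I" "vol (P (Suc n)) (\<lambda>_. 0) \<in> carrier I"
      by (intro vol_closed smooth_intros Pn h)+
    have low: "elt a b j n P f = vol (\<lambda>_. 0) h \<otimes> \<delta> [^] Suc n"
      unfolding g(2) h(2) nat_pow_Suc2[OF \<delta>_closed] by (intro m_assoc c \<delta>_closed \<delta>_pow_closed)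
    have "elt a b j (Suc n) P f = elt a b j n P f \<oplus> vol (P (Suc n)) (\<lambda>_. 0) \<otimes> \<delta> [^] Suc n"
      by (rule elt_Suc[OF Suc.prems assms(2)])
    also have "\<dots> = (vol (\<lambda>_. 0) h \<oplus> vol (P (Suc n)) (\<lambda>_. 0)) \<otimes> \<delta> [^] Suc n"
      unfolding low by (rule l_distr[OF c \<delta>_pow_closed, symmetric])
    also have "vol (\<lambda>_. 0) h \<oplus> vol (P (Suc n)) (\<lambda>_. 0) = vol (P (Suc n)) h"
      unfolding vol_split[OF Pn(2) h(1)] by (rule a_comm[OF c])
    finally show ?case using h(1) by (intro exI[of _ h] conjI)
  qed
  then show ?thesis using that by (elim exE conjE)
qed

text \<open>Conversely, \<open>(g \<theta>) \<delta>\<^bsup>n+1\<^esup> = (g(x,x) - g\<^sub>y \<theta>) \<delta>\<^sup>n\<close> expands an integral operator followed by a power of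
the derivative into terms of lower order.\<close>

lemma leading_form_eq_elt:
  assumes "smooth1 P" "smooth2 g"
  shows "\<exists>Q f. (\<forall>i. Q i \<in> B1 a b) \<and> (\<forall>i>n. Q i = zero1 a b) \<and> f \<in> B2 a b \<and>
    Q n = restrict P {a..b} \<and> vol P g \<otimes> \<delta> [^] n = elt a b j n Q f"
  using assms
proof (induction n arbitrary: P g)
  case 0
  let ?Q = "\<lambda>i. if i = 0 then restrict P {a..b} else zero1 a b" and ?f = "restrict g (triangle a b)"
  have "vol P g \<otimes> \<delta> [^] (0 :: nat) = elt a b j 0 ?Q ?f"
    using vol_closed[OF 0] by (simp add: elt_0) (rule vol_cong, simp_all)
  moreover have "?Q i \<in> B1 a b" for i using smooth_restrict(1)[OF 0(1)] zero_in_B by simp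
  ultimately show ?case
    using smooth_restrict(2)[OF 0(2)]
    by (intro exI[of _ ?Q] exI[of _ ?f] conjI allI impI) (assumption | simp only: if_True if_False refl | simp)+
next
  case (Suc n)
  obtain g' where g': "has_dy a b g g'" "smooth2 g'" by (rule smooth_triangle_has_dy[OF less Suc.prems(2)])
  have s: "smooth1 (\<lambda>x. g (x, x))" "smooth2 (\<lambda>p. - g' p)" by (intro smooth_intros Suc.prems g')+
  obtain Q f where Q: "\<forall>i. Q i \<in> B1 a b" and f: "f \<in> B2 a b"
    and zero: "\<forall>i>n. Q i = zero1 a b"
    and eq: "vol (\<lambda>x. g (x, x)) (\<lambda>p. - g' p) \<otimes> \<delta> [^] n = elt a b j n Q f"
    using Suc.IH[OF s] by metis
  let ?Q = "Q(Suc n := restrict P {a..b})"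
  have Q': "\<forall>i. ?Q i \<in> B1 a b" using Q smooth_restrict(1)[OF Suc.prems(1)] by simp
  have c: "vol P (\<lambda>_. 0) \<in> carrier I" "vol (\<lambda>_. 0) g \<in> carrier I"
    by (intro vol_closed smooth_intros Suc.prems)+
  have "vol (\<lambda>_. 0) g \<otimes> \<delta> [^] Suc n = (vol (\<lambda>_. 0) g \<otimes> \<delta>) \<otimes> \<delta> [^] n"
    unfolding nat_pow_Suc2[OF \<delta>_closed] by (intro m_assoc[symmetric] c \<delta>_closed \<delta>_pow_closed)
  also have "\<dots> = elt a b j n ?Q f"
    unfolding integral_\<delta>[OF Suc.prems(2) g'] eq by (rule elt_cong) simp
  finally have low: "vol (\<lambda>_. 0) g \<otimes> \<delta> [^] Suc n = elt a b j n ?Q f" .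
  have "vol P g \<otimes> \<delta> [^] Suc n = vol P (\<lambda>_. 0) \<otimes> \<delta> [^] Suc n \<oplus> vol (\<lambda>_. 0) g \<otimes> \<delta> [^] Suc n"
    unfolding vol_split[OF Suc.prems] by (rule l_distr[OF c \<delta>_pow_closed])
  also have "\<dots> = elt a b j n ?Q f \<oplus> vol P (\<lambda>_. 0) \<otimes> \<delta> [^] Suc n"
    unfolding low[symmetric] by (intro a_comm m_closed c \<delta>_pow_closed)
  also have "vol P (\<lambda>_. 0) = vol (?Q (Suc n)) (\<lambda>_. 0)" by (rule vol_cong) simp_all
  also have "elt a b j n ?Q f \<oplus> vol (?Q (Suc n)) (\<lambda>_. 0) \<otimes> \<delta> [^] Suc n = elt a b j (Suc n) ?Q f"
    by (rule elt_Suc[symmetric]) (rule B_smooth(1)[OF spec[OF Q']], rule B_smooth(2)[OF f])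
  finally have "vol P g \<otimes> \<delta> [^] Suc n = elt a b j (Suc n) ?Q f" .
  moreover have "\<forall>i>Suc n. ?Q i = zero1 a b" using zero by simp
  moreover have "?Q (Suc n) = restrict P {a..b}" by simp
  ultimately show ?case using Q' f by (intro exI[of _ ?Q] exI[of _ f] conjI)
qed

lemma \<delta>_pow_cancel:
  assumes "x \<in> carrier I" "y \<in> carrier I" "x \<otimes> \<delta> [^] (n :: nat) = y \<otimes> \<delta> [^] n"
  shows "x = y"
proof -
  have u: "\<delta> [^] n \<in> Units I" by (induction n) (simp_all add: \<delta>_unit)
  have "z = z \<otimes> \<delta> [^] n \<otimes> inv (\<delta> [^] n)" if "z \<in> carrier I" for z
    using that u by (simp add: m_assoc Units_closed)
  then show ?thesis using assms by metis
qed

text \<open>The leading coefficients agree because \<open>\<delta>\<^sup>n\<close> can be cancelled and an operator of order zero determines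
its multiplication part; subtracting the leading terms lowers the order.\<close>

lemma elt_eq_imp_coefficients_eq:
  assumes P: "\<And>i. i \<le> n \<Longrightarrow> smooth1 (P i)" and f: "smooth2 f"
    and Q: "\<And>i. i \<le> n \<Longrightarrow> smooth1 (Q i)" and g: "smooth2 g"
    and eq: "elt a b j n P f = elt a b j n Q g" and i: "i \<le> n" and x: "x \<in> {a..b}"
  shows "P i x = Q i x"
  using P Q eq i
proof (induction n)
  case 0
  then show ?case
    using vol_eq_imp_multiplier_eq[OF 0(1)[OF order_refl] f 0(2)[OF order_refl] g _ x] by (simp add: elt_0)
next
  case (Suc n)
  obtain f1 where f1: "smooth2 f1" "elt a b j (Suc n) P f = vol (P (Suc n)) f1 \<otimes> \<delta> [^] Suc n"
    by (rule elt_eq_leading_form[OF Suc.prems(1) f])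
  obtain g1 where g1: "smooth2 g1" "elt a b j (Suc n) Q g = vol (Q (Suc n)) g1 \<otimes> \<delta> [^] Suc n"
    by (rule elt_eq_leading_form[OF Suc.prems(2) g])
  have top: "smooth1 (P (Suc n))" "smooth1 (Q (Suc n))" by (simp_all add: Suc.prems)
  have "vol (P (Suc n)) f1 = vol (Q (Suc n)) g1"
    by (rule \<delta>_pow_cancel[of _ _ "Suc n"], rule vol_closed[OF top(1) f1(1)], rule vol_closed[OF top(2) g1(1)])
      (use Suc.prems(3) f1(2) g1(2) in simp)
  then have lead: "P (Suc n) y = Q (Suc n) y" if "y \<in> {a..b}" for y
    using vol_eq_imp_multiplier_eq[OF top(1) f1(1) top(2) g1(1) _ that] by blast
  then have t: "vol (P (Suc n)) (\<lambda>_. 0) = vol (Q (Suc n)) (\<lambda>_. 0)" by (rule vol_cong) simp_all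
  have "elt a b j n P f \<oplus> vol (P (Suc n)) (\<lambda>_. 0) \<otimes> \<delta> [^] Suc n =
      elt a b j n Q g \<oplus> vol (P (Suc n)) (\<lambda>_. 0) \<otimes> \<delta> [^] Suc n"
    using elt_Suc[OF Suc.prems(1) f] elt_Suc[OF Suc.prems(2) g] Suc.prems(3) t by simp
  moreover have "elt a b j n P f \<in> carrier I" "elt a b j n Q g \<in> carrier I"
    by (rule elt_closed, simp add: Suc.prems, rule f) (rule elt_closed, simp add: Suc.prems, rule g)
  moreover have "vol (P (Suc n)) (\<lambda>_. 0) \<otimes> \<delta> [^] Suc n \<in> carrier I"
    by (rule m_closed[OF vol_closed[OF top(1) smooth_intros(4)] \<delta>_pow_closed])
  ultimately have "elt a b j n P f = elt a b j n Q g" by (simp only: add.right_cancel)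
  then have "P i x = Q i x" if "i \<le> n"
    using that by (intro Suc.IH) (simp_all add: Suc.prems)
  then show ?case using lead[OF x] Suc.prems(4) by (cases "i = Suc n") simp_all
qed

lemma elt_pad:
  assumes P: "\<And>i. P i \<in> B1 a b" and zero: "\<And>i. i > n \<Longrightarrow> P i = zero1 a b" and f: "f \<in> B2 a b"
  shows "elt a b j (n + k) P f = elt a b j n P f"
proof (induction k)
  case (Suc k)
  have "vol (P (Suc (n + k))) (\<lambda>_. 0) = vol (\<lambda>_. 0) (\<lambda>_. 0)"
    by (rule vol_cong) (simp_all add: zero zero1_def)
  then have "vol (P (Suc (n + k))) (\<lambda>_. 0) \<otimes> \<delta> [^] Suc (n + k) = \<zero>"
    by (simp only: vol_zero l_null[OF \<delta>_pow_closed])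
  then have "elt a b j (Suc (n + k)) P f = elt a b j (n + k) P f \<oplus> \<zero>"
    by (simp only: elt_Suc[OF B_smooth(1)[OF P] B_smooth(2)[OF f]])
  also have "\<dots> = elt a b j (n + k) P f"
    by (rule r_zero[OF elt_closed[OF B_smooth(1)[OF P] B_smooth(2)[OF f]]])
  finally show ?case using Suc.IH by simp
qed simp

lemma coeffs_elt:
  assumes P: "\<And>i. P i \<in> B1 a b" and zero: "\<And>i. i > n \<Longrightarrow> P i = zero1 a b" and f: "f \<in> B2 a b"
  shows "coeffs a b j (elt a b j n P f) = P"
  unfolding coeffs_def
proof (rule the_equality)
  show "\<exists>m. \<exists>g\<in>B2 a b. (\<forall>i. P i \<in> B1 a b) \<and> (\<forall>i>m. P i = zero1 a b) \<and> elt a b j n P f = elt a b j m P g"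
    using assms by blast
  fix Q assume "\<exists>m. \<exists>g\<in>B2 a b. (\<forall>i. Q i \<in> B1 a b) \<and> (\<forall>i>m. Q i = zero1 a b) \<and> elt a b j n P f = elt a b j m Q g"
  then obtain m g where Q: "\<And>i. Q i \<in> B1 a b" "\<And>i. i > m \<Longrightarrow> Q i = zero1 a b" and g: "g \<in> B2 a b"
    and eq: "elt a b j n P f = elt a b j m Q g" by blast
  \<comment> \<open>Padding with zero coefficients brings two representations of different lengths to the same length.\<close>
  have eq': "elt a b j (n + m) P f = elt a b j (n + m) Q g"
    using elt_pad[where P = P and n = n and k = m, OF P zero f] elt_pad[where P = Q and n = m and k = n, OF Q g] eq by (simp add: Groups.add.commute)
  have "Q i = P i" for i
  proof (cases "i \<le> n + m")
    case True
    show ?thesis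
    proof (rule extensionalityI[of _ "{a..b}"])
      show "Q i \<in> extensional {a..b}" "P i \<in> extensional {a..b}" using P Q(1) by (auto simp: B1_def)
      show "Q i x = P i x" if "x \<in> {a..b}" for x
        by (rule elt_eq_imp_coefficients_eq[OF B_smooth(1)[OF P] B_smooth(2)[OF f] B_smooth(1)[OF Q(1)]
            B_smooth(2)[OF g] eq' True that, symmetric])
    qed
  next
    case False
    then show ?thesis using zero Q(2) by simp
  qed
  then show "Q = P" by blast
qed

lemma B1_plus_ne_zero1: "P \<in> B1_plus a b \<Longrightarrow> P \<noteq> zero1 a b"
proof
  assume "P \<in> B1_plus a b" "P = zero1 a b"
  then show False using less by (auto simp: B1_plus_def zero1_def dest: bspec[of _ _ a])
qed

lemma deg_Coef_elt:
  assumes P: "\<And>i. P i \<in> B1 a b" and zero: "\<And>i. i > n \<Longrightarrow> P i = zero1 a b" and f: "f \<in> B2 a b"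
    and top: "P n \<in> B1_plus a b"
  shows "deg a b j (elt a b j n P f) = n" "Coef a b j (elt a b j n P f) = P n"
proof -
  have c: "coeffs a b j (elt a b j n P f) = P" by (rule coeffs_elt) (simp_all add: P zero f)
  show d: "deg a b j (elt a b j n P f) = n"
  proof (cases "n = 0")
    case True
    then have "\<forall>i\<ge>1. P i = zero1 a b" using zero by simp
    then show ?thesis using True unfolding deg_def c by simp
  next
    case False
    have "(GREATEST i. 1 \<le> i \<and> P i \<noteq> zero1 a b) = n"
      using False zero B1_plus_ne_zero1[OF top] by (intro Greatest_equality) (auto simp: not_less[symmetric])
    moreover have "\<not> (\<forall>i\<ge>1. P i = zero1 a b)" using False B1_plus_ne_zero1[OF top] by auto
    ultimately show ?thesis unfolding deg_def c by (simp only: if_False)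
  qed
  show "Coef a b j (elt a b j n P f) = P n" unfolding Coef_def d c ..
qed

lemma coefficient_zero_above_deg:
  assumes P: "\<And>i. P i \<in> B1 a b" and zero: "\<And>i. i > n \<Longrightarrow> P i = zero1 a b" and f: "f \<in> B2 a b"
    and i: "i > deg a b j (elt a b j n P f)"
  shows "P i = zero1 a b"
proof (rule ccontr)
  assume ne: "P i \<noteq> zero1 a b"
  have c: "coeffs a b j (elt a b j n P f) = P" by (rule coeffs_elt) (simp_all add: P zero f)
  have "1 \<le> i \<and> P i \<noteq> zero1 a b" using i ne by auto
  moreover have "k \<le> n" if "1 \<le> k \<and> P k \<noteq> zero1 a b" for k
    using zero[of k] that not_less by blast
  ultimately have "i \<le> (GREATEST i. 1 \<le> i \<and> P i \<noteq> zero1 a b)" by (rule Greatest_le_nat)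
  then show False using i ne unfolding deg_def c by (auto split: if_splits)
qed

lemma carrier_elt_form:
  assumes "x \<in> carrier I"
  obtains n P f where "\<forall>i. P i \<in> B1 a b" "\<forall>i>n. P i = zero1 a b" "f \<in> B2 a b" "x = elt a b j n P f"
proof -
  obtain P g n where P: "smooth1 P" "smooth2 g" "x = vol P g \<otimes> \<delta> [^] (n :: nat)" by (rule carrier_form[OF assms])
  show ?thesis using leading_form_eq_elt[OF P(1,2), of n] that P(3) by metis
qed

text \<open>This translates the conditions on degree and leading coefficient into membership in the cosets of
\<open>Order0\<close>, with which the group theory works. Both directions rest on the uniqueness of coefficients.\<close>

lemma deg_Coef_iff:
  assumes x: "x \<in> carrier I"
  shows "deg a b j x = n \<and> Coef a b j x \<in> B1_plus a b \<longleftrightarrow> (\<exists>e\<in>Order0. x = e \<otimes> \<delta> [^] n)"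
proof
  assume "deg a b j x = n \<and> Coef a b j x \<in> B1_plus a b"
  then have deg: "deg a b j x = n" and Coef: "Coef a b j x \<in> B1_plus a b" by auto
  obtain m P f where "\<forall>i. P i \<in> B1 a b" "\<forall>i>m. P i = zero1 a b" and f: "f \<in> B2 a b"
    and xm: "x = elt a b j m P f" by (rule carrier_elt_form[OF x])
  then have P: "\<And>i. P i \<in> B1 a b" "\<And>i. i > m \<Longrightarrow> P i = zero1 a b" by simp_all
  have zero: "P i = zero1 a b" if "i > n" for i
    using coefficient_zero_above_deg[where P = P and n = m, OF P f] that deg unfolding xm by blast
  have xn: "x = elt a b j n P f"
    using elt_pad[where P = P and n = m and k = n, OF P f] elt_pad[where P = P and n = n and k = m, OF P(1) zero f] xm by (simp add: Groups.add.commute)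
  have "Coef a b j x = P n"
    using coeffs_elt[where P = P and n = m, OF P f] deg unfolding Coef_def xm by simp
  then have nz: "P n y \<noteq> 0" if "y \<in> {a..b}" for y using Coef that by (auto simp: B1_plus_def)
  obtain g where g: "smooth2 g" "elt a b j n P f = vol (P n) g \<otimes> \<delta> [^] n"
    by (rule elt_eq_leading_form[OF B_smooth(1)[OF P(1)] B_smooth(2)[OF f]])
  have "vol (P n) g \<in> Order0" by (rule Order0_I[OF B_smooth(1)[OF P(1)] g(1) nz])
  then show "\<exists>e\<in>Order0. x = e \<otimes> \<delta> [^] n" using xn g(2) by blast
next
  assume "\<exists>e\<in>Order0. x = e \<otimes> \<delta> [^] n"
  then obtain P g where P: "smooth1 P" "smooth2 g" "\<forall>y\<in>{a..b}. P y \<noteq> 0" "x = vol P g \<otimes> \<delta> [^] n"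
    by (auto simp: Order0_def)
  obtain Q f where Q: "\<And>i. Q i \<in> B1 a b" "\<And>i. i > n \<Longrightarrow> Q i = zero1 a b" and f: "f \<in> B2 a b"
    and Qn: "Q n = restrict P {a..b}" and xe: "x = elt a b j n Q f"
    using leading_form_eq_elt[OF P(1,2), of n] P(4) by metis
  have top: "Q n \<in> B1_plus a b" using Q(1)[of n] P(3) Qn by (simp add: B1_plus_def)
  show "deg a b j x = n \<and> Coef a b j x \<in> B1_plus a b"
    unfolding xe using deg_Coef_elt[where P = Q and n = n, OF Q f top] top by simp
qed

lemma leading_form_closed: "e \<in> Order0 \<Longrightarrow> e \<otimes> \<delta> [^] (n :: nat) \<in> carrier I"
  by (intro m_closed Order0_closed \<delta>_pow_closed)

section \<open>The generated group\<close>

lemma W1_eq: "W1 a b I j = Order0"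
proof -
  have "x \<in> W1 a b I j \<longleftrightarrow> x \<in> Order0" for x
    using deg_Coef_iff[of x 0] Order0_closed by (auto simp: W1_def)
  then show ?thesis by blast
qed

lemma W2_eq: "W2 a b I j = {e \<otimes> \<delta> [^] n | e n. e \<in> Order0 \<and> 1 \<le> (n :: nat)}"
proof -
  have "x \<in> W2 a b I j \<longleftrightarrow> (\<exists>e n. x = e \<otimes> \<delta> [^] n \<and> e \<in> Order0 \<and> 1 \<le> (n :: nat))" for x
  proof
    assume "x \<in> W2 a b I j"
    then have x: "x \<in> carrier I" "1 \<le> deg a b j x" "Coef a b j x \<in> B1_plus a b" by (simp_all add: W2_def)
    then obtain e where "e \<in> Order0" "x = e \<otimes> \<delta> [^] deg a b j x" using deg_Coef_iff[OF x(1), of "deg a b j x"] by auto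
    then show "\<exists>e n. x = e \<otimes> \<delta> [^] n \<and> e \<in> Order0 \<and> 1 \<le> (n :: nat)" using x(2) by blast
  next
    assume "\<exists>e n. x = e \<otimes> \<delta> [^] n \<and> e \<in> Order0 \<and> 1 \<le> (n :: nat)"
    then obtain e n where e: "x = e \<otimes> \<delta> [^] n" "e \<in> Order0" "1 \<le> (n :: nat)" by blast
    then have "x \<in> carrier I" by (simp add: leading_form_closed)
    moreover from this have "deg a b j x = n \<and> Coef a b j x \<in> B1_plus a b" using deg_Coef_iff e by blast
    ultimately show "x \<in> W2 a b I j" using e(3) by (simp add: W2_def)
  qed
  then show ?thesis by blast
qed

text \<open>An operator \<open>P + f \<theta>\<close> is of type 2 unless \<open>f \<theta> = 0\<close>, and in that case it equals \<open>P\<close>, of type 1.\<close>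

lemma type12_eq: "type1 a b j \<union> type2 a b I j = Order0"
proof (intro equalityI subsetI)
  fix x assume "x \<in> type1 a b j \<union> type2 a b I j"
  then obtain P f where "P \<in> B1_plus a b" "f \<in> B2 a b" "x = vol P f"
    using zero_in_B(2) by (auto simp: type1_def type2_def elt_0)
  then show "x \<in> Order0" by (auto simp: B1_plus_def intro!: Order0_I B_smooth)
next
  fix x assume "x \<in> Order0"
  then obtain P f where P: "smooth1 P" "\<forall>y\<in>{a..b}. P y \<noteq> 0" and f: "smooth2 f" and x: "x = vol P f"
    by (auto simp: Order0_def)
  let ?P = "restrict P {a..b}" and ?f = "restrict f (triangle a b)"
  have P': "?P \<in> B1_plus a b" using smooth_restrict(1)[OF P(1)] P(2) by (simp add: B1_plus_def)
  have f': "?f \<in> B2 a b" by (rule smooth_restrict(2)[OF f])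
  have x': "x = vol ?P ?f" unfolding x by (rule vol_cong) simp_all
  show "x \<in> type1 a b j \<union> type2 a b I j"
  proof (cases "elt a b j 0 (\<lambda>_. zero1 a b) ?f = \<zero>")
    case True
    have "vol (\<lambda>_. 0) f = vol (zero1 a b) ?f" by (rule vol_cong) (simp_all add: zero1_def)
    with True have "vol (\<lambda>_. 0) f = \<zero>" by (simp add: elt_0)
    then have "x = vol P (\<lambda>_. 0)"
      using vol_split[OF P(1) f] vol_closed[OF P(1) smooth_intros(4)] by (simp add: x)
    also have "\<dots> = vol ?P (zero2 a b)" by (rule vol_cong) (simp_all add: zero2_def)
    finally show ?thesis using P' by (auto simp: type1_def elt_0)
  next
    case False
    then show ?thesis using P' f' x' by (auto simp: type2_def elt_0)
  qed
qed

lemma type3_eq: "type3 a b j = {e \<otimes> \<delta> [^] n | e n. e \<in> Order0 \<and> 1 \<le> (n :: nat)}"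
proof (intro equalityI subsetI)
  fix x assume "x \<in> type3 a b j"
  then obtain n P f where n: "1 \<le> n" and P: "\<And>i. i \<le> n \<Longrightarrow> P i \<in> B1 a b" "P n \<in> B1_plus a b"
    and f: "f \<in> B2 a b" and x: "x = elt a b j n P f" by (auto simp: type3_def)
  obtain g where g: "smooth2 g" "elt a b j n P f = vol (P n) g \<otimes> \<delta> [^] n"
    by (rule elt_eq_leading_form[OF B_smooth(1)[OF P(1)] B_smooth(2)[OF f]])
  have "vol (P n) g \<in> Order0" by (rule Order0_I[OF B_smooth(1)[OF P(1)[OF order_refl]] g(1)]) (use P(2) in \<open>simp add: B1_plus_def\<close>)
  then show "x \<in> {e \<otimes> \<delta> [^] n | e n. e \<in> Order0 \<and> 1 \<le> (n :: nat)}" using x g(2) n by blast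
next
  fix x assume "x \<in> {e \<otimes> \<delta> [^] n | e n. e \<in> Order0 \<and> 1 \<le> (n :: nat)}"
  then obtain P g n where P: "smooth1 P" "smooth2 g" "\<forall>y\<in>{a..b}. P y \<noteq> 0" "x = vol P g \<otimes> \<delta> [^] n"
    and n: "1 \<le> (n :: nat)" by (auto simp: Order0_def)
  obtain Q f where Q: "\<And>i. Q i \<in> B1 a b" and f: "f \<in> B2 a b"
    and Qn: "Q n = restrict P {a..b}" and x: "x = elt a b j n Q f"
    using leading_form_eq_elt[OF P(1,2), of n] P(4) by metis
  have "Q n \<in> B1_plus a b" using Q[of n] P(3) Qn by (simp add: B1_plus_def)
  then show "x \<in> type3 a b j" using Q f n x unfolding type3_def by blast
qed

lemma units_of_nat_pow: "x [^]\<^bsub>units_of I\<^esub> (n :: nat) = x [^] n"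
  by (induction n) (simp_all add: units_of_mult units_of_one)

lemma Order0_\<delta>_commute_left:
  assumes "e \<in> Order0"
  shows "\<exists>e'\<in>Order0. \<delta> \<otimes> e = e' \<otimes> \<delta>"
proof -
  obtain P f where P: "smooth1 P" "smooth2 f" "\<forall>x\<in>{a..b}. P x \<noteq> 0" and e: "e = vol P f"
    using assms by (auto simp: Order0_def)
  obtain g where g: "smooth2 g" "\<delta> \<otimes> vol P f = vol P g \<otimes> \<delta>" by (rule \<delta>_vol_commute_left[OF P(1,2)])
  have "vol P g \<in> Order0" by (rule Order0_I[OF P(1) g(1)]) (use P(3) in blast)
  then show ?thesis unfolding e using g(2) by blast
qed

lemma Order0_\<delta>_commute_right:
  assumes "e \<in> Order0"
  shows "\<exists>e'\<in>Order0. e \<otimes> \<delta> = \<delta> \<otimes> e'"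
proof -
  obtain P f where P: "smooth1 P" "smooth2 f" "\<forall>x\<in>{a..b}. P x \<noteq> 0" and e: "e = vol P f"
    using assms by (auto simp: Order0_def)
  obtain g where g: "smooth2 g" "vol P f \<otimes> \<delta> = \<delta> \<otimes> vol P g" by (rule \<delta>_vol_commute_right[OF P(1,2)])
  have "vol P g \<in> Order0" by (rule Order0_I[OF P(1) g(1)]) (use P(3) in blast)
  then show ?thesis unfolding e using g(2) by blast
qed

lemma U_eq: "U a b I j = W1 a b I j \<union> W2 a b I j \<union> W3 a b I j"
proof -
  interpret G: group "units_of I" by (rule units_group)
  interpret Order0: subgroup Order0 "units_of I" by (rule Order0_subgroup)
  let ?H = "{e \<otimes> \<delta> [^] n | e n. e \<in> Order0 \<and> n \<in> (UNIV :: nat set)}"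
  have H: "?H = W1 a b I j \<union> W2 a b I j"
  proof (intro equalityI subsetI)
    fix x assume "x \<in> ?H"
    then obtain e n where e: "e \<in> Order0" "x = e \<otimes> \<delta> [^] (n :: nat)" by blast
    show "x \<in> W1 a b I j \<union> W2 a b I j"
    proof (cases "n = 0")
      case True
      then show ?thesis using e Order0_closed by (simp add: W1_eq)
    next
      case False
      then have "1 \<le> n" by simp
      then show ?thesis using e unfolding W2_eq by blast
    qed
  next
    fix x assume "x \<in> W1 a b I j \<union> W2 a b I j"
    moreover have "x \<in> ?H" if "x \<in> Order0"
    proof -
      have "x = x \<otimes> \<delta> [^] (0 :: nat)" using Order0_closed[OF that] by simp
      then show ?thesis using that by blast
    qed
    ultimately show "x \<in> ?H" unfolding W1_eq W2_eq by blast
  qed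
  have sub: "{u \<in> Units I. inv u \<in> Order0} \<subseteq> Order0"
  proof
    fix u assume "u \<in> {u \<in> Units I. inv u \<in> Order0}"
    then have u: "u \<in> Units I" "inv u \<in> Order0" by simp_all
    have "inv\<^bsub>units_of I\<^esub> (inv u) \<in> Order0" by (rule Order0.m_inv_closed[OF u(2)])
    then show "u \<in> Order0" using u(1) by (simp add: units_of_inv)
  qed
  have "U a b I j = generate (units_of I) ?H"
    unfolding U_def H W1_eq W2_eq type12_eq type3_eq ..
  also have "\<dots> = ?H \<union> {u \<in> carrier (units_of I). inv\<^bsub>units_of I\<^esub> u \<in> ?H}"
    using G.generate_by_powers_of_normalizing_element[OF Order0_subgroup, of \<delta>]
      \<delta>_unit Order0_\<delta>_commute_left Order0_\<delta>_commute_right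
    by (simp add: units_of_carrier units_of_mult units_of_nat_pow)
  also have "{u \<in> carrier (units_of I). inv\<^bsub>units_of I\<^esub> u \<in> ?H} = {u \<in> Units I. inv u \<in> Order0} \<union> W3 a b I j"
  proof -
    have "inv u \<in> W2 a b I j \<longleftrightarrow> 1 \<le> deg a b j (inv u) \<and> Coef a b j (inv u) \<in> B1_plus a b"
      if "u \<in> Units I" for u
      using that by (simp add: W2_def)
    then show ?thesis
      unfolding H W1_eq W3_def by (auto simp: units_of_carrier units_of_inv)
  qed
  also have "?H \<union> ({u \<in> Units I. inv u \<in> Order0} \<union> W3 a b I j) = W1 a b I j \<union> W2 a b I j \<union> W3 a b I j"
    using sub unfolding H W1_eq by blast
  finally show ?thesis .
qed

end

theorem proposition4:
  fixes a b :: real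
    and I :: "('i, 'm) ring_scheme"
    and j :: "operator \<Rightarrow> 'i"
  assumes "a < b"
    and "ring I"
    and "j \<in> ring_iso (I_M a b) I"
  shows "U a b I j = W1 a b I j \<union> W2 a b I j \<union> W3 a b I j"
proof -
  interpret integro_differential_ring a b I j
    by (intro integro_differential_ring.intro nondegenerate_interval.intro
        integro_differential_ring_axioms.intro assms)
  show ?thesis by (rule U_eq)
qed

end
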